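(* Let $E,F$ be complex Banach spaces, $U\subseteq E$ open, $v$ a weight on $U$, $p\in(1,\infty)$, and $f\in\mathcal H_v^\infty(U,F)$. Let $(\mathcal I,i)$ be either $(\mathcal K_p,p)$ or $(\mathcal K_{up},up)$. The following are equivalent: (i) $f\in\mathcal H^\infty_{v\mathcal I}(U,F)$; (ii) $f^t\in\mathcal{QN}_i(F^*,\mathcal H_v^\infty(U))$. In this case, $\|f\|_{\mathcal H^\infty_{v\mathcal I}}=\|f^t\|_{\mathcal{QN}_i}$.
   Context: A weight on $U$ is a strictly positive continuous function. $\mathcal H_v^\infty(U,F)$ is the Banach space of holomorphic $f\colon U\to F$ with $\|f\|_v:=\sup_{x\in U}v(x)\|f(x)\|<\infty$; $\mathcal H_v^\infty(U):=\mathcal H_v^\infty(U,\mathbb C)$. The transpose of $f\in\mathcal H_v^\infty(U,F)$ is the bounded linear operator $f^t\colon F^*\to\mathcal H_v^\infty(U)$, $f^t(y^* )=y^*\circ f$. $p^*$ is the conjugate index of $p$. Sequences in a Banach space $X$: $\ell_p(X)$ is the space of sequences with $\|(x_n)\|_p=(\sum\|x_n\|^p)^{1/p}<\infty$; $\ell_p^w(X)$ of those with $\|(x_n)\|_p^w=\sup_{x^*\in B_{X^*}}(\sum|x^*(x_n)|^p)^{1/p}<\infty$; $\ell_p^u(X)$ of those $(x_n)\in\ell_p^w(X)$ with $\|(x_n)_{n\ge m}\|_p^w\to0$ as $m\to\infty$. $p\text{-}\mathrm{conv}(x_n)=\{\sum_n a_nx_n:(a_n)\in B_{\ell_{p^*}}\}$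 for $1<p<\infty$. A set $K\subseteq X$ is relatively $p$-compact (resp. relatively unconditionally $p$-compact) if $K\subseteq p\text{-}\mathrm{conv}(x_n)$ for some $(x_n)$ in $\ell_p(X)$ (resp. $\ell_p^u(X)$); $m_{\mathcal K_p}(K)$ (resp. $m_{\mathcal K_{up}}(K)$) is the infimum over all such sequences of $\|(x_n)\|_p$ (resp. $\|(x_n)\|_p^w$). For $\mathcal I=\mathcal K_p$ (resp. $\mathcal K_{up}$), $\mathcal H^\infty_{v\mathcal I}(U,F)$ is the set of $f\in\mathcal H_v^\infty(U,F)$ such that $(vf)(U)=\{v(x)f(x):x\in U\}$ is relatively $p$-compact (resp. relatively unconditionally $p$-compact), with $\|f\|_{\mathcal H^\infty_{v\mathcal I}}=m_{\mathcal I}((vf)(U))$. A bounded linear operator $T\colon X\to Y$ is quasi $p$-nuclear, $T\in\mathcal{QN}_p(X,Y)$ (resp. quasi unconditionally $p$-nuclear, $T\in\mathcal{QN}_{up}(X,Y)$) if there is $(x_n^* )\in\ell_p(X^* )$ (resp. $(x_n^* )\in\ell_p^u(X^* )$) with $\|T(x)\|\le\|(x_n^*(x))\|_p$ for all $x\in X$; $\|T\|_{\mathcal{QN}_p}$ (resp. $\|T\|_{\mathcal{QN}_{up}}$) is the infimum of $\|(x_n^* )\|_p$ (resp. $\|(x_n^* )\|_p^w$) over all such sequences. *)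

theory Defs
  imports "HOL-Analysis.Analysis" "HOL-Library.Function_Algebras"
begin

section \<open>Complex Banach spaces\<close>

class scaleC =
  fixes scaleC :: "complex \<Rightarrow> 'a \<Rightarrow> 'a" (infixr "*\<^sub>C" 75)

class complex_vector = scaleC + ab_group_add +
  assumes scaleC_add_right: "a *\<^sub>C (x + y) = a *\<^sub>C x + a *\<^sub>C y"
    and scaleC_add_left: "(a + b) *\<^sub>C x = a *\<^sub>C x + b *\<^sub>C x"
    and scaleC_scaleC: "a *\<^sub>C b *\<^sub>C x = (a * b) *\<^sub>C x"
    and scaleC_one: "1 *\<^sub>C x = x"

class complex_normed_vector = complex_vector + real_normed_vector +
  assumes scaleR_scaleC: "r *\<^sub>R x = complex_of_real r *\<^sub>C x"
    and norm_scaleC: "norm (a *\<^sub>C x) = cmod a * norm x"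

class cbanach = complex_normed_vector + banach

instantiation complex :: cbanach
begin

definition scaleC_complex :: "complex \<Rightarrow> complex \<Rightarrow> complex"
  where "scaleC_complex a x = a * x"

instance
  by standard (simp_all add: scaleC_complex_def algebra_simps scaleR_conv_of_real norm_mult)

end

instantiation "fun" :: (type, complex_vector) complex_vector
begin

definition scaleC_fun :: "complex \<Rightarrow> ('a \<Rightarrow> 'b) \<Rightarrow> 'a \<Rightarrow> 'b"
  where "scaleC_fun a f = (\<lambda>x. a *\<^sub>C f x)"

instance
  by standard
    (simp_all add: scaleC_fun_def fun_eq_iff scaleC_add_right scaleC_add_left scaleC_scaleC
      scaleC_one)

end

interpretation complex_vector_space:
  vector_space "scaleC :: complex \<Rightarrow> 'a \<Rightarrow> 'a::complex_vector"
  by standard (simp_all add: scaleC_add_right scaleC_add_left scaleC_scaleC scaleC_one)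

abbreviation clinear :: "('a::complex_vector \<Rightarrow> 'b::complex_vector) \<Rightarrow> bool"
  where "clinear \<equiv> Vector_Spaces.linear scaleC scaleC"

lemma clinear_iff:
  "clinear f \<longleftrightarrow> (\<forall>x y. f (x + y) = f x + f y) \<and> (\<forall>a x. f (a *\<^sub>C x) = a *\<^sub>C f x)"
  unfolding Vector_Spaces.linear_def module_hom_def module_hom_axioms_def
  by (simp add: complex_vector_space.vector_space_axioms complex_vector_space.module_axioms)


section \<open>The dual space\<close>

typedef (overloaded) 'a cdual =
  "{\<phi> :: 'a::complex_normed_vector \<Rightarrow>\<^sub>L complex. clinear (blinfun_apply \<phi>)}"
  morphisms blinfun_of_cdual cdual_of_blinfun
  by (rule exI[of _ 0]) (simp add: clinear_iff)

setup_lifting type_definition_cdual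

lift_definition cdual_apply :: "'a::complex_normed_vector cdual \<Rightarrow> 'a \<Rightarrow> complex"
  is blinfun_apply .

instantiation cdual :: (complex_normed_vector) complex_normed_vector
begin

lift_definition zero_cdual :: "'a cdual" is 0
  by (simp add: clinear_iff)

lift_definition plus_cdual :: "'a cdual \<Rightarrow> 'a cdual \<Rightarrow> 'a cdual" is "(+)"
  by (simp add: clinear_iff blinfun.add_left scaleC_add_right algebra_simps)

lift_definition minus_cdual :: "'a cdual \<Rightarrow> 'a cdual \<Rightarrow> 'a cdual" is "(-)"
  by (simp add: clinear_iff blinfun.diff_left scaleC_complex_def algebra_simps)

lift_definition uminus_cdual :: "'a cdual \<Rightarrow> 'a cdual" is uminus
  by (simp add: clinear_iff blinfun.minus_left scaleC_complex_def)

lift_definition scaleR_cdual :: "real \<Rightarrow> 'a cdual \<Rightarrow> 'a cdual" is scaleR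
  by (simp add: clinear_iff blinfun.scaleR_left scaleC_complex_def algebra_simps)

lift_definition scaleC_cdual :: "complex \<Rightarrow> 'a cdual \<Rightarrow> 'a cdual"
  is "\<lambda>a \<phi>. blinfun_compose (blinfun_mult_right a) \<phi>"
  by (simp add: clinear_iff scaleC_complex_def algebra_simps)

text \<open>The operator norm of the underlying bounded functional.\<close>
lift_definition norm_cdual :: "'a cdual \<Rightarrow> real" is norm .

definition dist_cdual :: "'a cdual \<Rightarrow> 'a cdual \<Rightarrow> real"
  where "dist_cdual \<phi> \<psi> = norm (\<phi> - \<psi>)"

definition sgn_cdual :: "'a cdual \<Rightarrow> 'a cdual"
  where "sgn_cdual \<phi> = scaleR (inverse (norm \<phi>)) \<phi>"

definition uniformity_cdual :: "('a cdual \<times> 'a cdual) filter"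
  where "uniformity_cdual = (INF e\<in>{0<..}. principal {(\<phi>, \<psi>). dist \<phi> \<psi> < e})"

definition open_cdual :: "'a cdual set \<Rightarrow> bool"
  where "open_cdual S \<longleftrightarrow> (\<forall>\<phi>\<in>S. \<forall>\<^sub>F (\<phi>', \<psi>) in uniformity. \<phi>' = \<phi> \<longrightarrow> \<psi> \<in> S)"

instance
proof
  fix \<phi> \<psi> \<chi> :: "'a cdual" and a b :: complex and r s :: real
  show "a *\<^sub>C (\<phi> + \<psi>) = a *\<^sub>C \<phi> + a *\<^sub>C \<psi>"
    by transfer (auto intro!: blinfun_eqI simp: blinfun.add_left algebra_simps)
  show "(a + b) *\<^sub>C \<phi> = a *\<^sub>C \<phi> + b *\<^sub>C \<phi>"
    by transfer (auto intro!: blinfun_eqI simp: blinfun.add_left algebra_simps)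
  show "a *\<^sub>C b *\<^sub>C \<phi> = (a * b) *\<^sub>C \<phi>"
    by transfer (auto intro!: blinfun_eqI)
  show "1 *\<^sub>C \<phi> = \<phi>"
    by transfer (auto intro!: blinfun_eqI)
  show "r *\<^sub>R \<phi> = complex_of_real r *\<^sub>C \<phi>"
    by transfer (auto intro!: blinfun_eqI simp: blinfun.scaleR_left scaleR_conv_of_real)
  show "norm (a *\<^sub>C \<phi>) = cmod a * norm \<phi>"
  proof transfer
    fix a and \<phi> :: "'a \<Rightarrow>\<^sub>L complex"
    have *: "norm (blinfun_mult_right c o\<^sub>L \<psi>) \<le> cmod c * norm \<psi>" for c and \<psi> :: "'a \<Rightarrow>\<^sub>L complex"
      by (rule norm_blinfun_bound)
        (auto simp: norm_mult mult.assoc intro!: mult_left_mono norm_blinfun)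
    show "norm (blinfun_mult_right a o\<^sub>L \<phi>) = cmod a * norm \<phi>"
    proof (cases "a = 0")
      case True
      have "norm (blinfun_mult_right a o\<^sub>L \<phi>) \<le> 0"
        using *[of a \<phi>] True by simp
      then show ?thesis using True by simp
    next
      case False
      have eq: "blinfun_mult_right (inverse a) o\<^sub>L (blinfun_mult_right a o\<^sub>L \<phi>) = \<phi>"
        using False by (auto intro!: blinfun_eqI)
      have "norm \<phi> \<le> cmod (inverse a) * norm (blinfun_mult_right a o\<^sub>L \<phi>)"
        using *[of "inverse a" "blinfun_mult_right a o\<^sub>L \<phi>"] eq by simp
      then have "cmod a * norm \<phi> \<le> norm (blinfun_mult_right a o\<^sub>L \<phi>)"
        using False by (simp add: norm_divide field_simps)
      then show ?thesis using *[of a \<phi>] by simp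
    qed
  qed
  show "dist \<phi> \<psi> = norm (\<phi> - \<psi>)" by (rule dist_cdual_def)
  show "sgn \<phi> = scaleR (inverse (norm \<phi>)) \<phi>" by (rule sgn_cdual_def)
  show "uniformity = (INF e\<in>{0<..}. principal {(\<phi> :: 'a cdual, \<psi>). dist \<phi> \<psi> < e})"
    by (rule uniformity_cdual_def)
  show "open S \<longleftrightarrow> (\<forall>\<phi>\<in>S. \<forall>\<^sub>F (\<phi>', \<psi>) in uniformity. \<phi>' = \<phi> \<longrightarrow> \<psi> \<in> S)" for S :: "'a cdual set"
    by (rule open_cdual_def)
  show "norm (\<phi> + \<psi>) \<le> norm \<phi> + norm \<psi>"
    by transfer (rule norm_triangle_ineq)
qed (transfer; simp add: algebra_simps)+

end

instance cdual :: (complex_normed_vector) cbanach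
proof
  fix X :: "nat \<Rightarrow> 'a cdual"
  assume "Cauchy X"
  define Y where "Y n = blinfun_of_cdual (X n)" for n
  have dist_Y: "dist (Y m) (Y n) = dist (X m) (X n)" for m n
    by (simp add: Y_def dist_norm norm_cdual.rep_eq minus_cdual.rep_eq)
  have "Cauchy Y"
    using \<open>Cauchy X\<close> by (simp add: Cauchy_def dist_Y)
  then obtain L where L: "Y \<longlonglongrightarrow> L"
    by (meson Cauchy_convergent convergent_def)
  have lin_Y: "clinear (blinfun_apply (Y n))" for n
    using blinfun_of_cdual by (auto simp: Y_def)
  have lim: "(\<lambda>n. Y n x) \<longlonglongrightarrow> L x" for x
    by (intro blinfun.tendsto L tendsto_const)
  have "L (a *\<^sub>C x) = a *\<^sub>C L x" for a x
  proof (rule LIMSEQ_unique[OF lim])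
    show "(\<lambda>n. Y n (a *\<^sub>C x)) \<longlonglongrightarrow> a *\<^sub>C L x"
      using lin_Y by (auto simp: clinear_iff scaleC_complex_def intro!: tendsto_mult lim)
  qed
  then have "clinear (blinfun_apply L)"
    by (simp add: clinear_iff blinfun.add_right)
  then have L': "blinfun_of_cdual (cdual_of_blinfun L) = L"
    by (simp add: cdual_of_blinfun_inverse)
  have "dist (X n) (cdual_of_blinfun L) = dist (Y n) L" for n
    by (simp add: Y_def dist_norm norm_cdual.rep_eq minus_cdual.rep_eq L')
  then have "X \<longlonglongrightarrow> cdual_of_blinfun L"
    using L by (simp add: tendsto_iff)
  then show "convergent X"
    by (auto simp: convergent_def)
qed


section \<open>Sequence spaces and \<open>p\<close>-compact sets\<close>

definition lp :: "real \<Rightarrow> (nat \<Rightarrow> 'a::complex_normed_vector) set"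
  where "lp p = {x. summable (\<lambda>n. norm (x n) powr p)}"

definition lp_norm :: "real \<Rightarrow> (nat \<Rightarrow> 'a::complex_normed_vector) \<Rightarrow> real"
  where "lp_norm p x = (\<Sum>n. norm (x n) powr p) powr (1 / p)"

definition lpw :: "real \<Rightarrow> (nat \<Rightarrow> 'a::complex_normed_vector) set"
  where "lpw p = {x. (\<forall>\<phi>\<in>cball 0 1. (\<lambda>n. cdual_apply \<phi> (x n)) \<in> lp p) \<and>
    bdd_above ((\<lambda>\<phi>. lp_norm p (\<lambda>n. cdual_apply \<phi> (x n))) ` cball 0 1)}"

definition lpw_norm :: "real \<Rightarrow> (nat \<Rightarrow> 'a::complex_normed_vector) \<Rightarrow> real"
  where "lpw_norm p x = (SUP \<phi>\<in>cball 0 1. lp_norm p (\<lambda>n. cdual_apply \<phi> (x n)))"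

definition lpu :: "real \<Rightarrow> (nat \<Rightarrow> 'a::complex_normed_vector) set"
  where "lpu p = {x \<in> lpw p. (\<lambda>m. lpw_norm p (\<lambda>n. x (n + m))) \<longlonglongrightarrow> 0}"

definition conj_index :: "real \<Rightarrow> real"
  where "conj_index p = p / (p - 1)"

definition p_conv :: "real \<Rightarrow> (nat \<Rightarrow> 'a::complex_normed_vector) \<Rightarrow> 'a set"
  where "p_conv p x = {s. \<exists>a. a \<in> lp (conj_index p) \<and> lp_norm (conj_index p) a \<le> 1 \<and>
    (\<lambda>n. a n *\<^sub>C x n) sums s}"

definition rel_p_compact :: "real \<Rightarrow> 'a::cbanach set \<Rightarrow> bool"
  where "rel_p_compact p K \<longleftrightarrow> (\<exists>x\<in>lp p. K \<subseteq> p_conv p x)"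

definition m_Kp :: "real \<Rightarrow> 'a::cbanach set \<Rightarrow> real"
  where "m_Kp p K = (INF x\<in>{x \<in> lp p. K \<subseteq> p_conv p x}. lp_norm p x)"

definition rel_up_compact :: "real \<Rightarrow> 'a::cbanach set \<Rightarrow> bool"
  where "rel_up_compact p K \<longleftrightarrow> (\<exists>x\<in>lpu p. K \<subseteq> p_conv p x)"

definition m_Kup :: "real \<Rightarrow> 'a::cbanach set \<Rightarrow> real"
  where "m_Kup p K = (INF x\<in>{x \<in> lpu p. K \<subseteq> p_conv p x}. lpw_norm p x)"


section \<open>Weighted spaces of holomorphic maps\<close>

definition weight_on :: "'e::cbanach set \<Rightarrow> ('e \<Rightarrow> real) \<Rightarrow> bool"
  where "weight_on U v \<longleftrightarrow> continuous_on U v \<and> (\<forall>x\<in>U. 0 < v x)"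

text \<open>Holomorphy on an open set is complex Frechet differentiability at every point.\<close>
definition holomorphic_map_on :: "('e::cbanach \<Rightarrow> 'f::cbanach) \<Rightarrow> 'e set \<Rightarrow> bool"
  where "holomorphic_map_on f U \<longleftrightarrow> (\<forall>x\<in>U. \<exists>D. clinear D \<and> (f has_derivative D) (at x))"

text \<open>A map on \<open>U\<close> is represented by its extension by \<open>0\<close> to the whole type, so that equality of
  elements of the space is equality on \<open>U\<close>.\<close>
definition Hv :: "'e::cbanach set \<Rightarrow> ('e \<Rightarrow> real) \<Rightarrow> ('e \<Rightarrow> 'f::cbanach) set"
  where "Hv U v = {f. holomorphic_map_on f U \<and> (\<forall>x. x \<notin> U \<longrightarrow> f x = 0) \<and>
    bdd_above ((\<lambda>x. v x * norm (f x)) ` U)}"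

text \<open>Inserting \<open>0\<close> makes the supremum \<open>0\<close> when \<open>U\<close> is empty and changes nothing otherwise.\<close>
definition Hv_norm :: "'e::cbanach set \<Rightarrow> ('e \<Rightarrow> real) \<Rightarrow> ('e \<Rightarrow> 'f::cbanach) \<Rightarrow> real"
  where "Hv_norm U v f = Sup (insert 0 ((\<lambda>x. v x * norm (f x)) ` U))"

definition Hv_Kp :: "'e::cbanach set \<Rightarrow> ('e \<Rightarrow> real) \<Rightarrow> real \<Rightarrow> ('e \<Rightarrow> 'f::cbanach) set"
  where "Hv_Kp U v p = {f \<in> Hv U v. rel_p_compact p ((\<lambda>x. v x *\<^sub>R f x) ` U)}"

definition Hv_Kp_norm :: "'e::cbanach set \<Rightarrow> ('e \<Rightarrow> real) \<Rightarrow> real \<Rightarrow> ('e \<Rightarrow> 'f::cbanach) \<Rightarrow> real"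
  where "Hv_Kp_norm U v p f = m_Kp p ((\<lambda>x. v x *\<^sub>R f x) ` U)"

definition Hv_Kup :: "'e::cbanach set \<Rightarrow> ('e \<Rightarrow> real) \<Rightarrow> real \<Rightarrow> ('e \<Rightarrow> 'f::cbanach) set"
  where "Hv_Kup U v p = {f \<in> Hv U v. rel_up_compact p ((\<lambda>x. v x *\<^sub>R f x) ` U)}"

definition Hv_Kup_norm :: "'e::cbanach set \<Rightarrow> ('e \<Rightarrow> real) \<Rightarrow> real \<Rightarrow> ('e \<Rightarrow> 'f::cbanach) \<Rightarrow> real"
  where "Hv_Kup_norm U v p f = m_Kup p ((\<lambda>x. v x *\<^sub>R f x) ` U)"

definition transpose_map :: "('e::cbanach \<Rightarrow> 'f::cbanach) \<Rightarrow> 'f cdual \<Rightarrow> 'e \<Rightarrow> complex"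
  where "transpose_map f = (\<lambda>y. cdual_apply y \<circ> f)"


section \<open>Quasi nuclear operators\<close>

text \<open>The space of weighted holomorphic functions depends on the set \<open>U\<close> and the weight \<open>v\<close> and is
  therefore not a type.  The codomain of an operator is given by a carrier \<open>Y\<close> inside a complex
  vector space together with a norm \<open>N\<close> on \<open>Y\<close>.\<close>
definition bounded_ops ::
    "'y set \<Rightarrow> ('y \<Rightarrow> real) \<Rightarrow> ('x::cbanach \<Rightarrow> 'y::complex_vector) set"
  where "bounded_ops Y N = {T. clinear T \<and> range T \<subseteq> Y \<and> (\<exists>C. \<forall>x. N (T x) \<le> C * norm x)}"

definition QNp ::
    "real \<Rightarrow> 'y set \<Rightarrow> ('y \<Rightarrow> real) \<Rightarrow> ('x::cbanach \<Rightarrow> 'y::complex_vector) set"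
  where "QNp p Y N = {T \<in> bounded_ops Y N.
    \<exists>\<phi>\<in>lp p. \<forall>x. N (T x) \<le> lp_norm p (\<lambda>n. cdual_apply (\<phi> n) x)}"

definition QNp_norm :: "real \<Rightarrow> ('y \<Rightarrow> real) \<Rightarrow> ('x::cbanach \<Rightarrow> 'y::complex_vector) \<Rightarrow> real"
  where "QNp_norm p N T =
    (INF \<phi>\<in>{\<phi> \<in> lp p. \<forall>x. N (T x) \<le> lp_norm p (\<lambda>n. cdual_apply (\<phi> n) x)}. lp_norm p \<phi>)"

definition QNup ::
    "real \<Rightarrow> 'y set \<Rightarrow> ('y \<Rightarrow> real) \<Rightarrow> ('x::cbanach \<Rightarrow> 'y::complex_vector) set"
  where "QNup p Y N = {T \<in> bounded_ops Y N.
    \<exists>\<phi>\<in>lpu p. \<forall>x. N (T x) \<le> lp_norm p (\<lambda>n. cdual_apply (\<phi> n) x)}"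

definition QNup_norm :: "real \<Rightarrow> ('y \<Rightarrow> real) \<Rightarrow> ('x::cbanach \<Rightarrow> 'y::complex_vector) \<Rightarrow> real"
  where "QNup_norm p N T =
    (INF \<phi>\<in>{\<phi> \<in> lpu p. \<forall>x. N (T x) \<le> lp_norm p (\<lambda>n. cdual_apply (\<phi> n) x)}. lpw_norm p \<phi>)"

end

theory Submission
  imports Defs
begin

text \<open>Put \<open>K = {v x *\<^sub>R f x | x. x \<in> U}\<close>.  The norm of \<open>transpose_map f y\<close> is the supremum of \<open>\<bar>y k\<bar>\<close>
  over \<open>k \<in> K\<close>, so a sequence whose \<open>p\<close>-convex hull contains \<open>K\<close> dominates the transpose by Hoelder's
  inequality, after embedding it into the bidual.  Conversely, Hahn-Banach turns a dominating
  sequence \<open>\<Phi>\<close> of the bidual into coefficients representing every \<open>k \<in> K\<close> as a combination of the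
  \<open>\<Phi> n\<close>.  Finitely many such representations are moved into the space itself, at an arbitrarily small
  cost in norm, by a Helly-type local reflexivity argument.  Since the coefficients are
  bounded and only finitely many of them matter up to a small tail, a finite net of \<open>K\<close> suffices:
  the differences to the net again lie in the space and are represented in the bidual by a sequence
  of small norm.  Iterating and joining the resulting finite blocks, scaled so that the norms add,
  gives the sequence in the space.\<close>

section \<open>The Hahn-Banach theorem\<close>

text \<open>The obstacle is twofold. Dominating sequences live in the bidual and can be moved into
  the space only for finitely many constraints at a time, while \<open>K\<close> and the sequence
  are infinite; and the two infima must agree exactly, so no constant factor may be lost. Hence only
  the first block may cost about \<open>A\<close>; every later one approximates remainders that are
  already small, at a cost prescribed in advance. The scheme closes because a remainder involves
  vectors of three kinds only: the finitely many errors at net points, an initial segment of the old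
  sequence with small coefficients, and its tail, which is small by \<open>pnull\<close>. This
  vanishing of tails is automatic for \<open>lp\<close> and is the defining extra condition of
  \<open>lpu\<close>; it also gives norm convergence in the space, where the bidual offers only
  weak-star convergence. Both kinds of summability reduce to finitely many norm constraints, so that
  one local reflexivity lemma serves both.\<close>

definition sublinear :: "('a::complex_vector \<Rightarrow> real) \<Rightarrow> bool"
  where "sublinear p \<longleftrightarrow> (\<forall>x y. p (x + y) \<le> p x + p y) \<and>
    (\<forall>t x. 0 < t \<longrightarrow> p (complex_of_real t *\<^sub>C x) \<le> t * p x)"

lemma scaleC_zero_right [simp]: "a *\<^sub>C (0::'a::complex_vector) = 0"
  by (rule complex_vector_space.scale_zero_right)

lemma scaleC_zero_left [simp]: "0 *\<^sub>C (x::'a::complex_vector) = 0"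
  by (rule complex_vector_space.scale_zero_left)

lemma scaleC_minus_one: "(-1) *\<^sub>C (x::'a::complex_vector) = - x"
  using complex_vector_space.scale_minus_left[of 1 x] by (simp add: scaleC_one)

lemma sublinear_zero:
  assumes "sublinear p"
  shows "p 0 = 0"
proof (rule antisym)
  have "p 0 \<le> (1/2) * p 0"
    using assms unfolding sublinear_def by (metis half_gt_zero_iff scaleC_zero_right zero_less_one)
  then show "p 0 \<le> 0" by simp
  have "p (0 + 0) \<le> p 0 + p 0" using assms unfolding sublinear_def by blast
  then show "0 \<le> p 0" by simp
qed

text \<open>The infimal convolution of \<open>p\<close> with the cone \<open>M\<close> of pairs (point, required lower bound).\<close>
lemma sublinear_reduct:
  fixes p :: "'a::complex_vector \<Rightarrow> real" and M :: "('a \<times> real) set"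
  assumes p: "sublinear p"
    and M0: "(0, 0) \<in> M"
    and Madd: "\<And>x a y b. (x, a) \<in> M \<Longrightarrow> (y, b) \<in> M \<Longrightarrow> (x + y, a + b) \<in> M"
    and Mscale: "\<And>x a t. (x, a) \<in> M \<Longrightarrow> 0 < t \<Longrightarrow> (complex_of_real t *\<^sub>C x, t * a) \<in> M"
    and Mle: "\<And>x a. (x, a) \<in> M \<Longrightarrow> a \<le> p x"
  obtains q where "sublinear q" "\<And>x. q x \<le> p x" "\<And>x a. (x, a) \<in> M \<Longrightarrow> q (- x) \<le> - a"
proof -
  define q where "q z = (INF m\<in>M. p (z + fst m) - snd m)" for z
  have padd: "p (x + y) \<le> p x + p y" for x y
    using p by (simp add: sublinear_def)
  have psc: "p (complex_of_real t *\<^sub>C x) \<le> t * p x" if "0 < t" for t x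
    using p that by (simp add: sublinear_def)
  have bdd: "bdd_below ((\<lambda>m. p (z + fst m) - snd m) ` M)" for z
  proof (rule bdd_belowI2)
    fix m assume "m \<in> M"
    then have "snd m \<le> p (fst m)" using Mle[of "fst m" "snd m"] by simp
    also have "\<dots> \<le> p (- z) + p (z + fst m)" using padd[of "- z" "z + fst m"] by simp
    finally show "- p (- z) \<le> p (z + fst m) - snd m" by simp
  qed
  have qle: "q z \<le> p (z + x) - a" if "(x, a) \<in> M" for z x a
    unfolding q_def using cINF_lower[OF bdd that] by simp
  have qge: "c \<le> q z" if "\<And>x a. (x, a) \<in> M \<Longrightarrow> c \<le> p (z + x) - a" for c z
    unfolding q_def using M0 that by (intro cINF_greatest) auto
  show thesis
  proof
    show "q x \<le> p x" for x using qle[OF M0, of x] by simp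
    show "q (- x) \<le> - a" if "(x, a) \<in> M" for x a
      using qle[OF that, of "- x"] sublinear_zero[OF p] by simp
    show "sublinear q"
      unfolding sublinear_def
    proof (intro conjI allI impI)
      fix x y
      have "q (x + y) - (p (x + u) - a) \<le> p (y + w) - b" if "(u, a) \<in> M" "(w, b) \<in> M" for u a w b
        using qle[OF Madd[OF that], of "x + y"] padd[of "x + u" "y + w"] by (simp add: algebra_simps)
      then have "q (x + y) - (p (x + u) - a) \<le> q y" if "(u, a) \<in> M" for u a
        using that by (intro qge) auto
      then have "q (x + y) - q y \<le> q x"
        by (intro qge) (smt (verit))
      then show "q (x + y) \<le> q x + q y" by simp
    next
      fix t :: real and x assume t: "0 < t"
      have "q (complex_of_real t *\<^sub>C x) / t \<le> p (x + u) - a" if "(u, a) \<in> M" for u a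
        using qle[OF Mscale[OF that t], of "complex_of_real t *\<^sub>C x"] psc[OF t, of "x + u"] t
        by (simp add: scaleC_add_right field_simps)
      then have "q (complex_of_real t *\<^sub>C x) / t \<le> q x" by (rule qge)
      then show "q (complex_of_real t *\<^sub>C x) \<le> t * q x" using t by (simp add: field_simps)
    qed
  qed
qed

text \<open>Zorn's lemma for the reversed pointwise order: the infimum of a chain is again
  sublinear, and it is finite because every sublinear \<open>q\<close> below \<open>p\<close>
  satisfies \<open>- p (- x) \<le> q x\<close>.\<close>

lemma minimal_sublinear_exists:
  fixes p :: "'a::complex_vector \<Rightarrow> real"
  assumes p: "sublinear p"
  obtains q where "sublinear q" "q \<le> p" "\<And>r. sublinear r \<Longrightarrow> r \<le> q \<Longrightarrow> r = q"
proof -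
  define A where "A = {q. sublinear q \<and> q \<le> p}"
  let ?P = "\<lambda>a b :: 'a \<Rightarrow> real. b \<le> a"
  have po: "partial_order_on A (relation_of ?P A)"
    by (rule partial_order_on_relation_ofI) auto
  have lower: "- p (- x) \<le> q x" if "q \<in> A" for q x
  proof -
    have "0 \<le> q x + q (- x)"
      using that sublinear_zero[of q] unfolding A_def sublinear_def
      by (metis (mono_tags, lifting) add.right_inverse mem_Collect_eq)
    moreover have "q (- x) \<le> p (- x)" using that by (auto simp: A_def le_fun_def)
    ultimately show ?thesis by simp
  qed
  have "\<exists>m\<in>A. \<forall>a\<in>A. ?P m a \<longrightarrow> a = m"
  proof (rule predicate_Zorn[OF po])
    fix C assume C: "C \<in> Chains (relation_of ?P A)"
    then have CA: "C \<subseteq> A" and total: "\<And>a b. a \<in> C \<Longrightarrow> b \<in> C \<Longrightarrow> a \<le> b \<or> b \<le> a"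
      by (auto simp: Chains_def relation_of_def)
    show "\<exists>u\<in>A. \<forall>a\<in>C. ?P a u"
    proof (cases "C = {}")
      case True
      then show ?thesis using p by (auto simp: A_def)
    next
      case False
      define r where "r x = (INF q\<in>C. q x)" for x
      have bdd: "bdd_below ((\<lambda>q. q x) ` C)" for x
        using lower CA by (intro bdd_belowI2[of _ "- p (- x)"]) auto
      have rle: "r x \<le> q x" if "q \<in> C" for q x
        unfolding r_def by (rule cINF_lower[OF bdd that])
      have rge: "c \<le> r x" if "\<And>q. q \<in> C \<Longrightarrow> c \<le> q x" for c x
        unfolding r_def using False that by (intro cINF_greatest) auto
      have "sublinear r"
        unfolding sublinear_def
      proof (intro conjI allI impI)
        fix x y
        have "r (x + y) - a x \<le> b y" if ab: "a \<in> C" "b \<in> C" for a b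
        proof -
          \<comment> \<open>Subadditivity relates values of one function only, so the two members of
            the chain are replaced by the smaller one.\<close>
          obtain d where d: "d \<in> C" "d \<le> a" "d \<le> b" using total[OF ab] ab by auto
          have "r (x + y) \<le> d x + d y"
            using rle[OF d(1), of "x + y"] d(1) CA unfolding A_def sublinear_def
            by (smt (verit) in_mono mem_Collect_eq)
          then show ?thesis using d(2,3) by (smt (verit) le_funD)
        qed
        then have "r (x + y) - a x \<le> r y" if "a \<in> C" for a
          using that by (intro rge) auto
        then have "r (x + y) - r y \<le> r x"
          by (intro rge) (smt (verit))
        then show "r (x + y) \<le> r x + r y" by simp
      next
        fix t :: real and x assume t: "0 < t"
        have "r (complex_of_real t *\<^sub>C x) / t \<le> a x" if "a \<in> C" for a
        proof -
          have "r (complex_of_real t *\<^sub>C x) \<le> a (complex_of_real t *\<^sub>C x)" by (rule rle[OF that])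
          also have "\<dots> \<le> t * a x" using that CA t unfolding A_def sublinear_def by blast
          finally show ?thesis using t by (simp add: field_simps)
        qed
        then have "r (complex_of_real t *\<^sub>C x) / t \<le> r x" by (rule rge)
        then show "r (complex_of_real t *\<^sub>C x) \<le> t * r x" using t by (simp add: field_simps)
      qed
      moreover have "r \<le> p"
        using False rle CA unfolding A_def le_fun_def by (smt (verit) all_not_in_conv mem_Collect_eq subsetD)
      ultimately show ?thesis
        using rle by (auto simp: A_def le_fun_def)
    qed
  qed
  then obtain q where "q \<in> A" and q: "\<And>a. a \<in> A \<Longrightarrow> a \<le> q \<Longrightarrow> a = q" by auto
  then show thesis
    using that[of q] by (auto simp: A_def intro: order_trans)
qed

text \<open>The reduct encodes a required lower bound \<open>a\<close> at \<open>x\<close> as the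
  upper bound \<open>- a\<close> at \<open>- x\<close>, so every linear functional below the reduct
  meets all requirements. A minimal sublinear functional below it is such a functional.\<close>

theorem Mazur_Orlicz:
  fixes p :: "'a::complex_vector \<Rightarrow> real" and M :: "('a \<times> real) set"
  assumes p: "sublinear p"
    and M0: "(0, 0) \<in> M"
    and Madd: "\<And>x a y b. (x, a) \<in> M \<Longrightarrow> (y, b) \<in> M \<Longrightarrow> (x + y, a + b) \<in> M"
    and Mscale: "\<And>x a t. (x, a) \<in> M \<Longrightarrow> 0 < t \<Longrightarrow> (complex_of_real t *\<^sub>C x, t * a) \<in> M"
    and Mle: "\<And>x a. (x, a) \<in> M \<Longrightarrow> a \<le> p x"
  obtains u where "\<And>x y. u (x + y) = u x + u y" "\<And>t x. u (complex_of_real t *\<^sub>C x) = t * u x"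
    "\<And>x. u x \<le> p x" "\<And>x a. (x, a) \<in> M \<Longrightarrow> a \<le> u x"
proof -
  obtain q where q: "sublinear q" "\<And>x. q x \<le> p x" "\<And>x a. (x, a) \<in> M \<Longrightarrow> q (- x) \<le> - a"
    using sublinear_reduct[OF assms] by blast
  obtain u where u: "sublinear u" "u \<le> q" and umin: "\<And>r. sublinear r \<Longrightarrow> r \<le> u \<Longrightarrow> r = u"
    using minimal_sublinear_exists[OF q(1)] by blast
  have uadd: "u (x + y) \<le> u x + u y" for x y
    using u by (simp add: sublinear_def)
  have usc: "u (complex_of_real t *\<^sub>C x) \<le> t * u x" if "0 < t" for t x
    using u that by (simp add: sublinear_def)
  have usc_eq: "u (complex_of_real t *\<^sub>C x) = t * u x" if t: "0 \<le> t" for t x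
  proof (cases "t = 0")
    case True
    then show ?thesis using sublinear_zero[OF u(1)] by simp
  next
    case False
    then have t: "0 < t" using t by simp
    have "u x = u (complex_of_real (1 / t) *\<^sub>C (complex_of_real t *\<^sub>C x))"
      using t by (simp add: scaleC_scaleC scaleC_one)
    also have "\<dots> \<le> (1 / t) * u (complex_of_real t *\<^sub>C x)"
      by (rule usc) (use t in simp)
    finally have "t * u x \<le> u (complex_of_real t *\<^sub>C x)" using t by (simp add: field_simps)
    then show ?thesis using usc[OF t, of x] by simp
  qed
  \<comment> \<open>Minimality forces oddness: the reduct of \<open>u\<close> along the ray through
    \<open>x\<close> lies below \<open>u\<close>, hence equals \<open>u\<close>, and its value at
    \<open>- x\<close> is at most \<open>- u x\<close>.\<close>
  have uneg: "u (- x) = - u x" for x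
  proof -
    have "\<exists>r. sublinear r \<and> r \<le> u \<and> r (- x) \<le> - u x"
    proof (rule sublinear_reduct[OF u(1), of "{(complex_of_real t *\<^sub>C x, t * u x) | t. 0 \<le> t}"])
      show "(0, 0) \<in> {(complex_of_real t *\<^sub>C x, t * u x) | t. 0 \<le> t}"
        by (force intro: exI[of _ 0])
      show "(y + z, a + b) \<in> {(complex_of_real t *\<^sub>C x, t * u x) | t. 0 \<le> t}"
        if "(y, a) \<in> {(complex_of_real t *\<^sub>C x, t * u x) | t. 0 \<le> t}"
          "(z, b) \<in> {(complex_of_real t *\<^sub>C x, t * u x) | t. 0 \<le> t}" for y a z b
      proof -
        from that obtain t s where "y = complex_of_real t *\<^sub>C x" "a = t * u x" "0 \<le> t"
          "z = complex_of_real s *\<^sub>C x" "b = s * u x" "0 \<le> s" by auto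
        then show ?thesis
          by (auto intro!: exI[of _ "t + s"] simp: scaleC_add_left algebra_simps)
      qed
      show "(complex_of_real s *\<^sub>C y, s * a) \<in> {(complex_of_real t *\<^sub>C x, t * u x) | t. 0 \<le> t}"
        if "(y, a) \<in> {(complex_of_real t *\<^sub>C x, t * u x) | t. 0 \<le> t}" "0 < s" for y a s
      proof -
        from that(1) obtain t where "y = complex_of_real t *\<^sub>C x" "a = t * u x" "0 \<le> t" by auto
        then show ?thesis
          using that(2) by (auto intro!: exI[of _ "s * t"] simp: scaleC_scaleC)
      qed
      show "a \<le> u y" if "(y, a) \<in> {(complex_of_real t *\<^sub>C x, t * u x) | t. 0 \<le> t}" for y a
        using that usc_eq by auto
      fix r assume r: "sublinear r" "\<And>x. r x \<le> u x"
        "\<And>y a. (y, a) \<in> {(complex_of_real t *\<^sub>C x, t * u x) | t. 0 \<le> t} \<Longrightarrow> r (- y) \<le> - a"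
      have "r (- x) \<le> - u x"
        by (rule r(3)) (auto intro!: exI[of _ 1] simp: scaleC_one)
      then show ?thesis using r(1,2) by (auto simp: le_fun_def)
    qed
    then have "u (- x) \<le> - u x" using umin by blast
    moreover have "0 \<le> u x + u (- x)"
      using uadd[of x "- x"] sublinear_zero[OF u(1)] by simp
    ultimately show ?thesis by simp
  qed
  show thesis
  proof
    show "u (x + y) = u x + u y" for x y
      using uadd[of x y] uadd[of "x + y" "- y"] uneg[of y] by simp
    show "u (complex_of_real t *\<^sub>C x) = t * u x" for t x
    proof (cases "0 \<le> t")
      case False
      have "complex_of_real t *\<^sub>C x = - (complex_of_real (- t) *\<^sub>C x)"
        by (simp add: complex_vector_space.scale_minus_left)
      then show ?thesis using False uneg usc_eq[of "- t" x] by simp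
    qed (rule usc_eq)
    show "u x \<le> p x" for x
      using u(2) q(2) by (meson le_funD order_trans)
    show "a \<le> u x" if "(x, a) \<in> M" for x a
      using q(3)[OF that] u(2) uneg[of x] by (smt (verit) le_funD)
  qed
qed

text \<open>The cone \<open>M\<close> lets one statement cover extension from a subspace
  (\<open>M\<close> a graph), norming functionals (\<open>M\<close> a ray) and separation from an
  affine subspace (\<open>M\<close> the cone over it).\<close>

lemma Hahn_Banach_complex:
  fixes p :: "'a::complex_vector \<Rightarrow> real" and M :: "('a \<times> real) set"
  assumes padd: "\<And>x y. p (x + y) \<le> p x + p y"
    and psc: "\<And>c x. p (c *\<^sub>C x) = cmod c * p x"
    and M: "(0, 0) \<in> M"
      "\<And>x a y b. (x, a) \<in> M \<Longrightarrow> (y, b) \<in> M \<Longrightarrow> (x + y, a + b) \<in> M"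
      "\<And>x a t. (x, a) \<in> M \<Longrightarrow> 0 < t \<Longrightarrow> (complex_of_real t *\<^sub>C x, t * a) \<in> M"
      "\<And>x a. (x, a) \<in> M \<Longrightarrow> a \<le> p x"
  obtains f :: "'a \<Rightarrow> complex" where "clinear f" "\<And>x. cmod (f x) \<le> p x"
    "\<And>x a. (x, a) \<in> M \<Longrightarrow> a \<le> Re (f x)"
proof -
  have sub: "sublinear p" using padd psc by (simp add: sublinear_def)
  obtain u where u: "\<And>x y. u (x + y) = u x + u y"
      "\<And>t x. u (complex_of_real t *\<^sub>C x) = t * u x"
      "\<And>x. u x \<le> p x" "\<And>x a. (x, a) \<in> M \<Longrightarrow> a \<le> u x"
    using Mazur_Orlicz[OF sub M] by blast
  \<comment> \<open>A complex linear functional is determined by its real part \<open>u\<close>: its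
    imaginary part at \<open>x\<close> is minus the real part at \<i> times
    \<open>x\<close>.\<close>
  define f where "f x = Complex (u x) (- u (\<i> *\<^sub>C x))" for x
  have uneg: "u (- x) = - u x" for x
    using u(2)[of "-1" x] by (simp add: scaleC_minus_one)
  have f_scale: "f (c *\<^sub>C x) = c * f x" for c x
  proof -
    have split: "u (c *\<^sub>C y) = Re c * u y + Im c * u (\<i> *\<^sub>C y)" for c y
    proof -
      have "c *\<^sub>C y = complex_of_real (Re c) *\<^sub>C y + complex_of_real (Im c) *\<^sub>C (\<i> *\<^sub>C y)"
        by (metis complex_eq mult.commute scaleC_add_left scaleC_scaleC)
      then show ?thesis by (simp only: u(1,2))
    qed
    have "u (\<i> *\<^sub>C c *\<^sub>C x) = Re (\<i> * c) * u x + Im (\<i> * c) * u (\<i> *\<^sub>C x)"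
      unfolding scaleC_scaleC by (rule split)
    then show ?thesis
      unfolding f_def by (auto simp: complex_eq_iff split[of c x] algebra_simps)
  qed
  show thesis
  proof
    show "clinear f"
      unfolding clinear_iff
    proof (intro conjI allI)
      show "f (x + y) = f x + f y" for x y
        by (simp add: f_def u(1) scaleC_add_right complex_eq_iff)
    qed (simp add: f_scale scaleC_complex_def)
    show "cmod (f x) \<le> p x" for x
    proof (cases "f x = 0")
      case True
      have "0 \<le> p x" using padd[of x "- x"] psc[of "-1" x] psc[of 0 x]
        by (simp add: scaleC_minus_one)
      then show ?thesis using True by simp
    next
      case False
      \<comment> \<open>Rotating \<open>x\<close> by \<open>c\<close>, of modulus 1, makes the value
        of \<open>f\<close> real and equal to \<open>cmod (f x)\<close>, so the bound on the real
        part suffices.\<close>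
      define c where "c = cnj (f x) / cmod (f x)"
      have "cmod c = 1" using False by (simp add: c_def norm_divide)
      have "c * f x = cmod (f x)"
        using False by (simp add: c_def complex_norm_square[symmetric] power2_eq_square mult.commute)
      then have "cmod (f x) = Re (f (c *\<^sub>C x))" by (simp add: f_scale)
      also have "\<dots> \<le> p (c *\<^sub>C x)" by (simp add: f_def u(3))
      finally show ?thesis using \<open>cmod c = 1\<close> by (simp add: psc)
    qed
    show "a \<le> Re (f x)" if "(x, a) \<in> M" for x a using u(4)[OF that] by (simp add: f_def)
  qed
qed

section \<open>Duality of the sequence spaces\<close>

text \<open>The relation is kept symmetric, instead of fixing \<open>q\<close> as
  \<open>conj_index p\<close>, so that \<open>swap\<close> makes every result of the locale
  available for the dual exponent.\<close>

locale conjugate_exponents =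
  fixes p q :: real
  assumes p_gt_1: "1 < p" and conj: "1 / p + 1 / q = 1"
begin

lemma p_pos: "0 < p" and p_nonzero: "p \<noteq> 0"
  using p_gt_1 by auto

lemma q_gt_1: "1 < q"
proof -
  have "1 / p < 1" "0 < 1 / p" using p_gt_1 by (simp_all add: field_simps)
  then have "0 < 1 / q" "1 / q < 1" using conj by linarith+
  then show ?thesis by (simp add: zero_less_divide_iff)
qed

lemma swap: "conjugate_exponents q p"
  by unfold_locales (use q_gt_1 conj in auto)

lemma q_eq: "q = conj_index p"
  using conj p_gt_1 q_gt_1 by (simp add: conj_index_def field_simps)

section \<open>Powers with exponent \<open>p\<close>, and the Hoelder and Minkowski inequalities for
  finite sums\<close>

lemma powr_p_root: "0 \<le> c \<Longrightarrow> (c powr p) powr (1 / p) = c"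
  using p_gt_1 by (simp add: powr_powr)

lemma powr_root_p: "0 \<le> c \<Longrightarrow> (c powr (1 / p)) powr p = c"
  using p_gt_1 by (simp add: powr_powr)

lemma powr_le_cancel: "0 \<le> b \<Longrightarrow> a powr p \<le> b powr p \<Longrightarrow> 0 \<le> a \<Longrightarrow> a \<le> b"
  using powr_less_mono2[OF p_pos, of b a] by linarith

lemma root_le_iff: "0 \<le> s \<Longrightarrow> 0 \<le> c \<Longrightarrow> s powr (1 / p) \<le> c \<longleftrightarrow> s \<le> c powr p"
  using p_gt_1 powr_mono2[of "1/p" s "c powr p"] powr_mono2[of p "s powr (1/p)" c]
  by (auto simp: powr_powr)

text \<open>Each \<open>c\<close> between 0 and \<open>a + b\<close> satisfies
  \<open>c powr p \<le> c * (a + b) powr (p - 1)\<close>; apply this to both summands. It is the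
  reason why bounds add when sequences are concatenated.\<close>

lemma powr_add_superadditive:
  assumes "0 \<le> a" "0 \<le> b"
  shows "a powr p + b powr p \<le> (a + b) powr p"
proof (cases "a + b = 0")
  case False
  then have s: "0 < a + b" using assms by linarith
  have *: "c powr p \<le> c * (a + b) powr (p - 1)" if "0 \<le> c" "c \<le> a + b" for c
  proof (cases "c = 0")
    case False
    then have "c powr p = c * c powr (p - 1)"
      using that by (simp add: powr_mult_base)
    also have "\<dots> \<le> c * (a + b) powr (p - 1)"
      using that p_gt_1 by (intro mult_left_mono powr_mono2) auto
    finally show ?thesis .
  qed (use p_gt_1 in auto)
  have "a powr p + b powr p \<le> (a + b) * (a + b) powr (p - 1)"
    using *[of a] *[of b] assms by (simp add: distrib_right)
  also have "\<dots> = (a + b) powr p" using s by (simp add: powr_mult_base)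
  finally show ?thesis .
next
  case True
  then have "a = 0" "b = 0" using assms by auto
  then show ?thesis by simp
qed

text \<open>Young's inequality for \<open>a i\<close> and \<open>s i / c\<close>, summed over
  \<open>i\<close>. The normalised form keeps roots out of the statement.\<close>

lemma Holder_sum:
  assumes "finite I" and nonneg: "\<And>i. i \<in> I \<Longrightarrow> 0 \<le> a i" "\<And>i. i \<in> I \<Longrightarrow> 0 \<le> s i"
    and a: "(\<Sum>i\<in>I. a i powr q) \<le> 1" and s: "(\<Sum>i\<in>I. s i powr p) \<le> c powr p" and c: "0 \<le> c"
  shows "(\<Sum>i\<in>I. a i * s i) \<le> c"
proof (cases "c = 0")
  case True
  then have "(\<Sum>i\<in>I. s i powr p) = 0"
    using s by (intro antisym sum_nonneg) auto
  then have "s i = 0" if "i \<in> I" for i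
    using that \<open>finite I\<close> by (simp add: sum_nonneg_eq_0_iff)
  then show ?thesis using c by simp
next
  case False
  then have c: "0 < c" using c by simp
  have "(\<Sum>i\<in>I. a i * (s i / c)) \<le> (\<Sum>i\<in>I. a i powr q / q + (s i / c) powr p / p)"
    using nonneg c p_gt_1 q_gt_1 conj
    by (intro sum_mono Youngs_inequality) (auto simp: add.commute)
  also have "\<dots> = (\<Sum>i\<in>I. a i powr q) / q + (\<Sum>i\<in>I. s i powr p) / c powr p / p"
    using nonneg c by (simp add: sum.distrib sum_divide_distrib powr_divide)
  also have "\<dots> \<le> 1 / q + 1 / p"
    using a s c p_gt_1 q_gt_1 by (intro add_mono divide_right_mono) (auto simp: divide_le_eq)
  also have "\<dots> = 1" using conj by simp
  finally have "(\<Sum>i\<in>I. a i * s i) / c \<le> 1" by (simp add: sum_divide_distrib)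
  then show ?thesis using c by (simp add: field_simps)
qed

lemma Holder_norm_sum:
  fixes a s :: "nat \<Rightarrow> complex"
  assumes "finite I" "(\<Sum>i\<in>I. cmod (a i) powr q) \<le> 1" "(\<Sum>i\<in>I. cmod (s i) powr p) \<le> c powr p" "0 \<le> c"
  shows "cmod (\<Sum>i\<in>I. a i * s i) \<le> c"
proof -
  have "cmod (\<Sum>i\<in>I. a i * s i) \<le> (\<Sum>i\<in>I. cmod (a i) * cmod (s i))"
    by (rule order_trans[OF norm_sum]) (simp add: norm_mult)
  also have "\<dots> \<le> c" using assms by (intro Holder_sum) auto
  finally show ?thesis .
qed

text \<open>The equality case of Hoelder. It reads off a finite \<open>p\<close>-norm from a single
  linear combination, which gives Minkowski, the coefficient bounds in
  \<open>lp_dual_representation\<close> and the weak bounds in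
  \<open>local_reflexivity_gauge\<close>.\<close>

lemma Holder_attained:
  fixes s :: "nat \<Rightarrow> complex"
  obtains b where "(\<Sum>i<N. cmod (b i) powr q) \<le> 1"
    "(\<Sum>i<N. b i * s i) = complex_of_real ((\<Sum>i<N. cmod (s i) powr p) powr (1 / p))"
proof -
  define S where "S = (\<Sum>i<N. cmod (s i) powr p)"
  have "0 \<le> S" by (auto simp: S_def intro: sum_nonneg)
  show thesis
  proof (cases "S = 0")
    case True
    then show ?thesis using that[of "\<lambda>_. 0"] q_gt_1 by (simp add: S_def)
  next
    case False
    then have S: "0 < S" using \<open>0 \<le> S\<close> by simp
    have pq: "(p - 1) * q = p" "(1 / q) * q = 1" "1 - 1 / q = 1 / p"
      using conj p_gt_1 q_gt_1 by (auto simp: field_simps)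
    \<comment> \<open>The phases make all products nonnegative, and the moduli are proportional to
      \<open>cmod (s i) powr (p - 1)\<close>. Since \<open>(p - 1) * q = p\<close>, dividing by
      \<open>S powr (1 / q)\<close> normalises the \<open>q\<close>-th powers.\<close>
    define b where "b i = cnj (sgn (s i)) * complex_of_real (cmod (s i) powr (p - 1) / S powr (1 / q))" for i
    have "cmod (b i) powr q \<le> cmod (s i) powr p / S" for i
    proof (cases "s i = 0")
      case False
      then have "cmod (b i) = cmod (s i) powr (p - 1) / S powr (1 / q)"
        by (simp add: b_def norm_mult norm_divide norm_sgn)
      then show ?thesis using S pq by (simp add: powr_divide powr_powr)
    qed (use q_gt_1 S in \<open>simp add: b_def\<close>)
    then have "(\<Sum>i<N. cmod (b i) powr q) \<le> (\<Sum>i<N. cmod (s i) powr p / S)"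
      by (intro sum_mono) auto
    also have "\<dots> = 1" using S by (simp add: sum_divide_distrib[symmetric] S_def)
    finally have 1: "(\<Sum>i<N. cmod (b i) powr q) \<le> 1" .
    have "b i * s i = complex_of_real (cmod (s i) powr p / S powr (1 / q))" for i
    proof (cases "s i = 0")
      case False
      have "cnj (sgn (s i)) * s i = complex_of_real (cmod (s i))"
        using False complex_norm_square[of "s i"]
        by (simp add: sgn_eq power2_eq_square field_simps)
      then have "b i * s i = complex_of_real (cmod (s i) * (cmod (s i) powr (p - 1) / S powr (1 / q)))"
        by (simp add: b_def mult.commute mult.left_commute)
      also have "cmod (s i) * (cmod (s i) powr (p - 1) / S powr (1 / q)) = cmod (s i) powr p / S powr (1 / q)"
        using False by (simp add: powr_mult_base)
      finally show ?thesis .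
    qed (use p_gt_1 in simp)
    then have "(\<Sum>i<N. b i * s i) = complex_of_real (\<Sum>i<N. cmod (s i) powr p / S powr (1 / q))"
      by simp
    also have "(\<Sum>i<N. cmod (s i) powr p / S powr (1 / q)) = S powr 1 / S powr (1 / q)"
      using S by (simp add: sum_divide_distrib[symmetric] S_def)
    also have "\<dots> = S powr (1 / p)"
      using S pq by (simp only: powr_diff[symmetric])
    finally show ?thesis using that 1 by (simp add: S_def)
  qed
qed

text \<open>Test the sum with its own extremal coefficients and apply Hoelder to \<open>x\<close>
  and \<open>y\<close> separately.\<close>

lemma Minkowski_sum:
  fixes x y :: "nat \<Rightarrow> complex"
  assumes "(\<Sum>i<N. cmod (x i) powr p) \<le> c powr p" "(\<Sum>i<N. cmod (y i) powr p) \<le> d powr p"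
    and "0 \<le> c" "0 \<le> d"
  shows "(\<Sum>i<N. cmod (x i + y i) powr p) \<le> (c + d) powr p"
proof -
  obtain b where b: "(\<Sum>i<N. cmod (b i) powr q) \<le> 1"
      "(\<Sum>i<N. b i * (x i + y i)) = complex_of_real ((\<Sum>i<N. cmod (x i + y i) powr p) powr (1 / p))"
    by (rule Holder_attained[where s="\<lambda>i. x i + y i"])
  have "(\<Sum>i<N. cmod (x i + y i) powr p) powr (1 / p) = cmod (\<Sum>i<N. b i * (x i + y i))"
    unfolding b(2) by simp
  also have "\<dots> = cmod ((\<Sum>i<N. b i * x i) + (\<Sum>i<N. b i * y i))"
    by (simp add: distrib_left sum.distrib)
  also have "\<dots> \<le> c + d"
    using b(1) assms by (intro norm_triangle_mono Holder_norm_sum) auto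
  finally show ?thesis
    using assms by (subst (asm) root_le_iff) (auto intro: sum_nonneg)
qed

text \<open>Replaces an infinite sum together with its summability by bounds on all partial sums,
  the form in which the later estimates are made.\<close>

lemma lp_iff: "x \<in> lp p \<and> lp_norm p x \<le> c \<longleftrightarrow> (\<forall>N. (\<Sum>i<N. norm (x i) powr p) \<le> c powr p)"
  if "0 \<le> c" for x :: "nat \<Rightarrow> 'a::complex_normed_vector"
proof
  assume x: "x \<in> lp p \<and> lp_norm p x \<le> c"
  then have s: "summable (\<lambda>n. norm (x n) powr p)" by (simp add: lp_def)
  have "(\<Sum>n. norm (x n) powr p) \<le> c powr p"
    using x that suminf_nonneg[OF s] by (simp add: lp_norm_def root_le_iff)
  then show "\<forall>N. (\<Sum>i<N. norm (x i) powr p) \<le> c powr p"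
    using sum_le_suminf[OF s] by (meson finite_lessThan order_trans powr_ge_zero)
next
  assume *: "\<forall>N. (\<Sum>i<N. norm (x i) powr p) \<le> c powr p"
  then have s: "summable (\<lambda>n. norm (x n) powr p)"
    by (intro summableI_nonneg_bounded) auto
  then have "(\<Sum>n. norm (x n) powr p) \<le> c powr p"
    using * by (intro suminf_le_const) auto
  then show "x \<in> lp p \<and> lp_norm p x \<le> c"
    using s that suminf_nonneg[OF s] by (simp add: lp_def lp_norm_def root_le_iff)
qed

section \<open>The spaces \<open>lp p\<close> of scalar sequences: norm, tails and duality\<close>

lemma lp_norm_nonneg: "0 \<le> lp_norm p x"
  by (simp add: lp_norm_def)

lemma lp_norm_bound: "x \<in> lp p \<Longrightarrow> (\<Sum>i<N. norm (x i) powr p) \<le> lp_norm p x powr p"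
  using lp_iff[OF lp_norm_nonneg, of x x] by auto

lemma lp_add:
  fixes x y :: "nat \<Rightarrow> complex"
  assumes "x \<in> lp p" "y \<in> lp p"
  shows "x + y \<in> lp p" "lp_norm p (x + y) \<le> lp_norm p x + lp_norm p y"
proof -
  have "\<forall>N. (\<Sum>i<N. norm ((x + y) i) powr p) \<le> (lp_norm p x + lp_norm p y) powr p"
    unfolding plus_fun_apply
    using assms by (intro allI Minkowski_sum lp_norm_bound lp_norm_nonneg)
  then show "x + y \<in> lp p" "lp_norm p (x + y) \<le> lp_norm p x + lp_norm p y"
    using lp_iff[of "lp_norm p x + lp_norm p y" "x + y"] lp_norm_nonneg[of x] lp_norm_nonneg[of y]
    by auto
qed

lemma lp_scaleC:
  fixes x :: "nat \<Rightarrow> complex"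
  assumes "x \<in> lp p"
  shows "c *\<^sub>C x \<in> lp p" "lp_norm p (c *\<^sub>C x) = cmod c * lp_norm p x"
proof -
  have *: "norm ((c *\<^sub>C x) n) powr p = cmod c powr p * norm (x n) powr p" for n
    by (simp add: scaleC_fun_def norm_scaleC powr_mult)
  show "c *\<^sub>C x \<in> lp p" using assms by (simp add: lp_def * summable_mult)
  have "lp_norm p (c *\<^sub>C x) = (cmod c powr p * (\<Sum>n. norm (x n) powr p)) powr (1 / p)"
    using assms by (simp add: lp_norm_def lp_def * suminf_mult)
  also have "\<dots> = cmod c * lp_norm p x"
    using assms by (simp add: powr_mult powr_p_root lp_norm_def suminf_nonneg lp_def)
  finally show "lp_norm p (c *\<^sub>C x) = cmod c * lp_norm p x" .
qed

lemma lp_subspace: "complex_vector_space.subspace (lp p :: (nat \<Rightarrow> complex) set)"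
  unfolding complex_vector_space.subspace_def
  using lp_add(1) lp_scaleC(1) p_gt_1 by (auto simp: lp_def)

lemma lp_tail:
  fixes x :: "nat \<Rightarrow> complex"
  assumes "x \<in> lp p"
  shows "(\<lambda>m. lp_norm p (\<lambda>n. if n < m then 0 else x n)) \<longlonglongrightarrow> 0"
proof -
  have s: "summable (\<lambda>n. cmod (x n) powr p)" using assms by (simp add: lp_def)
  have eq: "(\<lambda>n. cmod (if n < m then 0 else x n) powr p) sums (\<Sum>n. cmod (x (n + m)) powr p)" for m
  proof -
    have "(\<lambda>n. cmod (if n + m < m then 0 else x (n + m)) powr p) sums (\<Sum>n. cmod (x (n + m)) powr p)"
      using summable_ignore_initial_segment[OF s, of m] by (simp add: summable_sums)
    then show ?thesis
      by (subst (asm) sums_iff_shift) (use p_gt_1 in simp)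
  qed
  have "(\<lambda>m. (\<Sum>n. cmod (x (n + m)) powr p)) \<longlonglongrightarrow> 0"
    using suminf_exist_split2[OF s] .
  then have "(\<lambda>m. (\<Sum>n. cmod (x (n + m)) powr p) powr (1 / p)) \<longlonglongrightarrow> 0 powr (1 / p)"
    using p_gt_1 s by (intro tendsto_powr2) (auto intro!: always_eventually suminf_nonneg summable_ignore_initial_segment)
  then show ?thesis
    using p_gt_1 by (simp add: lp_norm_def sums_unique[OF eq, symmetric])
qed

text \<open>Weak-star form of the duality between \<open>lp p\<close> and \<open>lp q\<close>: Hahn-Banach extends the functional
  that \<open>g\<close> induces on the range of \<open>\<Theta>\<close>.\<close>
lemma lp_dual_representation:
  fixes \<Theta> :: "'x::complex_vector \<Rightarrow> nat \<Rightarrow> complex" and g :: "'x \<Rightarrow> complex"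
  assumes \<Theta>: "clinear \<Theta>" "\<And>x. \<Theta> x \<in> lp p" and g: "clinear g"
    and le: "\<And>x. cmod (g x) \<le> lp_norm p (\<Theta> x)"
  obtains a where "\<And>N. (\<Sum>n<N. cmod (a n) powr q) \<le> 1" "\<And>x. (\<lambda>n. a n * \<Theta> x n) sums g x"
proof -
  interpret sequences: vector_space_pair
    "scaleC :: complex \<Rightarrow> (nat \<Rightarrow> complex) \<Rightarrow> _" "scaleC :: complex \<Rightarrow> (nat \<Rightarrow> complex) \<Rightarrow> _" ..
  have "clinear (id :: (nat \<Rightarrow> complex) \<Rightarrow> _)" by (simp add: clinear_iff)
  \<comment> \<open>\<open>Hahn_Banach_complex\<close> asks for a seminorm on the whole type, but
    \<open>lp_norm p\<close> is one only on \<open>lp p\<close>. Composing it with an algebraic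
    projection \<open>P\<close> onto \<open>lp p\<close> extends it to all sequences.\<close>
  then obtain P :: "(nat \<Rightarrow> complex) \<Rightarrow> nat \<Rightarrow> complex"
    where P: "range P \<subseteq> lp p" "clinear P" "\<And>s. s \<in> lp p \<Longrightarrow> P s = s"
    using sequences.linear_exists_left_inverse_on[OF _ lp_subspace inj_on_id] by auto
  have Plp: "P s \<in> lp p" for s using P(1) by auto
  have lin: "F (x + y) = F x + F y" "F (c *\<^sub>C x) = c *\<^sub>C F x" if "clinear F"
    for F :: "'c::complex_vector \<Rightarrow> 'd::complex_vector" and x y c
    using that by (auto simp: clinear_iff)
  have lin0: "F 0 = 0" if "clinear F" for F :: "'c::complex_vector \<Rightarrow> 'd::complex_vector"
    using lin(2)[OF that, of 0 0] by simp
  let ?M = "range (\<lambda>x. (\<Theta> x, Re (g x)))"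
  obtain f :: "(nat \<Rightarrow> complex) \<Rightarrow> complex" where f: "clinear f"
      "\<And>s. cmod (f s) \<le> lp_norm p (P s)" and fM: "\<And>s a. (s, a) \<in> ?M \<Longrightarrow> a \<le> Re (f s)"
  proof (rule Hahn_Banach_complex[of "\<lambda>s. lp_norm p (P s)" ?M])
    show "lp_norm p (P (x + y)) \<le> lp_norm p (P x) + lp_norm p (P y)" for x y
      using lp_add(2)[OF Plp Plp] by (simp add: lin[OF P(2)])
    show "lp_norm p (P (c *\<^sub>C x)) = cmod c * lp_norm p (P x)" for c x
      using lp_scaleC(2)[OF Plp] by (simp add: lin[OF P(2)])
    show "(0, 0) \<in> ?M"
      by (rule range_eqI[of _ _ 0]) (simp add: lin0 \<Theta> g)
    show "(x + y, a + b) \<in> ?M" if "(x, a) \<in> ?M" "(y, b) \<in> ?M" for x a y b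
    proof -
      from that obtain u w where "x = \<Theta> u" "a = Re (g u)" "y = \<Theta> w" "b = Re (g w)" by auto
      then show ?thesis
        by (intro range_eqI[of _ _ "u + w"]) (simp add: lin(1)[OF \<Theta>(1)] lin(1)[OF g])
    qed
    show "(complex_of_real t *\<^sub>C x, t * a) \<in> ?M" if "(x, a) \<in> ?M" "0 < t" for x a t
    proof -
      from that(1) obtain u where "x = \<Theta> u" "a = Re (g u)" by auto
      then show ?thesis
        by (intro range_eqI[of _ _ "complex_of_real t *\<^sub>C u"])
          (simp add: lin[OF \<Theta>(1)] lin[OF g] scaleC_complex_def)
    qed
    show "a \<le> lp_norm p (P x)" if "(x, a) \<in> ?M" for x a
      using that le \<Theta>(2) P(3) complex_Re_le_cmod order_trans by fastforce
  qed blast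
  have f_le: "cmod (f s) \<le> lp_norm p s" if "s \<in> lp p" for s
    using f(2)[of s] P(3)[OF that] by simp
  \<comment> \<open>The required lower bounds hold on a complex subspace, so testing with the
    multiples of \<open>x\<close> by 1, -1, \<i> and -\<i> turns them into an equality.\<close>
  have f\<Theta>: "f (\<Theta> x) = g x" for x
  proof -
    have Re_le: "Re (g y) \<le> Re (f (\<Theta> y))" for y by (rule fM) auto
    have sc: "Re (c * g x) \<le> Re (c * f (\<Theta> x))" for c
      using Re_le[of "c *\<^sub>C x"]
      by (simp add: lin(2)[OF \<Theta>(1)] lin(2)[OF g] lin(2)[OF f(1)] scaleC_complex_def)
    show ?thesis
      using sc[of 1] sc[of "-1"] sc[of \<i>] sc[of "- \<i>"] by (simp add: complex_eq_iff)
  qed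
  define e :: "nat \<Rightarrow> nat \<Rightarrow> complex" where "e n = (\<lambda>i. if i = n then 1 else 0)" for n
  define a where "a n = f (e n)" for n
  have head: "f (\<lambda>i. if i < N then s i else 0) = (\<Sum>n<N. a n * s n)" for N s
  proof (induction N)
    case 0
    show ?case using lin0[OF f(1)] by (simp add: zero_fun_def)
  next
    case (Suc N)
    have "(\<lambda>i. if i < Suc N then s i else 0) = (\<lambda>i. if i < N then s i else 0) + s N *\<^sub>C e N"
      by (auto simp: e_def scaleC_fun_def scaleC_complex_def fun_eq_iff less_Suc_eq)
    then show ?case
      by (simp add: lin[OF f(1)] Suc.IH a_def scaleC_complex_def)
  qed
  show thesis
  proof
    show "(\<Sum>n<N. cmod (a n) powr q) \<le> 1" for N
    proof -
      interpret sw: conjugate_exponents q p by (rule swap)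
      \<comment> \<open>The sequence extremal for \<open>a\<close>, with the exponents exchanged and
        cut off at \<open>N\<close>, is a unit vector of \<open>lp p\<close> on which
        \<open>f\<close> takes the \<open>q\<close>-norm of the first \<open>N\<close> coefficients
        as its value.\<close>
      obtain b where b: "(\<Sum>i<N. cmod (b i) powr p) \<le> 1"
        "(\<Sum>i<N. b i * a i) = complex_of_real ((\<Sum>i<N. cmod (a i) powr q) powr (1 / q))"
        using sw.Holder_attained[of N a] by blast
      let ?s = "\<lambda>i. if i < N then b i else 0"
      have "(\<Sum>i<K. cmod (?s i) powr p) \<le> 1" for K
      proof -
        have "(\<Sum>i<K. cmod (?s i) powr p) = (\<Sum>i\<in>{..<K} \<inter> {..<N}. cmod (b i) powr p)"
          using p_gt_1 by (intro sum.mono_neutral_cong_right) auto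
        also have "\<dots> \<le> (\<Sum>i<N. cmod (b i) powr p)" by (intro sum_mono2) auto
        finally show ?thesis using b(1) by simp
      qed
      then have s: "?s \<in> lp p" "lp_norm p ?s \<le> 1" using lp_iff[of 1 ?s] by auto
      have "(\<Sum>i<N. cmod (a i) powr q) powr (1 / q) = cmod (f ?s)"
        unfolding head using b(2) by (simp add: mult.commute)
      also have "\<dots> \<le> 1" using f_le[OF s(1)] s(2) by simp
      finally show ?thesis by (subst (asm) sw.root_le_iff) (auto intro: sum_nonneg)
    qed
    show "(\<lambda>n. a n * \<Theta> x n) sums g x" for x
    proof -
      \<comment> \<open>Splitting off the first \<open>N\<close> entries leaves \<open>f\<close> of
        a tail of \<Theta> \<open>x\<close>, and \<open>f\<close> is dominated by the norm on
        \<open>lp p\<close>, where tails tend to 0.\<close>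
      have "cmod (g x - (\<Sum>n<N. a n * \<Theta> x n)) \<le> lp_norm p (\<lambda>n. if n < N then 0 else \<Theta> x n)" for N
      proof -
        let ?t = "\<lambda>n. if n < N then 0 else \<Theta> x n"
        have "\<Theta> x = (\<lambda>i. if i < N then \<Theta> x i else 0) + ?t" by (auto simp: fun_eq_iff)
        then have "g x = (\<Sum>n<N. a n * \<Theta> x n) + f ?t"
          by (metis f\<Theta> head lin(1)[OF f(1)])
        moreover have "?t \<in> lp p"
          using \<Theta>(2)[of x] unfolding lp_def
          by (auto elim!: summable_comparison_test' simp: p_nonzero)
        ultimately show ?thesis using f_le[of ?t] by simp
      qed
      then have "(\<lambda>N. g x - (\<Sum>n<N. a n * \<Theta> x n)) \<longlonglongrightarrow> 0"
        by (intro Lim_null_comparison[OF _ lp_tail[OF \<Theta>(2)[of x]]] always_eventually) simp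
      then have "(\<lambda>N. g x - (g x - (\<Sum>n<N. a n * \<Theta> x n))) \<longlonglongrightarrow> g x - 0"
        by (intro tendsto_diff tendsto_const)
      then show ?thesis by (simp add: sums_def)
    qed
  qed
qed

end

section \<open>The bidual and local reflexivity\<close>

lemma clinear_cdual: "clinear (cdual_apply \<phi>)"
  by transfer

lemma cdual_add_right: "cdual_apply \<phi> (x + y) = cdual_apply \<phi> x + cdual_apply \<phi> y"
  and cdual_scaleC_right: "cdual_apply \<phi> (c *\<^sub>C x) = c * cdual_apply \<phi> x"
  using clinear_cdual[of \<phi>] by (auto simp: clinear_iff scaleC_complex_def)

lemma cdual_add_left: "cdual_apply (\<phi> + \<psi>) x = cdual_apply \<phi> x + cdual_apply \<psi> x"
  by transfer (simp add: blinfun.add_left)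

lemma cdual_diff_left: "cdual_apply (\<phi> - \<psi>) x = cdual_apply \<phi> x - cdual_apply \<psi> x"
  by transfer (simp add: blinfun.diff_left)

lemma cdual_scaleC_left: "cdual_apply (c *\<^sub>C \<phi>) x = c * cdual_apply \<phi> x"
  by transfer simp

lemma cdual_zero_left [simp]: "cdual_apply 0 x = 0"
  by transfer simp

lemma cdual_zero_right [simp]: "cdual_apply \<phi> 0 = 0"
  using cdual_scaleC_right[of \<phi> 0 0] by simp

lemma cdual_minus_right: "cdual_apply \<phi> (- x) = - cdual_apply \<phi> x"
  using cdual_scaleC_right[of \<phi> "-1" x] by (simp add: scaleC_minus_one)

lemma cdual_diff_right: "cdual_apply \<phi> (x - y) = cdual_apply \<phi> x - cdual_apply \<phi> y"
  using cdual_add_right[of \<phi> x "- y"] by (simp add: cdual_minus_right)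

lemma cdual_sum_left: "cdual_apply (\<Sum>i\<in>I. \<phi> i) x = (\<Sum>i\<in>I. cdual_apply (\<phi> i) x)"
  by (induction I rule: infinite_finite_induct) (simp_all add: cdual_add_left)

lemma cdual_sum_right: "cdual_apply \<phi> (\<Sum>i\<in>I. x i) = (\<Sum>i\<in>I. cdual_apply \<phi> (x i))"
  by (induction I rule: infinite_finite_induct) (simp_all add: cdual_add_right)

lemmas cdual_simps = cdual_add_right cdual_scaleC_right cdual_add_left cdual_diff_left
  cdual_scaleC_left cdual_minus_right cdual_diff_right cdual_sum_left cdual_sum_right

lemma cdual_eqI: "(\<And>x. cdual_apply \<phi> x = cdual_apply \<psi> x) \<Longrightarrow> \<phi> = \<psi>"
  by transfer (rule blinfun_eqI)

lemma cdual_le: "cmod (cdual_apply \<phi> x) \<le> norm \<phi> * norm x"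
  by transfer (rule norm_blinfun)

lemma cdual_norm_le: "0 \<le> B \<Longrightarrow> (\<And>x. cmod (cdual_apply \<phi> x) \<le> B * norm x) \<Longrightarrow> norm \<phi> \<le> B"
  by transfer (rule norm_blinfun_bound)

lemma cdual_exists:
  fixes f :: "'a::complex_normed_vector \<Rightarrow> complex"
  assumes f: "clinear f" "\<And>x. cmod (f x) \<le> B * norm x"
  obtains \<phi> where "cdual_apply \<phi> = f"
proof -
  have "bounded_linear f"
    using f by (intro bounded_linear_intro[of _ B])
      (auto simp: clinear_iff scaleR_scaleC scaleC_complex_def scaleR_conv_of_real mult.commute)
  then have "cdual_apply (cdual_of_blinfun (Blinfun f)) = f"
    using f(1) by (simp add: cdual_apply.rep_eq cdual_of_blinfun_inverse bounded_linear_Blinfun_apply)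
  then show thesis by (rule that)
qed

lemma cdual_ball_le: "\<phi> \<in> cball 0 1 \<Longrightarrow> cmod (cdual_apply \<phi> x) \<le> norm x"
  using cdual_le[of \<phi> x] mult_right_mono[of "norm \<phi>" 1 "norm x"] by simp

lemma cdual_norm_le_ball:
  fixes \<phi> :: "'a::complex_normed_vector cdual"
  assumes "0 \<le> B" and le: "\<And>x. norm x \<le> 1 \<Longrightarrow> cmod (cdual_apply \<phi> x) \<le> B"
  shows "norm \<phi> \<le> B"
proof (rule cdual_norm_le)
  show "cmod (cdual_apply \<phi> x) \<le> B * norm x" for x
  proof (cases "x = 0")
    case False
    have "cmod (cdual_apply \<phi> (complex_of_real (1 / norm x) *\<^sub>C x)) \<le> B"
      by (rule le) (simp add: norm_scaleC norm_divide)
    then show ?thesis using False by (simp add: cdual_simps norm_mult norm_divide field_simps)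
  qed simp
qed fact

definition evaluation :: "'a::complex_normed_vector \<Rightarrow> 'a cdual cdual"
  where "evaluation x = (THE \<Phi>. cdual_apply \<Phi> = (\<lambda>\<phi>. cdual_apply \<phi> x))"

lemma evaluation_apply [simp]: "cdual_apply (evaluation x) \<phi> = cdual_apply \<phi> x"
proof -
  have "\<exists>!\<Phi>. cdual_apply \<Phi> = (\<lambda>\<phi>. cdual_apply \<phi> x)"
  proof (rule ex_ex1I)
    show "\<exists>\<Phi>. cdual_apply \<Phi> = (\<lambda>\<phi>. cdual_apply \<phi> x)"
    proof (rule cdual_exists)
      show "clinear (\<lambda>\<phi>. cdual_apply \<phi> x)" by (simp add: clinear_iff cdual_simps scaleC_complex_def)
      show "cmod (cdual_apply \<phi> x) \<le> norm x * norm \<phi>" for \<phi>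
        using cdual_le[of \<phi> x] by (simp add: mult.commute)
    qed blast
  qed (metis cdual_eqI)
  from theI'[OF this] show ?thesis unfolding evaluation_def by metis
qed

lemma norm_evaluation_le: "norm (evaluation x) \<le> norm x"
  using cdual_le[of _ x] by (intro cdual_norm_le) (simp_all add: mult.commute)

text \<open>Hahn-Banach with the ray through \<open>x\<close> as cone and \<open>t * norm x\<close>
  as required value yields a functional in the dual ball that is norming for
  \<open>x\<close>.\<close>

lemma norm_le_dual:
  fixes x :: "'a::complex_normed_vector"
  assumes "\<And>\<phi>. \<phi> \<in> cball 0 1 \<Longrightarrow> cmod (cdual_apply \<phi> x) \<le> c"
  shows "norm x \<le> c"
proof -
  let ?M = "{(complex_of_real t *\<^sub>C x, t * norm x) | t. 0 \<le> t}"
  obtain f :: "'a \<Rightarrow> complex" where f: "clinear f" "\<And>y. cmod (f y) \<le> norm y"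
      "\<And>y a. (y, a) \<in> ?M \<Longrightarrow> a \<le> Re (f y)"
  proof (rule Hahn_Banach_complex[of norm ?M])
    show "(0, 0) \<in> ?M" by (force intro: exI[of _ 0])
    show "(y + z, a + b) \<in> ?M" if "(y, a) \<in> ?M" "(z, b) \<in> ?M" for y a z b
    proof -
      from that obtain t s where "y = complex_of_real t *\<^sub>C x" "a = t * norm x" "0 \<le> t"
        "z = complex_of_real s *\<^sub>C x" "b = s * norm x" "0 \<le> s" by auto
      then show ?thesis
        by (auto intro!: exI[of _ "t + s"] simp: scaleC_add_left algebra_simps)
    qed
    show "(complex_of_real s *\<^sub>C y, s * a) \<in> ?M" if "(y, a) \<in> ?M" "0 < s" for y a s
    proof -
      from that(1) obtain t where "y = complex_of_real t *\<^sub>C x" "a = t * norm x" "0 \<le> t" by auto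
      then show ?thesis
        using that(2) by (auto intro!: exI[of _ "s * t"] simp: scaleC_scaleC)
    qed
  qed (auto simp: norm_triangle_ineq norm_scaleC)
  obtain \<phi> where \<phi>: "cdual_apply \<phi> = f"
    using cdual_exists[of f 1] f(1,2) by auto
  have "norm \<phi> \<le> 1" using f(2) by (intro cdual_norm_le) (auto simp: \<phi>)
  then have "cmod (cdual_apply \<phi> x) \<le> c" by (intro assms) simp
  moreover have "norm x \<le> Re (f x)"
    by (rule f(3)) (auto intro!: exI[of _ 1] simp: scaleC_one)
  ultimately show ?thesis using complex_Re_le_cmod[of "f x"] by (simp add: \<phi>)
qed

lemma cdual_almost_attained:
  fixes \<phi> :: "'a::complex_normed_vector cdual"
  assumes "\<theta> < 1"
  shows "\<exists>x. norm x \<le> 1 \<and> \<theta> * norm \<phi> \<le> cmod (cdual_apply \<phi> x)"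
proof (rule ccontr)
  assume "\<not> ?thesis"
  then have lt: "cmod (cdual_apply \<phi> x) < \<theta> * norm \<phi>" if "norm x \<le> 1" for x
    using that by (meson not_le_imp_less)
  have pos: "0 < \<theta> * norm \<phi>" using lt[of 0] by simp
  have "norm \<phi> \<le> \<theta> * norm \<phi>"
    using lt pos by (intro cdual_norm_le_ball) (auto intro: less_imp_le)
  moreover have "0 < norm \<phi>" using pos by (metis norm_eq_zero mult_zero_right less_irrefl zero_less_norm_iff)
  ultimately show False using assms by (simp add: mult_le_cancel_right1)
qed

text \<open>A Helly-type form of local reflexivity: a violated finite system of norm constraints would be
  separated by functionals \<open>u i\<close> with \<open>(\<Sum>i. c i n * u i) = 0\<close>, and these also see the bidual.\<close>
lemma local_reflexivity:
  fixes \<Phi> :: "nat \<Rightarrow> 'f::complex_normed_vector cdual cdual" and h :: "'i \<Rightarrow> 'f"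
  assumes I: "finite I" and \<eta>: "0 < \<eta>"
    and le: "\<And>i. i \<in> I \<Longrightarrow> norm ((\<Sum>n<N. c i n *\<^sub>C \<Phi> n) - evaluation (h i)) \<le> \<rho> i"
  shows "\<exists>x. \<forall>i\<in>I. norm ((\<Sum>n<N. c i n *\<^sub>C x n) - h i) \<le> \<rho> i + \<eta>"
proof (rule ccontr)
  assume "\<not> ?thesis"
  then have viol: "\<exists>i\<in>I. \<rho> i + \<eta> < norm ((\<Sum>n<N. c i n *\<^sub>C x n) - h i)" for x
    by (meson not_le_imp_less)
  then have ne: "I \<noteq> {}" by blast
  have \<rho>: "0 \<le> \<rho> i" if "i \<in> I" for i
    using le[OF that] norm_ge_zero order_trans by blast
  define R where "R i = \<rho> i + \<eta>" for i
  have R: "0 < R i" if "i \<in> I" for i using \<rho>[OF that] \<eta> by (simp add: R_def)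
  \<comment> \<open>The constraints with radii \<open>R i\<close> become one seminorm: a point
    satisfies all of them exactly if \<open>p\<close> of its vector of errors is at most 1.\<close>
  define p where "p w = Max ((\<lambda>i. norm (w i) / R i) ` I)" for w :: "'i \<Rightarrow> 'f"
  have p_le: "p w \<le> C \<longleftrightarrow> (\<forall>i\<in>I. norm (w i) / R i \<le> C)" for w C
    using I ne by (simp add: p_def)
  have p_ge: "norm (w i) / R i \<le> p w" if "i \<in> I" for w i
    using p_le[of w "p w"] that by simp
  define L where "L x = (\<lambda>i. \<Sum>n<N. c i n *\<^sub>C x n)" for x :: "nat \<Rightarrow> 'f"
  have L_lin: "L (x + y) = L x + L y" "L (a *\<^sub>C x) = a *\<^sub>C L x" for x y a
    by (simp_all add: L_def fun_eq_iff scaleC_add_right sum.distrib scaleC_fun_def scaleC_scaleC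
        complex_vector_space.scale_sum_right mult.commute)
  \<comment> \<open>By \<open>viol\<close>, \<open>p\<close> exceeds 1 on every difference of a
    point in the range of \<open>L\<close> and \<open>h\<close>. The cone requires the value
    \<open>t\<close> on \<open>t\<close> times \<open>h\<close> plus that range, so the functional
    vanishes on the range of \<open>L\<close> and has real part at least 1 at
    \<open>h\<close>.\<close>
  let ?M = "{(complex_of_real t *\<^sub>C h + L x, t) | t x. 0 \<le> t}"
  obtain f :: "('i \<Rightarrow> 'f) \<Rightarrow> complex" where f: "clinear f" "\<And>w. cmod (f w) \<le> p w"
      "\<And>w a. (w, a) \<in> ?M \<Longrightarrow> a \<le> Re (f w)"
  proof (rule Hahn_Banach_complex[of p ?M])
    show "p (x + y) \<le> p x + p y" for x y
      unfolding p_le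
    proof
      fix i assume i: "i \<in> I"
      have "norm ((x + y) i) / R i \<le> norm (x i) / R i + norm (y i) / R i"
        using R[OF i] by (simp add: add_divide_distrib[symmetric] divide_right_mono norm_triangle_ineq)
      then show "norm ((x + y) i) / R i \<le> p x + p y"
        using p_ge[OF i, of x] p_ge[OF i, of y] by linarith
    qed
    show "p (a *\<^sub>C x) = cmod a * p x" for a x
    proof -
      have "(*) (cmod a) (Max ((\<lambda>i. norm (x i) / R i) ` I)) = Max ((*) (cmod a) ` (\<lambda>i. norm (x i) / R i) ` I)"
        by (rule mono_Max_commute) (use I ne in \<open>auto simp: mono_def mult_left_mono\<close>)
      then show ?thesis by (simp add: p_def image_image scaleC_fun_def norm_scaleC)
    qed
    show "(0, 0) \<in> ?M"
      by (auto intro!: exI[of _ 0] simp: L_def zero_fun_def)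
    show "(y + z, a + b) \<in> ?M" if "(y, a) \<in> ?M" "(z, b) \<in> ?M" for y a z b
    proof -
      from that obtain t s u w where "y = complex_of_real t *\<^sub>C h + L u" "a = t" "0 \<le> t"
        "z = complex_of_real s *\<^sub>C h + L w" "b = s" "0 \<le> s" by auto
      then show ?thesis
        by (auto intro!: exI[of _ "u + w"] simp: scaleC_add_left algebra_simps L_lin)
    qed
    show "(complex_of_real s *\<^sub>C y, s * a) \<in> ?M" if "(y, a) \<in> ?M" "0 < s" for y a s
    proof -
      from that(1) obtain t u where "y = complex_of_real t *\<^sub>C h + L u" "a = t" "0 \<le> t" by auto
      then show ?thesis
        using that(2)
        by (auto intro!: exI[of _ "complex_of_real s *\<^sub>C u"] simp: scaleC_scaleC scaleC_add_right L_lin)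
    qed
    show "a \<le> p y" if "(y, a) \<in> ?M" for y a
    proof -
      from that obtain u where u: "y = complex_of_real a *\<^sub>C h + L u" and "0 \<le> a" by auto
      show ?thesis
      proof (cases "a = 0")
        case True
        obtain i where "i \<in> I" using ne by auto
        then have "0 \<le> norm (y i) / R i" using R[of i] by simp
        then show ?thesis using True p_ge[OF \<open>i \<in> I\<close>, of y] by linarith
      next
        case False
        then have a: "0 < a" using \<open>0 \<le> a\<close> by simp
        \<comment> \<open>Dividing the point of the cone by \<open>- a\<close> brings it to the form
          \<open>L x - h\<close>, where \<open>viol\<close> applies.\<close>
        obtain i where i: "i \<in> I"
            "R i < norm ((\<Sum>n<N. c i n *\<^sub>C (complex_of_real (- (1 / a)) *\<^sub>C u) n) - h i)"
          using viol R_def by metis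
        have "norm (y i) = norm (complex_of_real (- a) *\<^sub>C (L (complex_of_real (- (1 / a)) *\<^sub>C u) i - h i))"
          using a unfolding u L_lin
          by (simp add: scaleC_fun_def complex_vector_space.scale_right_diff_distrib scaleC_scaleC scaleC_one
              complex_vector_space.scale_minus_left add.commute)
        also have "\<dots> = a * norm (L (complex_of_real (- (1 / a)) *\<^sub>C u) i - h i)"
          using a by (simp only: norm_scaleC) simp
        also have "\<dots> \<ge> a * R i"
          using a i(2) by (simp add: L_def)
        finally have "a \<le> norm (y i) / R i" using R[OF i(1)] by (simp add: field_simps)
        then show ?thesis using p_ge[OF i(1), of y] by linarith
      qed
    qed
  qed blast
  have f_lin: "f (x + y) = f x + f y" "f (a *\<^sub>C x) = a * f x" for x y a
    using f(1) by (auto simp: clinear_iff scaleC_complex_def)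
  have f0: "f 0 = 0" using f_lin(2)[of 0 0] by simp
  have fL: "f (L x) = 0" for x
  proof -
    have "(complex_of_real 0 *\<^sub>C h + L (a *\<^sub>C x), 0) \<in> ?M" for a by blast
    then have "0 \<le> Re (f (L (a *\<^sub>C x)))" for a
      using f(3)[of "complex_of_real 0 *\<^sub>C h + L (a *\<^sub>C x)" 0] by simp
    then have "0 \<le> Re (a * f (L x))" for a by (simp add: L_lin f_lin)
    from this[of 1] this[of "-1"] this[of \<i>] this[of "-\<i>"] show ?thesis
      by (simp add: complex_eq_iff)
  qed
  have "(complex_of_real 1 *\<^sub>C h + L 0, 1) \<in> ?M" using zero_le_one by blast
  from f(3)[OF this] have "1 \<le> Re (f (h + L 0))" by (simp add: scaleC_one)
  then have fh: "1 \<le> Re (f h)" by (simp add: f_lin fL)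
  define single where "single i z = (\<lambda>j. if j = i then z else 0)" for i :: 'i and z :: 'f
  have "\<exists>u. \<forall>z. cdual_apply u z = f (single i z)" if i: "i \<in> I" for i
  proof -
    obtain u where "cdual_apply u = (\<lambda>z. f (single i z))"
    proof (rule cdual_exists)
      have "single i (x + y) = single i x + single i y" "single i (a *\<^sub>C x) = a *\<^sub>C single i x" for x y a
        by (auto simp: single_def fun_eq_iff scaleC_fun_def)
      then show "clinear (\<lambda>z. f (single i z))"
        by (simp add: clinear_iff f_lin scaleC_complex_def)
      have "p (single i z) \<le> 1 / R i * norm z" for z
        unfolding p_le using R[OF i] by (auto simp: single_def)
      then show "cmod (f (single i z)) \<le> 1 / R i * norm z" for z
        using f(2) order_trans by blast
    qed blast
    then show ?thesis by metis
  qed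
  then obtain u where u: "\<And>i z. i \<in> I \<Longrightarrow> cdual_apply (u i) z = f (single i z)" by metis
  have f_eq: "f w = (\<Sum>i\<in>I. cdual_apply (u i) (w i))" for w
  proof -
    \<comment> \<open>\<open>p\<close> does not see coordinates outside \<open>I\<close>, so
      \<open>f\<close> vanishes on the part of \<open>w\<close> supported there.\<close>
    define r where "r = (\<lambda>i. if i \<in> I then 0 else w i)"
    have sum_f: "f (\<Sum>i\<in>J. g i) = (\<Sum>i\<in>J. f (g i))" for J and g :: "'i \<Rightarrow> _"
      by (induction J rule: infinite_finite_induct) (simp_all only: sum.infinite sum.empty sum.insert f0 f_lin not_False_eq_True)
    have ev: "(\<Sum>i\<in>J. single i (w i)) j = (\<Sum>i\<in>J. single i (w i) j)" for J j
      by (induction J rule: infinite_finite_induct) simp_all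
    have "w = (\<Sum>i\<in>I. single i (w i)) + r"
    proof (rule ext)
      fix j
      have "(\<Sum>i\<in>I. single i (w i) j) = (if j \<in> I then w j else 0)"
        using I by (simp add: single_def)
      then show "w j = ((\<Sum>i\<in>I. single i (w i)) + r) j"
        by (simp add: ev r_def)
    qed
    then have "f w = (\<Sum>i\<in>I. f (single i (w i))) + f r"
      by (metis f_lin(1) sum_f)
    moreover have "p r \<le> 0" unfolding p_le by (simp add: r_def)
    then have "cmod (f r) \<le> 0" using f(2)[of r] by linarith
    then have "f r = 0" by simp
    ultimately show ?thesis using u by simp
  qed
  have cu: "(\<Sum>i\<in>I. c i n *\<^sub>C u i) = 0" if "n < N" for n
  proof (rule cdual_eqI)
    fix y
    have "L (\<lambda>m. if m = n then y else 0) i = c i n *\<^sub>C y" for i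
    proof -
      have "L (\<lambda>m. if m = n then y else 0) i = (\<Sum>m<N. if m = n then c i n *\<^sub>C y else 0)"
        unfolding L_def by (intro sum.cong) auto
      then show ?thesis using that by simp
    qed
    then show "cdual_apply (\<Sum>i\<in>I. c i n *\<^sub>C u i) y = cdual_apply 0 y"
      using fL[of "\<lambda>m. if m = n then y else 0"] by (simp add: f_eq cdual_simps)
  qed
  have u_sum: "(\<Sum>i\<in>I. R i * cmod (cdual_apply (u i) (z i))) \<le> 1" if z: "\<And>i. norm (z i) \<le> 1" for z
  proof -
    \<comment> \<open>The phases make all terms of \<open>f ?w\<close> nonnegative while
      \<open>p ?w\<close> stays at most 1, so the bound on \<open>f\<close> becomes a weighted sum
      bound on the functionals \<open>u i\<close>.\<close>
    let ?w = "\<lambda>i. (complex_of_real (R i) * cnj (sgn (cdual_apply (u i) (z i)))) *\<^sub>C z i"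
    have sgn: "cnj (sgn a) * a = complex_of_real (cmod a)" for a
      using complex_norm_square[of a] by (cases "a = 0") (auto simp: sgn_eq power2_eq_square field_simps)
    have "f ?w = complex_of_real (\<Sum>i\<in>I. R i * cmod (cdual_apply (u i) (z i)))"
      by (simp add: f_eq cdual_simps mult.assoc sgn)
    moreover have "p ?w \<le> 1"
      unfolding p_le
    proof
      fix i assume i: "i \<in> I"
      have "norm (?w i) \<le> R i * (1 * 1)"
        unfolding norm_scaleC norm_mult mult.assoc
        using R[OF i] z[of i] by (intro mult_mono) (auto simp: norm_sgn)
      then show "norm (?w i) / R i \<le> 1" using R[OF i] by simp
    qed
    ultimately show ?thesis
      using f(2)[of ?w] complex_Re_le_cmod[of "f ?w"] by simp
  qed
  \<comment> \<open>The norm of \<open>u i\<close> need not be attained. Giving away half of \<eta>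
    makes the factor less than 1 and leaves the other half as the gap for the contradiction.\<close>
  have "\<exists>z. norm z \<le> 1 \<and> (\<rho> i + \<eta> / 2) / R i * norm (u i) \<le> cmod (cdual_apply (u i) z)" if "i \<in> I" for i
    using \<eta> R[OF that] by (intro cdual_almost_attained) (simp add: R_def)
  then obtain z' where z': "\<And>i. i \<in> I \<Longrightarrow> norm (z' i) \<le> 1"
      "\<And>i. i \<in> I \<Longrightarrow> (\<rho> i + \<eta> / 2) / R i * norm (u i) \<le> cmod (cdual_apply (u i) (z' i))"
    by metis
  define z where "z i = (if i \<in> I then z' i else 0)" for i
  have "(\<Sum>i\<in>I. (\<rho> i + \<eta> / 2) * norm (u i)) \<le> (\<Sum>i\<in>I. R i * cmod (cdual_apply (u i) (z i)))"
  proof (rule sum_mono)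
    fix i assume i: "i \<in> I"
    show "(\<rho> i + \<eta> / 2) * norm (u i) \<le> R i * cmod (cdual_apply (u i) (z i))"
      using z'(2)[OF i] R[OF i] i by (simp add: z_def field_simps)
  qed
  also have "\<dots> \<le> 1" by (rule u_sum) (simp add: z_def z'(1))
  finally have upper: "(\<Sum>i\<in>I. (\<rho> i + \<eta> / 2) * norm (u i)) \<le> 1" .
  \<comment> \<open>By \<open>cu\<close> the functionals \<open>\<Phi> n\<close> see nothing of the
    combinations of the \<open>u i\<close>, so the combinations of \<Phi> can be inserted at no
    cost. This brings in the hypothesis \<open>le\<close> on the bidual.\<close>
  have "f h = - (\<Sum>i\<in>I. cdual_apply ((\<Sum>n<N. c i n *\<^sub>C \<Phi> n) - evaluation (h i)) (u i))"
  proof -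
    have "(\<Sum>i\<in>I. cdual_apply (\<Sum>n<N. c i n *\<^sub>C \<Phi> n) (u i)) = (\<Sum>i\<in>I. \<Sum>n<N. cdual_apply (\<Phi> n) (c i n *\<^sub>C u i))"
      by (simp add: cdual_simps)
    also have "\<dots> = (\<Sum>n<N. cdual_apply (\<Phi> n) (\<Sum>i\<in>I. c i n *\<^sub>C u i))"
      by (subst sum.swap) (simp add: cdual_sum_right)
    also have "\<dots> = 0" by (simp add: cu)
    finally show ?thesis by (simp add: f_eq cdual_diff_left sum_subtractf)
  qed
  then have "cmod (f h) \<le> (\<Sum>i\<in>I. cmod (cdual_apply ((\<Sum>n<N. c i n *\<^sub>C \<Phi> n) - evaluation (h i)) (u i)))"
    by (simp add: norm_sum)
  also have "\<dots> \<le> (\<Sum>i\<in>I. \<rho> i * norm (u i))"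
    using le by (intro sum_mono order_trans[OF cdual_le] mult_right_mono) auto
  finally have lower: "1 \<le> (\<Sum>i\<in>I. \<rho> i * norm (u i))"
    using fh complex_Re_le_cmod[of "f h"] by linarith
  have "(\<Sum>i\<in>I. \<rho> i * norm (u i)) + \<eta> / 2 * (\<Sum>i\<in>I. norm (u i)) = (\<Sum>i\<in>I. (\<rho> i + \<eta> / 2) * norm (u i))"
    by (simp add: sum_distrib_left sum.distrib[symmetric] distrib_right)
  then have "\<eta> / 2 * (\<Sum>i\<in>I. norm (u i)) \<le> 0" using upper lower by linarith
  then have "(\<Sum>i\<in>I. norm (u i)) \<le> 0" using \<eta> by (simp add: mult_le_0_iff)
  then have "norm (u i) = 0" if "i \<in> I" for i
    using that I sum_nonneg_eq_0_iff[of I "\<lambda>i. norm (u i)"] by (simp add: order_antisym sum_nonneg)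
  then show False using lower by simp
qed

section \<open>Gauges for strong and weak summability\<close>

text \<open>With \<open>strong\<close> the gauges measure norms (giving \<open>lp\<close> and \<open>lp_norm\<close>), otherwise functionals in the
  dual unit ball (giving \<open>lpw\<close> and \<open>lpw_norm\<close>); this treats both kinds of compactness at once.\<close>
definition gauges :: "bool \<Rightarrow> ('a::complex_normed_vector \<Rightarrow> real) set"
  where "gauges strong =
    (if strong then {norm} else (\<lambda>\<phi> x. cmod (cdual_apply \<phi> x)) ` cball 0 1)"

text \<open>For nonnegative \<open>c\<close> this is membership in \<open>lp p\<close> or
  \<open>lpw p\<close> with norm at most \<open>c\<close>; see \<open>pbound_strong_iff\<close> and
  \<open>pbound_weak_iff\<close>.\<close>

definition pbound :: "bool \<Rightarrow> real \<Rightarrow> (nat \<Rightarrow> 'a::complex_normed_vector) \<Rightarrow> real \<Rightarrow> bool"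
  where "pbound s p x c \<longleftrightarrow> (\<forall>\<tau>\<in>gauges s. \<forall>N. (\<Sum>n<N. \<tau> (x n) powr p) \<le> c powr p)"

text \<open>In the weak case this is what distinguishes \<open>lpu p\<close> inside
  \<open>lpw p\<close> (\<open>lpu_iff\<close>); in the strong case it holds throughout
  \<open>lp p\<close> (\<open>pnull_strong\<close>).\<close>

definition pnull :: "bool \<Rightarrow> real \<Rightarrow> (nat \<Rightarrow> 'a::complex_normed_vector) \<Rightarrow> bool"
  where "pnull s p x \<longleftrightarrow> (\<forall>e>0. \<exists>m. pbound s p (\<lambda>n. x (n + m)) e)"

definition pcat :: "nat \<Rightarrow> (nat \<Rightarrow> 'a) \<Rightarrow> (nat \<Rightarrow> 'a) \<Rightarrow> nat \<Rightarrow> 'a"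
  where "pcat m x y n = (if n < m then x n else y (n - m))"

definition lq_ball :: "real \<Rightarrow> (nat \<Rightarrow> complex) set"
  where "lq_ball q = {b. \<forall>N. (\<Sum>n<N. cmod (b n) powr q) \<le> 1}"

text \<open>Membership of \<open>k\<close>, seen in the bidual, in the convex hull \<open>p_conv\<close> of \<open>\<Phi>\<close>, with weak-star convergence.\<close>
definition bidual_conv :: "real \<Rightarrow> (nat \<Rightarrow> 'a::complex_normed_vector cdual cdual) \<Rightarrow> 'a set"
  where "bidual_conv q \<Phi> = {k. \<exists>b\<in>lq_ball q. \<forall>y. (\<lambda>n. b n * cdual_apply (\<Phi> n) y) sums cdual_apply y k}"

lemma gauge_nonneg: "\<tau> \<in> gauges s \<Longrightarrow> 0 \<le> \<tau> x"
  by (auto simp: gauges_def split: if_splits)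

lemma gauge_scaleC: "\<tau> \<in> gauges s \<Longrightarrow> \<tau> (c *\<^sub>C x) = cmod c * \<tau> x"
  by (auto simp: gauges_def norm_scaleC cdual_simps norm_mult split: if_splits)

lemma gauge_le_norm: "\<tau> \<in> gauges s \<Longrightarrow> \<tau> x \<le> norm x"
  by (auto simp: gauges_def intro!: cdual_ball_le split: if_splits)

lemma gauge_zero: "\<tau> \<in> gauges s \<Longrightarrow> \<tau> 0 = 0"
  using gauge_le_norm[of \<tau> s 0] gauge_nonneg[of \<tau> s 0] by simp

lemma gauge_dual: "\<phi> \<in> cball 0 1 \<Longrightarrow> \<exists>\<tau>\<in>gauges s. \<forall>x. cmod (cdual_apply \<phi> x) \<le> \<tau> x"
  by (cases s) (auto simp: gauges_def intro: cdual_ball_le)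

lemma pcat_comp: "f (pcat m x y n) = pcat m (\<lambda>n. f (x n)) (\<lambda>n. f (y n)) n"
  by (simp add: pcat_def)

lemma pcat_shift: "pcat m x y (n + (M + m)) = y (n + M)"
  by (simp add: pcat_def)

lemma pcat_sums:
  fixes f g :: "nat \<Rightarrow> 'a::real_normed_vector"
  assumes "g sums s"
  shows "pcat m f g sums ((\<Sum>n<m. f n) + s)"
proof -
  have "(\<lambda>n. pcat m f g (n + m)) sums s" using assms by (simp add: pcat_def)
  then show ?thesis
    by (subst (asm) sums_iff_shift) (simp add: pcat_def add.commute)
qed

lemma sum_pcat_le:
  fixes f g :: "nat \<Rightarrow> real"
  assumes "\<And>n. 0 \<le> f n" "\<And>n. 0 \<le> g n" "(\<Sum>n<m. f n) \<le> B" "\<And>M. (\<Sum>n<M. g n) \<le> C"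
  shows "(\<Sum>n<M. pcat m f g n) \<le> B + C"
proof -
  have "(\<Sum>n<M. pcat m f g n) \<le> (\<Sum>n<m + M. pcat m f g n)"
    using assms by (intro sum_mono2) (auto simp: pcat_def)
  also have "\<dots> = (\<Sum>n<m. f n) + (\<Sum>n<M. g n)"
    by (induction M) (simp_all add: pcat_def)
  finally show ?thesis using assms(3) assms(4)[of M] by linarith
qed

text \<open>Round the first \<open>N\<close> coordinates to a square grid of side
  \<open>h / 2\<close>. Only finitely many patterns of cells occur, and one representative is kept
  for each. The net is a net of coefficients; nothing is said about distances between the elements
  of \<open>K\<close> themselves.\<close>

lemma finite_net:
  fixes a :: "'k \<Rightarrow> nat \<Rightarrow> complex"
  assumes bd: "\<And>k n. k \<in> K \<Longrightarrow> n < N \<Longrightarrow> cmod (a k n) \<le> 1" and h: "0 < h"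
  obtains K0 \<kappa> where "finite K0" "K0 \<subseteq> K" "\<And>k. k \<in> K \<Longrightarrow> \<kappa> k \<in> K0"
    "\<And>k n. k \<in> K \<Longrightarrow> n < N \<Longrightarrow> cmod (a k n - a (\<kappa> k) n) \<le> h"
proof -
  define cell where "cell z = (\<lfloor>Re z * (2 / h)\<rfloor>, \<lfloor>Im z * (2 / h)\<rfloor>)" for z
  define g where "g k = map (\<lambda>n. cell (a k n)) [0..<N]" for k
  define B where "B = {\<lfloor>- (2 / h)\<rfloor>..\<lfloor>2 / h\<rfloor>}"
  have cellB: "cell z \<in> B \<times> B" if "cmod z \<le> 1" for z
  proof -
    have *: "\<lfloor>t * (2 / h)\<rfloor> \<in> B" if "\<bar>t\<bar> \<le> 1" for t :: real
    proof -
      have "t * (2 / h) \<le> 1 * (2 / h)" "(-1) * (2 / h) \<le> t * (2 / h)"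
        using that h by (intro mult_right_mono; simp)+
      then show ?thesis unfolding B_def by (auto intro!: floor_mono)
    qed
    show ?thesis
      using *[of "Re z"] *[of "Im z"] that abs_Re_le_cmod[of z] abs_Im_le_cmod[of z]
      by (simp add: cell_def)
  qed
  have "g ` K \<subseteq> {xs. set xs \<subseteq> B \<times> B \<and> length xs = N}"
  proof
    fix xs assume "xs \<in> g ` K"
    then obtain k where k: "k \<in> K" "xs = g k" by auto
    have "cell (a k n) \<in> B \<times> B" if "n < N" for n by (rule cellB[OF bd[OF k(1) that]])
    then have "set xs \<subseteq> B \<times> B"
      unfolding k(2) g_def set_map by (intro image_subsetI) simp
    then show "xs \<in> {xs. set xs \<subseteq> B \<times> B \<and> length xs = N}"
      by (simp add: k(2) g_def)
  qed
  moreover have "finite {xs. set xs \<subseteq> B \<times> B \<and> length xs = N}"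
    by (rule finite_lists_length_eq) (simp add: B_def)
  ultimately have fin: "finite (g ` K)" by (rule finite_subset)
  define \<kappa> where "\<kappa> k = inv_into K g (g k)" for k
  have \<kappa>: "\<kappa> k \<in> K" "g (\<kappa> k) = g k" if "k \<in> K" for k
    using that unfolding \<kappa>_def by (auto intro: inv_into_into f_inv_into_f)
  show thesis
  proof (rule that[of "inv_into K g ` g ` K" \<kappa>])
    show "cmod (a k n - a (\<kappa> k) n) \<le> h" if "k \<in> K" "n < N" for k n
    proof -
      have "g (\<kappa> k) ! n = g k ! n" by (simp only: \<kappa>(2)[OF that(1)])
      then have "cell (a (\<kappa> k) n) = cell (a k n)"
        using that(2) by (simp add: g_def)
      moreover have close: "\<bar>t - u\<bar> \<le> h / 2" if "\<lfloor>t * (2 / h)\<rfloor> = \<lfloor>u * (2 / h)\<rfloor>" for t u :: real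
      proof -
        have "\<bar>t * (2 / h) - u * (2 / h)\<bar> \<le> 1" using that by linarith
        moreover have "\<bar>t * (2 / h) - u * (2 / h)\<bar> = \<bar>t - u\<bar> * (2 / h)"
          using h by (simp only: left_diff_distrib[symmetric] abs_mult) simp
        ultimately have "\<bar>t - u\<bar> * (2 / h) \<le> 1" by simp
        then show ?thesis using h by (simp add: field_simps)
      qed
      ultimately have "\<bar>Re (a k n - a (\<kappa> k) n)\<bar> \<le> h / 2" "\<bar>Im (a k n - a (\<kappa> k) n)\<bar> \<le> h / 2"
        by (auto simp: cell_def intro!: close)
      then show ?thesis using cmod_le[of "a k n - a (\<kappa> k) n"] by linarith
    qed
  qed (use fin \<kappa> in \<open>auto simp: \<kappa>_def\<close>)
qed

section \<open>Calculus of \<open>pbound\<close> and \<open>pnull\<close>, and local reflexivity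
  with control of \<open>pbound\<close>\<close>

context conjugate_exponents
begin

lemma powr_le_self: "0 \<le> t \<Longrightarrow> t \<le> 1 \<Longrightarrow> t powr p \<le> t"
  using p_gt_1 powr_mono'[of 1 p t] by (cases "t = 0") auto

text \<open>Crude, but harmless wherever the size \<open>t\<close> of the terms may be chosen after
  their number \<open>m\<close>.\<close>

lemma const_block_le: "0 \<le> t \<Longrightarrow> real m * t powr p \<le> (real m * t) powr p"
proof (induction m)
  case (Suc m)
  have "real (Suc m) * t powr p = t powr p + real m * t powr p" by (simp add: distrib_right)
  also have "\<dots> \<le> t powr p + (real m * t) powr p" using Suc by simp
  also have "\<dots> \<le> (t + real m * t) powr p" using Suc by (intro powr_add_superadditive) auto
  finally show ?case by (simp add: distrib_right)
qed simp

lemma lq_ball_le: "b \<in> lq_ball q \<Longrightarrow> cmod (b n) \<le> 1"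
proof -
  assume "b \<in> lq_ball q"
  then have "(\<Sum>n<Suc n. cmod (b n) powr q) \<le> 1" unfolding lq_ball_def by blast
  moreover have "0 \<le> (\<Sum>n<n. cmod (b n) powr q)" by (intro sum_nonneg) auto
  ultimately have "cmod (b n) powr q \<le> 1 powr q" by simp
  then show ?thesis using conjugate_exponents.powr_le_cancel[OF swap, of 1 "cmod (b n)"] by simp
qed

lemma lq_ball_sum: "b \<in> lq_ball q \<Longrightarrow> finite I \<Longrightarrow> (\<Sum>n\<in>I. cmod (b n) powr q) \<le> 1"
proof -
  assume b: "b \<in> lq_ball q" and "finite I"
  then obtain N where "I \<subseteq> {..<N}" using finite_nat_bounded by blast
  then have "(\<Sum>n\<in>I. cmod (b n) powr q) \<le> (\<Sum>n<N. cmod (b n) powr q)" by (intro sum_mono2) auto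
  then show ?thesis using b unfolding lq_ball_def by (metis (no_types, lifting) mem_Collect_eq order_trans)
qed

lemma pbound_sum:
  assumes "pbound s p x c" "\<tau> \<in> gauges s" "finite I"
  shows "(\<Sum>n\<in>I. \<tau> (x n) powr p) \<le> c powr p"
proof -
  obtain N where "I \<subseteq> {..<N}" using finite_nat_bounded[OF assms(3)] by blast
  then have "(\<Sum>n\<in>I. \<tau> (x n) powr p) \<le> (\<Sum>n<N. \<tau> (x n) powr p)" by (intro sum_mono2) auto
  then show ?thesis using assms(1,2) unfolding pbound_def by (meson order_trans)
qed

lemma pbound_dual_sum:
  assumes "pbound s p x c" "\<phi> \<in> cball 0 1" "finite I"
  shows "(\<Sum>n\<in>I. cmod (cdual_apply \<phi> (x n)) powr p) \<le> c powr p"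
proof -
  obtain \<tau> where \<tau>: "\<tau> \<in> gauges s" "\<And>x. cmod (cdual_apply \<phi> x) \<le> \<tau> x"
    using gauge_dual[OF assms(2)] by blast
  have "(\<Sum>n\<in>I. cmod (cdual_apply \<phi> (x n)) powr p) \<le> (\<Sum>n\<in>I. \<tau> (x n) powr p)"
    using \<tau>(2) p_pos by (intro sum_mono powr_mono2) auto
  then show ?thesis using pbound_sum[OF assms(1) \<tau>(1) assms(3)] by linarith
qed

text \<open>Weak summability in the bidual is tested by the third dual; the points \<open>y\<close>
  of the dual enter through \<open>evaluation\<close>.\<close>

lemma pbound_eval_sum:
  assumes "pbound s p \<Phi> c" "norm y \<le> 1" "finite I"
  shows "(\<Sum>n\<in>I. cmod (cdual_apply (\<Phi> n) y) powr p) \<le> c powr p"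
  using pbound_dual_sum[OF assms(1) _ assms(3), of "evaluation y"] norm_evaluation_le[of y] assms(2)
  by simp

lemma pbound_mono:
  assumes "pbound s p x c" "0 \<le> c" "c \<le> d"
  shows "pbound s p x d"
proof -
  have "c powr p \<le> d powr p" using assms p_pos by (intro powr_mono2) auto
  then show ?thesis using assms(1) unfolding pbound_def by (meson order_trans)
qed

lemma pbound_scaleC:
  assumes "pbound s p x c" "0 \<le> c"
  shows "pbound s p (\<lambda>n. a *\<^sub>C x n) (cmod a * c)"
  unfolding pbound_def
proof (intro ballI allI)
  fix \<tau> :: "'a \<Rightarrow> real" and N assume \<tau>: "\<tau> \<in> gauges s"
  have "(\<Sum>n<N. \<tau> (a *\<^sub>C x n) powr p) = cmod a powr p * (\<Sum>n<N. \<tau> (x n) powr p)"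
    using gauge_nonneg[OF \<tau>] by (simp add: gauge_scaleC[OF \<tau>] powr_mult sum_distrib_left)
  also have "\<dots> \<le> cmod a powr p * c powr p"
    using pbound_sum[OF assms(1) \<tau>] by (intro mult_left_mono) auto
  finally show "(\<Sum>n<N. \<tau> (a *\<^sub>C x n) powr p) \<le> (cmod a * c) powr p"
    using assms(2) by (simp add: powr_mult)
qed

lemma pbound_shift_mono:
  assumes "pbound s p (\<lambda>n. x (n + m)) c" "m \<le> m'"
  shows "pbound s p (\<lambda>n. x (n + m')) c"
  unfolding pbound_def
proof (intro ballI allI)
  fix \<tau> :: "'a \<Rightarrow> real" and N assume \<tau>: "\<tau> \<in> gauges s"
  have "(\<Sum>n<N. \<tau> (x (n + m')) powr p) = (\<Sum>n\<in>(\<lambda>n. n + (m' - m)) ` {..<N}. \<tau> (x (n + m)) powr p)"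
    using assms(2) by (subst sum.reindex) (auto simp: inj_on_def)
  also have "\<dots> \<le> c powr p" by (rule pbound_sum[OF assms(1) \<tau>]) simp
  finally show "(\<Sum>n<N. \<tau> (x (n + m')) powr p) \<le> c powr p" .
qed

lemma pbound_pcat:
  assumes "pbound s p x c" "pbound s p y d" "0 \<le> c" "0 \<le> d"
  shows "pbound s p (pcat m x y) (c + d)"
  unfolding pbound_def
proof (intro ballI allI)
  fix \<tau> :: "'a \<Rightarrow> real" and N assume \<tau>: "\<tau> \<in> gauges s"
  have "(\<Sum>n<N. \<tau> (pcat m x y n) powr p) = (\<Sum>n<N. pcat m (\<lambda>n. \<tau> (x n) powr p) (\<lambda>n. \<tau> (y n) powr p) n)"
    by (intro sum.cong refl pcat_comp[where f="\<lambda>z. \<tau> z powr p"])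
  also have "\<dots> \<le> c powr p + d powr p"
    by (intro sum_pcat_le pbound_sum[OF assms(1) \<tau>] pbound_sum[OF assms(2) \<tau>]) auto
  also have "\<dots> \<le> (c + d) powr p" by (rule powr_add_superadditive[OF assms(3,4)])
  finally show "(\<Sum>n<N. \<tau> (pcat m x y n) powr p) \<le> (c + d) powr p" .
qed

lemma pbound_block:
  assumes "\<And>n. n < m \<Longrightarrow> norm (x n) \<le> t" "\<And>n. m \<le> n \<Longrightarrow> x n = 0" "0 \<le> t"
  shows "pbound s p x (real m * t)"
  unfolding pbound_def
proof (intro ballI allI)
  fix \<tau> :: "'a \<Rightarrow> real" and N assume \<tau>: "\<tau> \<in> gauges s"
  have "(\<Sum>n<N. \<tau> (x n) powr p) \<le> (\<Sum>n<N. if n < m then t powr p else 0)"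
  proof (rule sum_mono)
    fix n
    show "\<tau> (x n) powr p \<le> (if n < m then t powr p else 0)"
      using assms(1)[of n] assms(2)[of n] gauge_le_norm[OF \<tau>, of "x n"] gauge_nonneg[OF \<tau>, of "x n"] p_pos
      by (auto simp: gauge_zero[OF \<tau>] intro!: powr_mono2)
  qed
  also have "\<dots> = (\<Sum>n\<in>{..<N} \<inter> {..<m}. t powr p)"
    by (subst sum.inter_restrict) simp_all
  also have "\<dots> \<le> (\<Sum>n<m. t powr p)" by (intro sum_mono2) auto
  also have "\<dots> \<le> (real m * t) powr p" using const_block_le[OF assms(3)] by simp
  finally show "(\<Sum>n<N. \<tau> (x n) powr p) \<le> (real m * t) powr p" .
qed

lemma pnull_scaleC: "pnull s p x \<Longrightarrow> pnull s p (\<lambda>n. a *\<^sub>C x n)"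
  unfolding pnull_def
proof (intro allI impI)
  fix e :: real assume x: "\<forall>e>0. \<exists>m. pbound s p (\<lambda>n. x (n + m)) e" and e: "0 < e"
  have "0 < e / (cmod a + 1)" using e by (intro divide_pos_pos) (auto intro: add_nonneg_pos)
  then obtain m where "pbound s p (\<lambda>n. x (n + m)) (e / (cmod a + 1))" using x by blast
  then have "pbound s p (\<lambda>n. a *\<^sub>C x (n + m)) (cmod a * (e / (cmod a + 1)))"
    using e by (intro pbound_scaleC) auto
  moreover have "cmod a * (e / (cmod a + 1)) \<le> e"
    using e by (simp add: divide_le_eq add_nonneg_pos distrib_right mult.commute)
  ultimately show "\<exists>m. pbound s p (\<lambda>n. a *\<^sub>C x (n + m)) e"
    using e pbound_mono[of s "\<lambda>n. a *\<^sub>C x (n + m)" "cmod a * (e / (cmod a + 1))" e] by auto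
qed

lemma pnull_shift: "pnull s p x \<Longrightarrow> pnull s p (\<lambda>n. x (n + k))"
  unfolding pnull_def
proof (intro allI impI)
  fix e :: real assume x: "\<forall>e>0. \<exists>m. pbound s p (\<lambda>n. x (n + m)) e" and e: "0 < e"
  then obtain m where "pbound s p (\<lambda>n. x (n + m)) e" by blast
  then have "pbound s p (\<lambda>n. x (n + (m + k))) e" by (rule pbound_shift_mono) simp
  then show "\<exists>m. pbound s p (\<lambda>n. x (n + m + k)) e" by (auto simp: add.assoc)
qed

lemma pnull_pcat: "pnull s p y \<Longrightarrow> pnull s p (pcat m x y)"
  unfolding pnull_def
proof (intro allI impI)
  fix e :: real assume y: "\<forall>e>0. \<exists>m. pbound s p (\<lambda>n. y (n + m)) e" and e: "0 < e"
  then obtain M where "pbound s p (\<lambda>n. y (n + M)) e" by blast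
  then have "pbound s p (\<lambda>n. pcat m x y (n + (M + m))) e" by (simp only: pcat_shift)
  then show "\<exists>M. pbound s p (\<lambda>n. pcat m x y (n + M)) e" by blast
qed

lemma bidual_conv_block_le:
  fixes \<Phi> :: "nat \<Rightarrow> 'a::complex_normed_vector cdual cdual"
  assumes "pbound s p \<Phi> c" "0 \<le> c" "(\<Sum>n\<in>I. cmod (b n) powr q) \<le> 1" "finite I"
  shows "norm (\<Sum>n\<in>I. b n *\<^sub>C \<Phi> n) \<le> c"
proof (rule cdual_norm_le_ball[OF assms(2)])
  fix y :: "'a cdual" assume "norm y \<le> 1"
  then show "cmod (cdual_apply (\<Sum>n\<in>I. b n *\<^sub>C \<Phi> n) y) \<le> c"
    using assms by (simp add: cdual_simps Holder_norm_sum pbound_eval_sum)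
qed

text \<open>The bound on the new sequence must itself become finitely many norm constraints. In the
  strong case each term is bounded separately. In the weak case the bound means that all
  combinations with coefficients in the \<open>q\<close>-ball have norm at most \<open>A\<close>,
  and a finite net of that ball suffices.\<close>

lemma local_reflexivity_gauge:
  fixes \<Phi> :: "nat \<Rightarrow> 'f::complex_normed_vector cdual cdual" and h :: "'i \<Rightarrow> 'f"
  assumes \<Phi>: "pbound s p \<Phi> A" "0 \<le> A" and I: "finite I" and \<epsilon>: "0 < \<epsilon>"
    and le: "\<And>i. i \<in> I \<Longrightarrow> norm ((\<Sum>n<N. a i n *\<^sub>C \<Phi> n) - evaluation (h i)) \<le> \<rho>"
  shows "\<exists>x. pbound s p x (A + \<epsilon>) \<and>
    (\<forall>i\<in>I. norm ((\<Sum>n<N. a i n *\<^sub>C x n) - h i) \<le> \<rho> + \<epsilon>)"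
proof (cases s)
  case True
  \<comment> \<open>Each of the \<open>N\<close> terms may grow by \<eta>; by Minkowski and
    \<open>const_block_le\<close> the total growth is at most \<epsilon>.\<close>
  define \<eta> where "\<eta> = \<epsilon> / (real N + 1)"
  have \<eta>: "0 < \<eta>" "\<eta> \<le> \<epsilon>" "real N * \<eta> \<le> \<epsilon>"
    using \<epsilon> by (auto simp: \<eta>_def field_simps)
  \<comment> \<open>\<open>Inl\<close> carries the given constraints, while \<open>Inr m\<close>
    singles out the term \<open>m\<close>, with target 0 and radius
    \<open>norm (\<Phi> m)\<close>.\<close>
  define c where "c = case_sum a (\<lambda>m n. if n = m then 1 else (0::complex))"
  have unit: "(\<Sum>n<N. c (Inr m) n *\<^sub>C z n) = z m" if "m < N" for m and z :: "nat \<Rightarrow> 'b::complex_vector"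
  proof -
    have "(\<Sum>n<N. c (Inr m) n *\<^sub>C z n) = (\<Sum>n<N. if n = m then z n else 0)"
      by (intro sum.cong) (auto simp: c_def scaleC_one)
    then show ?thesis using that by simp
  qed
  have ev0: "evaluation (0::'f) = 0" by (rule cdual_eqI) simp
  have "\<exists>x. \<forall>j\<in>I <+> {..<N}. norm ((\<Sum>n<N. c j n *\<^sub>C x n) - case_sum h (\<lambda>_. 0) j)
      \<le> case_sum (\<lambda>_. \<rho>) (\<lambda>m. norm (\<Phi> m)) j + \<eta>"
  proof (rule local_reflexivity[OF _ \<eta>(1)])
    show "norm ((\<Sum>n<N. c j n *\<^sub>C \<Phi> n) - evaluation (case_sum h (\<lambda>_. 0) j))
      \<le> case_sum (\<lambda>_. \<rho>) (\<lambda>m. norm (\<Phi> m)) j" if "j \<in> I <+> {..<N}" for j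
      using that le by (auto simp: unit ev0) (auto simp: c_def)
  qed (use I in simp)
  then obtain x where x: "\<And>j. j \<in> I <+> {..<N} \<Longrightarrow> norm ((\<Sum>n<N. c j n *\<^sub>C x n) - case_sum h (\<lambda>_. 0) j)
      \<le> case_sum (\<lambda>_. \<rho>) (\<lambda>m. norm (\<Phi> m)) j + \<eta>" by blast
  have xI: "norm ((\<Sum>n<N. a i n *\<^sub>C x n) - h i) \<le> \<rho> + \<epsilon>" if "i \<in> I" for i
    using x[OF InlI[OF that]] \<eta>(2) by (auto simp: c_def)
  have xN: "norm (x m) \<le> norm (\<Phi> m) + \<eta>" if "m < N" for m
    using x[OF InrI, of m] that by (auto simp: unit)
  \<comment> \<open>Local reflexivity says nothing about terms from \<open>N\<close> on, so they are
    set to 0.\<close>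
  define x' where "x' n = (if n < N then x n else 0)" for n
  have sumN: "(\<Sum>n<N. (norm (\<Phi> n) + \<eta>) powr p) \<le> (A + \<epsilon>) powr p"
  proof -
    have "(\<Sum>n<N. cmod (complex_of_real (norm (\<Phi> n)) + complex_of_real \<eta>) powr p) \<le> (A + \<epsilon>) powr p"
    proof (rule Minkowski_sum)
      show "(\<Sum>n<N. cmod (complex_of_real (norm (\<Phi> n))) powr p) \<le> A powr p"
        using pbound_sum[OF \<Phi>(1), of norm] True by (simp add: gauges_def)
      have "(\<Sum>n<N. cmod (complex_of_real \<eta>) powr p) = real N * \<eta> powr p" using \<eta> by simp
      also have "\<dots> \<le> (real N * \<eta>) powr p" using \<eta> by (intro const_block_le) auto
      also have "\<dots> \<le> \<epsilon> powr p" using \<eta> p_pos by (intro powr_mono2) auto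
      finally show "(\<Sum>n<N. cmod (complex_of_real \<eta>) powr p) \<le> \<epsilon> powr p" .
    qed (use \<Phi> \<epsilon> in auto)
    moreover have "cmod (complex_of_real (norm (\<Phi> n)) + complex_of_real \<eta>) = norm (\<Phi> n) + \<eta>" for n
      using \<eta>(1) by (simp flip: of_real_add)
    ultimately show ?thesis by simp
  qed
  have "pbound s p x' (A + \<epsilon>)"
    unfolding pbound_def
  proof (intro ballI allI)
    fix \<tau> :: "'f \<Rightarrow> real" and M assume "\<tau> \<in> gauges s"
    then have \<tau>: "\<tau> = norm" using True by (simp add: gauges_def)
    have "(\<Sum>n<M. norm (x' n) powr p) = (\<Sum>n\<in>{..<M} \<inter> {..<N}. norm (x n) powr p)"
      using p_pos by (intro sum.mono_neutral_cong_right) (auto simp: x'_def)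
    also have "\<dots> \<le> (\<Sum>n<N. norm (x n) powr p)" by (intro sum_mono2) auto
    also have "\<dots> \<le> (\<Sum>n<N. (norm (\<Phi> n) + \<eta>) powr p)"
      using xN p_pos by (intro sum_mono powr_mono2) auto
    finally show "(\<Sum>n<M. \<tau> (x' n) powr p) \<le> (A + \<epsilon>) powr p"
      unfolding \<tau> using sumN by linarith
  qed
  then show ?thesis using xI by (intro exI[of _ x']) (simp add: x'_def)
next
  case False
  \<comment> \<open>Passing from the net to the whole ball gives
    \<open>w \<le> A + \<epsilon> / 2 + e * w\<close> for the weak norm \<open>w\<close> of the
    terms below; this \<open>e\<close> is the value for which solving for \<open>w\<close> yields
    \<open>A + \<epsilon>\<close>.\<close>
  define e where "e = \<epsilon> / (2 * (A + \<epsilon>))"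
  have e: "0 < e" "e < 1" and Ae: "A + \<epsilon> / 2 = (1 - e) * (A + \<epsilon>)"
    using \<epsilon> \<Phi>(2) by (auto simp: e_def field_simps)
  define B where "B = {b :: nat \<Rightarrow> complex. (\<Sum>n<N. cmod (b n) powr q) \<le> 1}"
  have Ble: "cmod (b n) \<le> 1" if "b \<in> B" "n < N" for b n
  proof -
    have "cmod (b n) powr q \<le> (\<Sum>n<N. cmod (b n) powr q)"
      using that by (intro member_le_sum) auto
    then show ?thesis
      using that conjugate_exponents.powr_le_cancel[OF swap, of 1 "cmod (b n)"] by (simp add: B_def)
  qed
  have mesh: "0 < e / (real N + 1)" using e by simp
  obtain B0 \<beta> where B0: "finite B0" "B0 \<subseteq> B" "\<And>b. b \<in> B \<Longrightarrow> \<beta> b \<in> B0"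
      "\<And>b n. b \<in> B \<Longrightarrow> n < N \<Longrightarrow> cmod (b n - \<beta> b n) \<le> e / (real N + 1)"
    by (rule finite_net[of B N "\<lambda>b. b", OF _ mesh]) (rule Ble, assumption+, blast)
  define c where "c = case_sum a (\<lambda>b. b)"
  have ev0: "evaluation (0::'f) = 0" by (rule cdual_eqI) simp
  have "\<exists>x. \<forall>j\<in>I <+> B0. norm ((\<Sum>n<N. c j n *\<^sub>C x n) - case_sum h (\<lambda>_. 0) j)
      \<le> case_sum (\<lambda>_. \<rho>) (\<lambda>_. A) j + \<epsilon> / 2"
  proof (rule local_reflexivity)
    show "norm ((\<Sum>n<N. c j n *\<^sub>C \<Phi> n) - evaluation (case_sum h (\<lambda>_. 0) j))
      \<le> case_sum (\<lambda>_. \<rho>) (\<lambda>_. A) j" if "j \<in> I <+> B0" for j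
      using that le B0(2) \<Phi> by (auto simp: c_def ev0 B_def intro!: bidual_conv_block_le)
  qed (use I B0(1) \<epsilon> in auto)
  then obtain x where x: "\<And>j. j \<in> I <+> B0 \<Longrightarrow> norm ((\<Sum>n<N. c j n *\<^sub>C x n) - case_sum h (\<lambda>_. 0) j)
      \<le> case_sum (\<lambda>_. \<rho>) (\<lambda>_. A) j + \<epsilon> / 2" by blast
  have xI: "norm ((\<Sum>n<N. a i n *\<^sub>C x n) - h i) \<le> \<rho> + \<epsilon>" if "i \<in> I" for i
    using x[OF InlI[OF that]] \<epsilon> by (auto simp: c_def)
  have xB: "norm (\<Sum>n<N. b n *\<^sub>C x n) \<le> A + \<epsilon> / 2" if "b \<in> B0" for b
    using x[OF InrI[OF that]] by (auto simp: c_def)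
  define x' where "x' n = (if n < N then x n else 0)" for n
  have key: "(\<Sum>n<N. cmod (cdual_apply \<phi> (x n)) powr p) \<le> (A + \<epsilon>) powr p" if \<phi>: "\<phi> \<in> cball 0 1" for \<phi>
  proof -
    define w where "w = (\<Sum>n<N. cmod (cdual_apply \<phi> (x n)) powr p) powr (1 / p)"
    have wp: "(\<Sum>n<N. cmod (cdual_apply \<phi> (x n)) powr p) = w powr p"
      unfolding w_def by (subst powr_root_p) (auto intro: sum_nonneg)
    have w: "0 \<le> w" by (simp add: w_def)
    obtain b where b: "(\<Sum>n<N. cmod (b n) powr q) \<le> 1"
        "(\<Sum>n<N. b n * cdual_apply \<phi> (x n)) = complex_of_real w"
      unfolding w_def by (rule Holder_attained[where s="\<lambda>n. cdual_apply \<phi> (x n)"])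
    then have bB: "b \<in> B" by (simp add: B_def)
    \<comment> \<open>The distance from the extremal \<open>b\<close> to its net point, divided by
      \<open>e\<close>, lies in the \<open>q\<close>-ball again. By Hoelder this part contributes at
      most \<open>e * w\<close>, which is absorbed on the left.\<close>
    have "(\<Sum>n<N. cmod ((b n - \<beta> b n) / complex_of_real e) powr q) \<le> (\<Sum>n<N. 1 / (real N + 1))"
    proof (rule sum_mono)
      fix n assume "n \<in> {..<N}"
      then have "cmod ((b n - \<beta> b n) / complex_of_real e) \<le> 1 / (real N + 1)"
        using B0(4)[OF bB, of n] e by (simp add: norm_divide field_simps)
      moreover have "cmod ((b n - \<beta> b n) / complex_of_real e) \<le> 1"
        using calculation by (rule order_trans) simp
      ultimately show "cmod ((b n - \<beta> b n) / complex_of_real e) powr q \<le> 1 / (real N + 1)"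
        using conjugate_exponents.powr_le_self[OF swap, of "cmod ((b n - \<beta> b n) / complex_of_real e)"] by simp
    qed
    also have "\<dots> \<le> 1" by simp
    finally have d: "cmod (\<Sum>n<N. (b n - \<beta> b n) / complex_of_real e * cdual_apply \<phi> (x n)) \<le> w"
      using wp w by (intro Holder_norm_sum) auto
    have split: "b n * z = \<beta> b n * z + complex_of_real e * ((b n - \<beta> b n) / complex_of_real e * z)" for n z
      using e by (simp add: left_diff_distrib)
    have "complex_of_real w = cdual_apply \<phi> (\<Sum>n<N. \<beta> b n *\<^sub>C x n) +
        complex_of_real e * (\<Sum>n<N. (b n - \<beta> b n) / complex_of_real e * cdual_apply \<phi> (x n))"
      unfolding b(2)[symmetric] cdual_simps sum_distrib_left sum.distrib[symmetric]
      by (intro sum.cong refl split)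
    then have "w \<le> cmod (cdual_apply \<phi> (\<Sum>n<N. \<beta> b n *\<^sub>C x n) +
        complex_of_real e * (\<Sum>n<N. (b n - \<beta> b n) / complex_of_real e * cdual_apply \<phi> (x n)))"
      using w by (metis norm_of_real abs_of_nonneg order_refl)
    also have "\<dots> \<le> (A + \<epsilon> / 2) + e * w"
      using cdual_ball_le[OF \<phi>] xB[OF B0(3)[OF bB]] d e
      by (intro norm_triangle_mono) (auto simp: norm_mult intro: order_trans)
    finally have "(1 - e) * w \<le> (1 - e) * (A + \<epsilon>)" unfolding Ae by (simp add: algebra_simps)
    then have "w \<le> A + \<epsilon>" using e by simp
    then show ?thesis unfolding wp using w p_pos by (intro powr_mono2) auto
  qed
  have "pbound s p x' (A + \<epsilon>)"
    unfolding pbound_def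
  proof (intro ballI allI)
    fix \<tau> :: "'f \<Rightarrow> real" and M assume "\<tau> \<in> gauges s"
    then obtain \<phi> where \<phi>: "\<phi> \<in> cball 0 1" and \<tau>: "\<tau> = (\<lambda>x. cmod (cdual_apply \<phi> x))"
      using False by (auto simp: gauges_def)
    have "(\<Sum>n<M. \<tau> (x' n) powr p) = (\<Sum>n\<in>{..<M} \<inter> {..<N}. \<tau> (x n) powr p)"
      using p_pos by (intro sum.mono_neutral_cong_right) (auto simp: x'_def \<tau>)
    also have "\<dots> \<le> (\<Sum>n<N. \<tau> (x n) powr p)" by (intro sum_mono2) auto
    also have "\<dots> \<le> (A + \<epsilon>) powr p" unfolding \<tau> by (rule key[OF \<phi>])
    finally show "(\<Sum>n<M. \<tau> (x' n) powr p) \<le> (A + \<epsilon>) powr p" .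
  qed
  then show ?thesis using xI by (intro exI[of _ x']) (simp add: x'_def)
qed

end

section \<open>Approximation by finite blocks\<close>

context conjugate_exponents
begin

text \<open>Test on the unit ball of the dual, where the series converges pointwise, and apply
  Hoelder to the tail. With \<open>N = 0\<close> this bounds \<open>evaluation k\<close>
  itself.\<close>

lemma bidual_tail_le:
  fixes \<Phi> :: "nat \<Rightarrow> 'f::complex_normed_vector cdual cdual"
  assumes b: "b \<in> lq_ball q" and sums: "\<And>y. (\<lambda>n. b n * cdual_apply (\<Phi> n) y) sums cdual_apply y k"
    and tail: "pbound s p (\<lambda>n. \<Phi> (n + N)) c" and c: "0 \<le> c"
  shows "norm ((\<Sum>n<N. b n *\<^sub>C \<Phi> n) - evaluation k) \<le> c"
proof (rule cdual_norm_le_ball[OF c])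
  fix y :: "'f cdual" assume y: "norm y \<le> 1"
  have "(\<lambda>n. b (n + N) * cdual_apply (\<Phi> (n + N)) y) sums (cdual_apply y k - (\<Sum>n<N. b n * cdual_apply (\<Phi> n) y))"
    using sums[of y] by (subst sums_iff_shift) simp
  then have lim: "(\<lambda>M. \<Sum>n<M. b (n + N) * cdual_apply (\<Phi> (n + N)) y)
      \<longlonglongrightarrow> cdual_apply y k - (\<Sum>n<N. b n * cdual_apply (\<Phi> n) y)"
    by (simp add: sums_def)
  have "cmod (\<Sum>n<M. b (n + N) * cdual_apply (\<Phi> (n + N)) y) \<le> c" for M
  proof (rule Holder_norm_sum)
    have "(\<Sum>n<M. cmod (b (n + N)) powr q) = (\<Sum>n\<in>(\<lambda>n. n + N) ` {..<M}. cmod (b n) powr q)"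
      by (subst sum.reindex) (auto simp: inj_on_def)
    then show "(\<Sum>n<M. cmod (b (n + N)) powr q) \<le> 1" using lq_ball_sum[OF b] by simp
    show "(\<Sum>n<M. cmod (cdual_apply (\<Phi> (n + N)) y) powr p) \<le> c powr p"
      using pbound_eval_sum[OF tail y, of "{..<M}"] by simp
  qed (use c in auto)
  then have "cmod (cdual_apply y k - (\<Sum>n<N. b n * cdual_apply (\<Phi> n) y)) \<le> c"
    by (intro LIMSEQ_le_const2[OF tendsto_norm[OF lim]]) auto
  then show "cmod (cdual_apply ((\<Sum>n<N. b n *\<^sub>C \<Phi> n) - evaluation k) y) \<le> c"
    by (simp add: cdual_simps norm_minus_commute)
qed

text \<open>Every \<open>k\<close> receives the coefficients of its net point
  \<open>\<kappa> k\<close>. The remainder is \<open>k - \<kappa> k\<close>, a combination of \<Phi>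
  whose leading coefficients are small, plus the approximation error at \<open>\<kappa> k\<close>,
  one of finitely many small vectors. The sequence \<open>\<Phi>'\<close> collects the vectors
  needed for both.\<close>

lemma approximation_step:
  fixes \<Phi> :: "nat \<Rightarrow> 'f::complex_normed_vector cdual cdual"
  assumes \<Phi>: "pbound s p \<Phi> A" "pnull s p \<Phi>" "0 \<le> A" and K: "K \<subseteq> bidual_conv q \<Phi>" and \<delta>: "0 < \<delta>"
  shows "\<exists>N x \<alpha> \<Phi>'. 0 < N \<and> pbound s p x (A + \<delta>) \<and> \<alpha> ` K \<subseteq> lq_ball q \<and>
    pbound s p \<Phi>' \<delta> \<and> pnull s p \<Phi>' \<and> (\<lambda>k. k - (\<Sum>n<N. \<alpha> k n *\<^sub>C x n)) ` K \<subseteq> bidual_conv q \<Phi>'"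
proof -
  obtain b where b: "\<And>k. k \<in> K \<Longrightarrow> b k \<in> lq_ball q"
      "\<And>k y. k \<in> K \<Longrightarrow> (\<lambda>n. b k n * cdual_apply (\<Phi> n) y) sums cdual_apply y k"
    using K unfolding bidual_conv_def subset_iff mem_Collect_eq by metis
  \<comment> \<open>Half of \<delta> pays for the two parts of \<open>\<Phi>'\<close> taken from
    \<Phi>, at cost \<open>3 * e * A\<close> and \<open>12 * e\<close>. The other half pays for the
    errors at the net points.\<close>
  define e where "e = \<delta> / (2 * (3 * A + 12))"
  have pos: "0 < 3 * A + 12" using \<Phi>(3) by simp
  then have e: "0 < e" using \<delta> by (simp add: e_def)
  have "e * (3 * A + 12) = \<delta> / 2" using pos unfolding e_def by (simp only: times_divide_eq_left mult_divide_mult_cancel_right)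
  then have e_sum: "3 * e * A + 12 * e = \<delta> / 2" by (simp add: algebra_simps)
  obtain N1 where N1: "pbound s p (\<lambda>n. \<Phi> (n + N1)) e"
    using \<Phi>(2) e unfolding pnull_def by blast
  have "0 < e / (real N1 + 1)" using e by simp
  then obtain K0 \<kappa> where K0: "finite K0" "K0 \<subseteq> K" and \<kappa>: "\<And>k. k \<in> K \<Longrightarrow> \<kappa> k \<in> K0"
      "\<And>k n. k \<in> K \<Longrightarrow> n < N1 \<Longrightarrow> cmod (b k n - b (\<kappa> k) n) \<le> e / (real N1 + 1)"
    using finite_net[of K N1 b "e / (real N1 + 1)"] b(1) lq_ball_le by metis
  define m where "m = card K0"
  obtain g where g: "bij_betw g {0..<m} K0"
    using ex_bij_betw_nat_finite[OF K0(1)] by (auto simp: m_def)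
  \<comment> \<open>Chosen only now, after the size \<open>m\<close> of the net is known, so that
    all \<open>m\<close> errors together, tripled, cost at most \<open>\<delta> / 2\<close>.\<close>
  define \<eta> where "\<eta> = \<delta> / (6 * (real m + 1))"
  have \<eta>: "0 < \<eta>" "3 * (real m * \<eta>) \<le> \<delta> / 2" "\<eta> \<le> \<delta>"
    using \<delta> by (auto simp: \<eta>_def field_simps)
  obtain N2 where "pbound s p (\<lambda>n. \<Phi> (n + N2)) (\<eta> / 2)"
    using \<Phi>(2) \<eta>(1) unfolding pnull_def by (metis half_gt_zero)
  \<comment> \<open>The successor keeps the block nonempty, as required when blocks are
    joined.\<close>
  define N where "N = Suc N2"
  have N: "pbound s p (\<lambda>n. \<Phi> (n + N)) (\<eta> / 2)"
    by (rule pbound_shift_mono[OF \<open>pbound s p (\<lambda>n. \<Phi> (n + N2)) (\<eta> / 2)\<close>]) (simp add: N_def)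
  have "\<exists>x. pbound s p x (A + \<eta> / 2) \<and>
      (\<forall>k\<in>K0. norm ((\<Sum>n<N. b k n *\<^sub>C x n) - k) \<le> \<eta> / 2 + \<eta> / 2)"
    using \<eta> K0 by (intro local_reflexivity_gauge[OF \<Phi>(1,3)] bidual_tail_le[OF _ _ N] b) auto
  then obtain x where x: "pbound s p x (A + \<eta> / 2)"
      "\<And>k. k \<in> K0 \<Longrightarrow> norm ((\<Sum>n<N. b k n *\<^sub>C x n) - k) \<le> \<eta>" by auto
  define r where "r j = g j - (\<Sum>n<N. b (g j) n *\<^sub>C x n)" for j
  define R where "R n = (if n < m then 3 *\<^sub>C evaluation (r n) else 0)" for n
  \<comment> \<open>The factors give each of the three parts a third of the \<open>q\<close>-ball:
    the error has coefficient \<open>1 / 3\<close>, the \<open>N1\<close> leading differences of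
    modulus at most \<open>e / (N1 + 1)\<close> are divided by \<open>3 * e\<close>, and the
    remaining ones by 12.\<close>
  define \<Phi>' where "\<Phi>' = pcat m R (pcat N1 (\<lambda>n. complex_of_real (3 * e) *\<^sub>C \<Phi> n) (\<lambda>n. 12 *\<^sub>C \<Phi> (n + N1)))"
  have r_le: "norm (r j) \<le> \<eta>" if "j < m" for j
    unfolding r_def by (subst norm_minus_commute, rule x(2)) (use g that in \<open>auto simp: bij_betw_def\<close>)
  have "pbound s p \<Phi>' (real m * (3 * \<eta>) + (cmod (complex_of_real (3 * e)) * A + cmod 12 * e))"
    unfolding \<Phi>'_def
  proof (intro pbound_pcat pbound_scaleC pbound_block \<Phi>(1) N1)
    show "norm (R n) \<le> 3 * \<eta>" if "n < m" for n
      using that r_le[OF that] norm_evaluation_le[of "r n"] by (simp add: R_def norm_scaleC)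
  qed (use e \<eta> \<Phi>(3) in \<open>auto simp: R_def\<close>)
  then have \<Phi>'_bound: "pbound s p \<Phi>' \<delta>"
    by (rule pbound_mono) (use e \<eta> e_sum \<Phi>(3) in auto)
  have \<Phi>'_null: "pnull s p \<Phi>'"
    unfolding \<Phi>'_def by (intro pnull_pcat pnull_scaleC pnull_shift \<Phi>(2))
  have conv: "k - (\<Sum>n<N. b (\<kappa> k) n *\<^sub>C x n) \<in> bidual_conv q \<Phi>'" if k: "k \<in> K" for k
  proof -
    have \<kappa>K: "\<kappa> k \<in> K" using \<kappa>(1)[OF k] K0 by auto
    obtain j where j: "j < m" "g j = \<kappa> k"
      using \<kappa>(1)[OF k] g by (auto simp: bij_betw_def image_iff)
    define d where "d n = b k n - b (\<kappa> k) n" for n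
    define b1 b2 b3 where "b1 n = (if n = j then 1 / 3 else 0 :: complex)"
      and "b2 n = d n / complex_of_real (3 * e)" and "b3 n = d (n + N1) / 12" for n
    define B where "B = pcat m b1 (pcat N1 b2 b3)"
    have small: "t powr q \<le> t" if "0 \<le> t" "t \<le> 1" for t
      by (rule conjugate_exponents.powr_le_self[OF swap that])
    have "B \<in> lq_ball q"
      unfolding lq_ball_def mem_Collect_eq
    proof
      fix M
      have "(\<Sum>n<M. cmod (B n) powr q) = (\<Sum>n<M. pcat m (\<lambda>n. cmod (b1 n) powr q)
          (pcat N1 (\<lambda>n. cmod (b2 n) powr q) (\<lambda>n. cmod (b3 n) powr q)) n)"
        by (intro sum.cong) (auto simp: B_def pcat_def)
      also have "\<dots> \<le> 1 / 3 + (1 / 3 + 1 / 3)"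
      proof (intro sum_pcat_le)
        have "(\<Sum>n<m. cmod (b1 n) powr q) = (\<Sum>n<m. if n = j then (1 / 3) powr q else 0)"
          using q_gt_1 by (intro sum.cong) (auto simp: b1_def norm_divide)
        then show "(\<Sum>n<m. cmod (b1 n) powr q) \<le> 1 / 3"
          using j(1) small[of "1 / 3"] by simp
        have "(\<Sum>n<N1. cmod (b2 n) powr q) \<le> (\<Sum>n<N1. 1 / (3 * (real N1 + 1)))"
        proof (rule sum_mono)
          fix n assume "n \<in> {..<N1}"
          then have le: "cmod (b2 n) \<le> 1 / (3 * (real N1 + 1))"
            using \<kappa>(2)[OF k, of n] e by (simp add: b2_def d_def norm_divide norm_mult field_simps)
          then have "cmod (b2 n) \<le> 1" by (rule order_trans) (simp add: field_simps)
          then show "cmod (b2 n) powr q \<le> 1 / (3 * (real N1 + 1))"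
            using le small[of "cmod (b2 n)"] by simp
        qed
        also have "\<dots> \<le> 1 / 3" by (simp add: field_simps)
        finally show "(\<Sum>n<N1. cmod (b2 n) powr q) \<le> 1 / 3" .
        fix M
        have "cmod (b3 n) powr q \<le> (cmod (b k (n + N1)) powr q + cmod (b (\<kappa> k) (n + N1)) powr q) / 6" for n
        proof -
          \<comment> \<open>A difference is at most twice the maximum \<open>u\<close>, so dividing
            by 12 leaves \<open>u / 6\<close>. The power of \<open>u\<close> is at most the sum of
            both powers, and two unit masses over 6 give the third.\<close>
          define u where "u = max (cmod (b k (n + N1))) (cmod (b (\<kappa> k) (n + N1)))"
          have "0 \<le> u" by (simp add: u_def le_max_iff_disj)
          have "cmod (d (n + N1)) \<le> 2 * u"
            using norm_triangle_ineq4[of "b k (n + N1)" "b (\<kappa> k) (n + N1)"] by (simp add: d_def u_def)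
          then have "cmod (b3 n) powr q \<le> (u * (1 / 6)) powr q"
            using q_gt_1 by (intro powr_mono2) (auto simp: b3_def norm_divide)
          also have "\<dots> = u powr q * (1 / 6) powr q" using \<open>0 \<le> u\<close> by (simp add: powr_mult powr_divide)
          also have "\<dots> \<le> u powr q * (1 / 6)"
            using small[of "1 / 6"] by (intro mult_left_mono) auto
          also have "u powr q \<le> cmod (b k (n + N1)) powr q + cmod (b (\<kappa> k) (n + N1)) powr q"
            by (auto simp: u_def max_def)
          finally show ?thesis by simp
        qed
        then have "(\<Sum>n<M. cmod (b3 n) powr q)
            \<le> (\<Sum>n<M. (cmod (b k (n + N1)) powr q + cmod (b (\<kappa> k) (n + N1)) powr q) / 6)"
          by (intro sum_mono)
        also have "\<dots> = ((\<Sum>n\<in>(\<lambda>n. n + N1) ` {..<M}. cmod (b k n) powr q) +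
            (\<Sum>n\<in>(\<lambda>n. n + N1) ` {..<M}. cmod (b (\<kappa> k) n) powr q)) / 6"
          by (simp add: sum.reindex sum_divide_distrib[symmetric] sum.distrib)
        also have "\<dots> \<le> (1 + 1) / 6"
          by (intro divide_right_mono add_mono lq_ball_sum b k \<kappa>K) auto
        finally show "(\<Sum>n<M. cmod (b3 n) powr q) \<le> 1 / 3" by simp
      qed (auto simp: pcat_def)
      finally show "(\<Sum>n<M. cmod (B n) powr q) \<le> 1" by simp
    qed
    moreover have "(\<lambda>n. B n * cdual_apply (\<Phi>' n) y) sums cdual_apply y (k - (\<Sum>n<N. b (\<kappa> k) n *\<^sub>C x n))" for y
    proof -
      have d_sums: "(\<lambda>n. d n * cdual_apply (\<Phi> n) y) sums (cdual_apply y k - cdual_apply y (\<kappa> k))"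
        using sums_diff[OF b(2)[OF k] b(2)[OF \<kappa>K], of y y] by (simp add: d_def algebra_simps)
      have "(\<lambda>n. d (n + N1) * cdual_apply (\<Phi> (n + N1)) y) sums
          (cdual_apply y k - cdual_apply y (\<kappa> k) - (\<Sum>n<N1. d n * cdual_apply (\<Phi> n) y))"
        using d_sums by (subst sums_iff_shift) simp
      from pcat_sums[OF pcat_sums[OF this, of N1 "\<lambda>n. d n * cdual_apply (\<Phi> n) y"], of m
          "\<lambda>n. if n = j then cdual_apply y (r j) else 0"]
      have "pcat m (\<lambda>n. if n = j then cdual_apply y (r j) else 0)
          (pcat N1 (\<lambda>n. d n * cdual_apply (\<Phi> n) y) (\<lambda>n. d (n + N1) * cdual_apply (\<Phi> (n + N1)) y))
          sums (cdual_apply y (r j) + (cdual_apply y k - cdual_apply y (\<kappa> k)))"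
        using j(1) by simp
      moreover have "pcat m (\<lambda>n. if n = j then cdual_apply y (r j) else 0)
          (pcat N1 (\<lambda>n. d n * cdual_apply (\<Phi> n) y) (\<lambda>n. d (n + N1) * cdual_apply (\<Phi> (n + N1)) y)) n
          = B n * cdual_apply (\<Phi>' n) y" for n
        using e by (simp add: pcat_def B_def \<Phi>'_def R_def b1_def b2_def b3_def cdual_simps)
      ultimately have "(\<lambda>n. B n * cdual_apply (\<Phi>' n) y) sums
          (cdual_apply y (r j) + (cdual_apply y k - cdual_apply y (\<kappa> k)))"
        by (metis (no_types, lifting) ext)
      then show ?thesis by (simp add: r_def j(2) cdual_simps)
    qed
    ultimately show ?thesis unfolding bidual_conv_def by blast
  qed
  show ?thesis
  proof (intro exI conjI)
    show "0 < N" by (simp add: N_def)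
    show "pbound s p x (A + \<delta>)" by (rule pbound_mono[OF x(1)]) (use \<eta> \<Phi>(3) in auto)
    show "(\<lambda>k. b (\<kappa> k)) ` K \<subseteq> lq_ball q" using \<kappa>(1) K0(2) b(1) by blast
    show "(\<lambda>k. k - (\<Sum>n<N. (b (\<kappa> k)) n *\<^sub>C x n)) ` K \<subseteq> bidual_conv q \<Phi>'" using conv by blast
  qed fact+
qed

end

section \<open>Joining the blocks\<close>

context
  fixes N :: "nat \<Rightarrow> nat"
  assumes N_pos: "\<And>j. 0 < N j"
begin

definition offset :: "nat \<Rightarrow> nat"
  where "offset j = (\<Sum>i<j. N i)"

text \<open>The least index exists because nonempty blocks make \<open>offset\<close>
  unbounded.\<close>

definition block_of :: "nat \<Rightarrow> nat"
  where "block_of n = (LEAST j. n < offset (Suc j))"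

definition join_blocks :: "(nat \<Rightarrow> nat \<Rightarrow> 'a) \<Rightarrow> nat \<Rightarrow> 'a"
  where "join_blocks X n = X (block_of n) (n - offset (block_of n))"

lemma offset_Suc: "offset (Suc j) = offset j + N j"
  by (simp add: offset_def)

lemma strict_mono_offset: "strict_mono offset"
  using N_pos by (intro strict_monoI_Suc) (simp add: offset_Suc)

lemma join_blocks_eq:
  assumes "i < N j"
  shows "join_blocks X (offset j + i) = X j i"
proof -
  have "block_of (offset j + i) = j"
    unfolding block_of_def
  proof (rule Least_equality)
    fix l assume "offset j + i < offset (Suc l)"
    then have "offset j < offset (Suc l)" by simp
    then show "j \<le> l" using strict_mono_less[OF strict_mono_offset] by auto
  qed (use assms in \<open>simp add: offset_Suc\<close>)
  then show ?thesis by (simp add: join_blocks_def)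
qed

lemma sum_offset:
  fixes h :: "nat \<Rightarrow> 'a::comm_monoid_add"
  assumes "J \<le> L"
  shows "(\<Sum>n\<in>{offset J..<offset L}. h n) = (\<Sum>j\<in>{J..<L}. \<Sum>i<N j. h (offset j + i))"
  using assms
proof (induction L rule: dec_induct)
  case (step L)
  have "offset J \<le> offset L" using step.hyps strict_mono_less_eq[OF strict_mono_offset] by simp
  then have "(\<Sum>n\<in>{offset J..<offset (Suc L)}. h n) =
      (\<Sum>n\<in>{offset J..<offset L}. h n) + (\<Sum>n\<in>{offset L..<offset L + N L}. h n)"
    by (simp add: offset_Suc sum.atLeastLessThan_concat)
  also have "(\<Sum>n\<in>{offset L..<offset L + N L}. h n) = (\<Sum>i<N L. h (offset L + i))"
    using sum.shift_bounds_nat_ivl[of h 0 "offset L" "N L"] by (simp add: add.commute lessThan_atLeast0)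
  finally show ?case using step by simp
qed simp

end

section \<open>Passage from the bidual to the space\<close>

context conjugate_exponents
begin

lemma lq_ball_iff: "b \<in> lq_ball q \<longleftrightarrow> b \<in> lp (conj_index p) \<and> lp_norm (conj_index p) b \<le> 1"
  using conjugate_exponents.lp_iff[OF swap, of 1 b] by (auto simp: lq_ball_def q_eq)

lemma block_norm_le:
  fixes x :: "nat \<Rightarrow> 'a::complex_normed_vector"
  assumes "pbound s p x c" "0 \<le> c" "(\<Sum>n\<in>I. cmod (b n) powr q) \<le> 1" "finite I"
  shows "norm (\<Sum>n\<in>I. b n *\<^sub>C x n) \<le> c"
proof (rule norm_le_dual)
  fix \<phi> :: "'a cdual" assume "\<phi> \<in> cball 0 1"
  then show "cmod (cdual_apply \<phi> (\<Sum>n\<in>I. b n *\<^sub>C x n)) \<le> c"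
    using assms by (simp add: cdual_simps Holder_norm_sum pbound_dual_sum)
qed

text \<open>Cauchy's criterion: by Hoelder, a block of the series is no larger in norm than the weak
  bound on the tail of \<open>x\<close>.\<close>

lemma summable_lq_combination:
  fixes x :: "nat \<Rightarrow> 'a::cbanach"
  assumes x: "pnull s p x" and b: "b \<in> lq_ball q"
  shows "summable (\<lambda>n. b n *\<^sub>C x n)"
  unfolding summable_Cauchy
proof (intro allI impI)
  fix e :: real assume "0 < e"
  then obtain m where m: "pbound s p (\<lambda>n. x (n + m)) (e / 2)"
    using x unfolding pnull_def by (metis half_gt_zero)
  have "norm (\<Sum>n\<in>{M..<L}. b n *\<^sub>C x n) < e" if "m \<le> M" for M L
  proof (cases "M \<le> L")
    case True
    have "(\<Sum>n\<in>{M..<L}. b n *\<^sub>C x n) = (\<Sum>n\<in>{M - m..<L - m}. b (n + m) *\<^sub>C x (n + m))"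
      using sum.shift_bounds_nat_ivl[of "\<lambda>n. b n *\<^sub>C x n" "M - m" m "L - m"] True that by simp
    also have "norm \<dots> \<le> e / 2"
    proof (rule block_norm_le[OF m])
      have "(\<Sum>n\<in>{M - m..<L - m}. cmod (b (n + m)) powr q) = (\<Sum>n\<in>{M..<L}. cmod (b n) powr q)"
        using sum.shift_bounds_nat_ivl[of "\<lambda>n. cmod (b n) powr q" "M - m" m "L - m"] True that by simp
      then show "(\<Sum>n\<in>{M - m..<L - m}. cmod (b (n + m)) powr q) \<le> 1"
        using lq_ball_sum[OF b] by simp
    qed (use \<open>0 < e\<close> in auto)
    finally show ?thesis using \<open>0 < e\<close> by simp
  qed (use \<open>0 < e\<close> in simp)
  then show "\<exists>N. \<forall>m\<ge>N. \<forall>n. norm (\<Sum>n\<in>{m..<n}. b n *\<^sub>C x n) < e" by blast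
qed

theorem p_conv_of_bidual_conv:
  fixes \<Phi> :: "nat \<Rightarrow> 'f::cbanach cdual cdual"
  assumes \<Phi>: "pbound s p \<Phi> A" "pnull s p \<Phi>" "0 \<le> A" and K: "K \<subseteq> bidual_conv q \<Phi>" and \<epsilon>: "0 < \<epsilon>"
  shows "\<exists>z. pbound s p z (A + \<epsilon>) \<and> pnull s p z \<and> K \<subseteq> p_conv p z"
proof -
  \<comment> \<open>\<theta> enters twice, as the bound on the next bidual sequence (through
    \<open>a\<close>) and as the loss in moving a block into the space. Its sum is
    \<open>\<epsilon> / 2\<close>, so all blocks together cost
    \<open>A + \<epsilon>\<close>.\<close>
  define \<theta> where "\<theta> j = \<epsilon> / 4 * (1 / 2) ^ j" for j :: nat
  have \<theta>: "0 < \<theta> j" for j using \<epsilon> by (simp add: \<theta>_def)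
  define a where "a j = (case j of 0 \<Rightarrow> A | Suc i \<Rightarrow> \<theta> i)" for j
  have a: "0 \<le> a j" for j using \<Phi>(3) \<theta> by (auto simp: a_def less_imp_le split: nat.split)
  define approx where "approx j T T' N x \<alpha> \<longleftrightarrow> 0 < N \<and> pbound s p x (a j + \<theta> j) \<and> \<alpha> ` T \<subseteq> lq_ball q \<and>
      T' = (\<lambda>k. k - (\<Sum>n<N. \<alpha> k n *\<^sub>C x n)) ` T" for j N x \<alpha> and T T' :: "'f set"
  define step where "step j T T' \<longleftrightarrow> (\<exists>N x \<alpha>. approx j T T' N x \<alpha>)" for j T T'
  \<comment> \<open>Dependent choice on pairs of a set of remainders and a bidual sequence
    representing it. Blocks and coefficients are hidden in \<open>step\<close> and extracted
    afterwards.\<close>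
  have "\<exists>st. \<forall>j. (pbound s p (snd (st j)) (a j) \<and> pnull s p (snd (st j)) \<and> fst (st j) \<subseteq> bidual_conv q (snd (st j)) \<and>
      (j = 0 \<longrightarrow> fst (st j) = K)) \<and> step j (fst (st j)) (fst (st (Suc j)))"
  proof (rule dependent_nat_choice)
    show "\<exists>st. pbound s p (snd st) (a 0) \<and> pnull s p (snd st) \<and> fst st \<subseteq> bidual_conv q (snd st) \<and>
        ((0::nat) = 0 \<longrightarrow> fst st = K)"
      using \<Phi> K by (intro exI[of _ "(K, \<Phi>)"]) (simp add: a_def)
    fix st :: "'f set \<times> (nat \<Rightarrow> 'f cdual cdual)" and j
    assume "pbound s p (snd st) (a j) \<and> pnull s p (snd st) \<and> fst st \<subseteq> bidual_conv q (snd st) \<and>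
        (j = 0 \<longrightarrow> fst st = K)"
    then have "\<exists>N x \<alpha> \<Phi>'. 0 < N \<and> pbound s p x (a j + \<theta> j) \<and>
        \<alpha> ` fst st \<subseteq> lq_ball q \<and> pbound s p \<Phi>' (\<theta> j) \<and> pnull s p \<Phi>' \<and>
        (\<lambda>k. k - (\<Sum>n<N. \<alpha> k n *\<^sub>C x n)) ` fst st \<subseteq> bidual_conv q \<Phi>'"
      by (intro approximation_step[where \<Phi>="snd st"]) (simp_all add: a \<theta>)
    then obtain N x \<alpha> \<Phi>' where *: "0 < N \<and> pbound s p x (a j + \<theta> j) \<and>
        \<alpha> ` fst st \<subseteq> lq_ball q \<and> pbound s p \<Phi>' (\<theta> j) \<and> pnull s p \<Phi>' \<and>
        (\<lambda>k. k - (\<Sum>n<N. \<alpha> k n *\<^sub>C x n)) ` fst st \<subseteq> bidual_conv q \<Phi>'"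
      by (elim exE)
    define st' where "st' = ((\<lambda>k. k - (\<Sum>n<N. \<alpha> k n *\<^sub>C x n)) ` fst st, \<Phi>')"
    have "approx j (fst st) (fst st') N x \<alpha>" using * by (simp add: approx_def st'_def)
    then have "step j (fst st) (fst st')" unfolding step_def by blast
    then show "\<exists>st'. (pbound s p (snd st') (a (Suc j)) \<and> pnull s p (snd st') \<and> fst st' \<subseteq> bidual_conv q (snd st') \<and>
        (Suc j = 0 \<longrightarrow> fst st' = K)) \<and> step j (fst st) (fst st')"
      using * by (intro exI[of _ st']) (simp add: a_def st'_def)
  qed
  then obtain st where st: "\<And>j. pbound s p (snd (st j)) (a j)"
      "\<And>j. fst (st j) \<subseteq> bidual_conv q (snd (st j))" "fst (st 0) = K"
      "\<And>j. step j (fst (st j)) (fst (st (Suc j)))" by blast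
  define T where "T j = fst (st j)" for j
  obtain N x \<alpha> where "\<And>j. approx j (T j) (T (Suc j)) (N j) (x j) (\<alpha> j)"
    using st(4) unfolding step_def T_def by metis
  then have N: "\<And>j. 0 < N j" and x: "\<And>j. pbound s p (x j) (a j + \<theta> j)"
      and \<alpha>: "\<And>j. \<alpha> j ` T j \<subseteq> lq_ball q"
      and T: "\<And>j. T (Suc j) = (\<lambda>k. k - (\<Sum>n<N j. \<alpha> j k n *\<^sub>C x j n)) ` T j"
    by (simp_all only: approx_def)
  \<comment> \<open>\<open>R k j\<close> is what is left of \<open>k\<close> after the first
    \<open>j\<close> blocks.\<close>
  define R where "R k = rec_nat k (\<lambda>j r. r - (\<Sum>n<N j. \<alpha> j r n *\<^sub>C x j n))" for k
  have R_Suc: "R k (Suc j) = R k j - (\<Sum>n<N j. \<alpha> j (R k j) n *\<^sub>C x j n)" for k j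
    by (simp add: R_def)
  have RT: "R k j \<in> T j" if "k \<in> K" for k j
  proof (induction j)
    case 0
    show ?case using that st(3) by (simp add: R_def T_def)
  next
    case (Suc j)
    then show ?case unfolding R_Suc T by blast
  qed
  have a_null: "a \<longlonglongrightarrow> 0"
  proof -
    have "\<theta> \<longlonglongrightarrow> \<epsilon> / 4 * 0"
      unfolding \<theta>_def by (intro tendsto_mult tendsto_const LIMSEQ_power_zero) simp
    then have "(\<lambda>j. a (Suc j)) \<longlonglongrightarrow> 0" by (simp add: a_def)
    then show ?thesis by (simp only: filterlim_sequentially_Suc)
  qed
  have R_le: "norm (R k j) \<le> a j" if k: "k \<in> K" for k j
  proof -
    have "R k j \<in> bidual_conv q (snd (st j))" using RT[OF k, of j] st(2)[of j] by (auto simp: T_def)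
    then obtain b where "b \<in> lq_ball q"
        "\<And>y. (\<lambda>n. b n * cdual_apply (snd (st j) n) y) sums cdual_apply y (R k j)"
      unfolding bidual_conv_def by blast
    \<comment> \<open>The case \<open>N = 0\<close> of \<open>bidual_tail_le\<close>: the remainder
      is no larger than the bound on the sequence representing it.\<close>
    then have ev: "norm (evaluation (R k j)) \<le> a j"
      using bidual_tail_le[of b "snd (st j)" "R k j" s 0 "a j"] st(1)[of j] a[of j] by simp
    show ?thesis
    proof (rule norm_le_dual)
      fix \<phi> :: "'f cdual" assume "\<phi> \<in> cball 0 1"
      then show "cmod (cdual_apply \<phi> (R k j)) \<le> a j"
        using cdual_le[of "evaluation (R k j)" \<phi>] mult_mono[OF ev, of "norm \<phi>" 1] a[of j] by simp
    qed
  qed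
  define \<nu> where "\<nu> j = a j + \<theta> j" for j
  define S where "S = A + \<epsilon>"
  have S: "0 < S" using \<Phi>(3) \<epsilon> by (simp add: S_def)
  have \<nu>: "0 < \<nu> j" for j using a[of j] \<theta>[of j] by (simp add: \<nu>_def)
  have \<nu>_sums: "\<nu> sums S"
  proof -
    have "(\<lambda>j. (1 / 2) ^ j :: real) sums 2" using geometric_sums[of "1 / 2 :: real"] by simp
    then have \<theta>_sums: "\<theta> sums (\<epsilon> / 2)"
      using sums_mult[of "\<lambda>j. (1 / 2) ^ j" 2 "\<epsilon> / 4"] by (simp add: \<theta>_def[abs_def])
    then have "(\<lambda>j. a (Suc j)) sums (\<epsilon> / 2)" by (simp add: a_def)
    then have "a sums (\<epsilon> / 2 + A)" by (subst (asm) sums_Suc_iff) (simp add: a_def)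
    from sums_add[OF this \<theta>_sums] show ?thesis by (simp add: \<nu>_def[abs_def] S_def add.commute)
  qed
  have \<nu>_part: "(\<Sum>j<J. \<nu> j) \<le> S" for J
    using sum_le_suminf[OF sums_summable[OF \<nu>_sums], of "{..<J}"] \<nu> sums_unique[OF \<nu>_sums]
    by (auto simp: less_imp_le)
  \<comment> \<open>Block \<open>j\<close> gets the share \<open>\<nu> j / S\<close> of the
    \<open>q\<close>-ball: its coefficients are multiplied by \<open>c j\<close> and its vectors
    divided by it. The \<open>p\<close>-th powers of the vectors then cost
    \<open>S powr (p - 1) * \<nu> j\<close>, which sums to \<open>S powr p\<close>.\<close>
  define c where "c j = (\<nu> j / S) powr (1 / q)" for j
  have c: "0 < c j" for j using \<nu>[of j] S by (simp add: c_def)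
  have cq: "c j powr q = \<nu> j / S" for j
    using \<nu>[of j] S q_gt_1 by (simp add: c_def powr_powr)
  have c\<nu>: "(\<nu> j / c j) powr p = S powr (p - 1) * \<nu> j" for j
  proof -
    have pq: "1 / q * p = p - 1" using conj p_gt_1 q_gt_1 by (simp add: field_simps)
    have "c j powr p = (\<nu> j / S) powr (p - 1)"
      unfolding c_def by (simp only: powr_powr pq)
    then have "(\<nu> j / c j) powr p = \<nu> j powr p / (\<nu> j / S) powr (p - 1)"
      by (simp only: powr_divide)
    also have "\<dots> = S powr (p - 1) * (\<nu> j powr p / \<nu> j powr (p - 1))"
      using \<nu>[of j] S by (simp add: powr_divide)
    also have "\<nu> j powr p / \<nu> j powr (p - 1) = \<nu> j"
      using \<nu>[of j] by (simp flip: powr_diff)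
    finally show ?thesis .
  qed
  define o' where "o' = offset N"
  have o_mono: "strict_mono o'" unfolding o'_def by (rule strict_mono_offset[of N, OF N])
  have o0: "o' 0 = 0" by (simp add: o'_def offset_def[of N, OF N])
  define z where "z = join_blocks N (\<lambda>j i. complex_of_real (1 / c j) *\<^sub>C x j i)"
  have z_eq: "z (o' j + i) = complex_of_real (1 / c j) *\<^sub>C x j i" if "i < N j" for i j
    unfolding z_def o'_def by (simp add: join_blocks_eq[of N, OF N that])
  have z_sum: "(\<Sum>n\<in>{o' J..<o' L}. \<tau> (z n) powr p) \<le> S powr (p - 1) * (\<Sum>j\<in>{J..<L}. \<nu> j)"
    if \<tau>: "\<tau> \<in> gauges s" and "J \<le> L" for \<tau> J L
  proof -
    have "(\<Sum>n\<in>{o' J..<o' L}. \<tau> (z n) powr p) = (\<Sum>j\<in>{J..<L}. \<Sum>i<N j. \<tau> (z (o' j + i)) powr p)"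
      unfolding o'_def by (rule sum_offset[of N, OF N that(2)])
    also have "\<dots> \<le> (\<Sum>j\<in>{J..<L}. (\<nu> j / c j) powr p)"
    proof (rule sum_mono)
      fix j
      have "pbound s p (\<lambda>i. complex_of_real (1 / c j) *\<^sub>C x j i) (cmod (complex_of_real (1 / c j)) * \<nu> j)"
        unfolding \<nu>_def using x[of j] a[of j] \<theta>[of j] by (intro pbound_scaleC) auto
      from pbound_sum[OF this \<tau>, of "{..<N j}"]
      show "(\<Sum>i<N j. \<tau> (z (o' j + i)) powr p) \<le> (\<nu> j / c j) powr p"
        using c[of j] by (simp add: z_eq norm_divide)
    qed
    finally show ?thesis by (simp add: c\<nu> sum_distrib_left)
  qed
  have z_bound: "pbound s p z S"
    unfolding pbound_def
  proof (intro ballI allI)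
    fix \<tau> :: "'f \<Rightarrow> real" and M assume \<tau>: "\<tau> \<in> gauges s"
    have "(\<Sum>n<M. \<tau> (z n) powr p) \<le> (\<Sum>n\<in>{o' 0..<o' M}. \<tau> (z n) powr p)"
      using strict_mono_imp_increasing[OF o_mono, of M] by (intro sum_mono2) (auto simp: o0)
    also have "\<dots> \<le> S powr (p - 1) * (\<Sum>j<M. \<nu> j)"
      using z_sum[OF \<tau>, of 0 M] by (simp add: lessThan_atLeast0)
    also have "\<dots> \<le> S powr (p - 1) * S" by (intro mult_left_mono \<nu>_part) simp
    also have "\<dots> = S powr p" using S powr_mult_base[of S "p - 1"] by (simp add: mult.commute)
    finally show "(\<Sum>n<M. \<tau> (z n) powr p) \<le> S powr p" .
  qed
  have z_null: "pnull s p z"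
    unfolding pnull_def
  proof (intro allI impI)
    fix e :: real assume e: "0 < e"
    \<comment> \<open>The tail starting with block \<open>J\<close> costs
      \<open>S powr (p - 1)\<close> times the remainder of the convergent series of \<nu>.\<close>
    have "(\<lambda>J. S powr (p - 1) * (S - (\<Sum>j<J. \<nu> j))) \<longlonglongrightarrow> S powr (p - 1) * (S - S)"
      using \<nu>_sums unfolding sums_def by (intro tendsto_intros)
    then have "\<forall>\<^sub>F J in sequentially. S powr (p - 1) * (S - (\<Sum>j<J. \<nu> j)) < e powr p"
      by (rule order_tendstoD) (use e in simp)
    then obtain J where J: "S powr (p - 1) * (S - (\<Sum>j<J. \<nu> j)) < e powr p"
      by (auto simp: eventually_sequentially)
    have "pbound s p (\<lambda>n. z (n + o' J)) e"
      unfolding pbound_def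
    proof (intro ballI allI)
      fix \<tau> :: "'f \<Rightarrow> real" and M assume \<tau>: "\<tau> \<in> gauges s"
      have "(\<Sum>n<M. \<tau> (z (n + o' J)) powr p) = (\<Sum>n\<in>{o' J..<M + o' J}. \<tau> (z n) powr p)"
        using sum.shift_bounds_nat_ivl[of "\<lambda>n. \<tau> (z n) powr p" 0 "o' J" M] by (simp add: lessThan_atLeast0)
      also have "\<dots> \<le> (\<Sum>n\<in>{o' J..<o' (J + M)}. \<tau> (z n) powr p)"
      proof (rule sum_mono2)
        have "M + o' J \<le> o' (J + M)"
        proof (induction M)
          case (Suc M)
          then show ?case using strict_monoD[OF o_mono, of "J + M" "J + Suc M"] by simp
        qed simp
        then show "{o' J..<M + o' J} \<subseteq> {o' J..<o' (J + M)}" by auto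
      qed auto
      also have "\<dots> \<le> S powr (p - 1) * (\<Sum>j\<in>{J..<J + M}. \<nu> j)" by (rule z_sum[OF \<tau>]) simp
      also have "(\<Sum>j\<in>{J..<J + M}. \<nu> j) = (\<Sum>j<J + M. \<nu> j) - (\<Sum>j<J. \<nu> j)"
        using sum.atLeastLessThan_concat[of 0 J "J + M" \<nu>] by (simp add: lessThan_atLeast0)
      also have "S powr (p - 1) * ((\<Sum>j<J + M. \<nu> j) - (\<Sum>j<J. \<nu> j)) \<le> S powr (p - 1) * (S - (\<Sum>j<J. \<nu> j))"
        using \<nu>_part[of "J + M"] by (intro mult_left_mono) auto
      finally show "(\<Sum>n<M. \<tau> (z (n + o' J)) powr p) \<le> e powr p" using J by simp
    qed
    then show "\<exists>m. pbound s p (\<lambda>n. z (n + m)) e" by blast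
  qed
  have "k \<in> p_conv p z" if k: "k \<in> K" for k
  proof -
    define b where "b = join_blocks N (\<lambda>j i. complex_of_real (c j) * \<alpha> j (R k j) i)"
    have b_eq: "b (o' j + i) = complex_of_real (c j) * \<alpha> j (R k j) i" if "i < N j" for i j
      unfolding b_def o'_def by (simp add: join_blocks_eq[of N, OF N that])
    have b: "b \<in> lq_ball q"
      unfolding lq_ball_def mem_Collect_eq
    proof
      fix M
      have "(\<Sum>n<M. cmod (b n) powr q) \<le> (\<Sum>n\<in>{o' 0..<o' M}. cmod (b n) powr q)"
        using strict_mono_imp_increasing[OF o_mono, of M] by (intro sum_mono2) (auto simp: o0)
      also have "\<dots> = (\<Sum>j\<in>{0..<M}. \<Sum>i<N j. cmod (b (o' j + i)) powr q)"
        unfolding o'_def by (rule sum_offset[of N, OF N]) simp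
      also have "\<dots> \<le> (\<Sum>j\<in>{0..<M}. \<nu> j / S)"
      proof (rule sum_mono)
        fix j
        have "\<alpha> j (R k j) \<in> lq_ball q" using \<alpha>[of j] RT[OF k, of j] by blast
        then have "c j powr q * (\<Sum>i<N j. cmod (\<alpha> j (R k j) i) powr q) \<le> c j powr q * 1"
          by (intro mult_left_mono lq_ball_sum) auto
        then show "(\<Sum>i<N j. cmod (b (o' j + i)) powr q) \<le> \<nu> j / S"
          using c[of j] by (simp add: b_eq norm_mult powr_mult sum_distrib_left cq)
      qed
      also have "\<dots> = (\<Sum>j<M. \<nu> j) / S" by (simp add: sum_divide_distrib lessThan_atLeast0)
      also have "\<dots> \<le> 1" using \<nu>_part[of M] S by simp
      finally show "(\<Sum>n<M. cmod (b n) powr q) \<le> 1" .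
    qed
    have partial: "(\<Sum>n<o' J. b n *\<^sub>C z n) = k - R k J" for J
    proof -
      have "(\<Sum>n<o' J. b n *\<^sub>C z n) = (\<Sum>j\<in>{0..<J}. \<Sum>i<N j. b (o' j + i) *\<^sub>C z (o' j + i))"
        using sum_offset[of N, OF N, of 0 J "\<lambda>n. b n *\<^sub>C z n"] o0 by (simp add: o'_def lessThan_atLeast0)
      also have "\<dots> = (\<Sum>j\<in>{0..<J}. R k j - R k (Suc j))"
      proof (rule sum.cong[OF refl])
        fix j
        have "complex_of_real (c j) * w * complex_of_real (1 / c j) = w" for w
          using c[of j] by (simp add: mult.commute)
        then have "(\<Sum>i<N j. b (o' j + i) *\<^sub>C z (o' j + i)) = (\<Sum>i<N j. \<alpha> j (R k j) i *\<^sub>C x j i)"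
          by (intro sum.cong) (auto simp only: b_eq z_eq scaleC_scaleC lessThan_iff)
        then show "(\<Sum>i<N j. b (o' j + i) *\<^sub>C z (o' j + i)) = R k j - R k (Suc j)"
          by (simp add: R_Suc)
      qed
      also have "\<dots> = k - R k J" by (induction J) (simp_all add: R_def)
      finally show ?thesis .
    qed
    have "R k \<longlonglongrightarrow> 0"
      by (rule Lim_null_comparison[OF _ a_null]) (simp add: R_le[OF k])
    then have "(\<lambda>J. k - R k J) \<longlonglongrightarrow> k - 0" by (intro tendsto_intros)
    then have lim: "(\<lambda>J. \<Sum>n<o' J. b n *\<^sub>C z n) \<longlonglongrightarrow> k" by (simp add: partial)
    \<comment> \<open>The remainders control only partial sums at block ends; summability of the
      whole series identifies its sum with their limit \<open>k\<close>.\<close>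
    have "(\<lambda>n. b n *\<^sub>C z n) sums (\<Sum>n. b n *\<^sub>C z n)"
      by (rule summable_sums[OF summable_lq_combination[OF z_null b]])
    moreover from this have "(\<lambda>J. \<Sum>n<o' J. b n *\<^sub>C z n) \<longlonglongrightarrow> (\<Sum>n. b n *\<^sub>C z n)"
      unfolding sums_def using LIMSEQ_subseq_LIMSEQ[OF _ o_mono] by (fastforce simp: o_def)
    ultimately have "(\<lambda>n. b n *\<^sub>C z n) sums k" using LIMSEQ_unique[OF lim] by simp
    then show ?thesis using b unfolding p_conv_def lq_ball_iff by blast
  qed
  then show ?thesis using z_bound z_null by (intro exI[of _ z]) (auto simp: S_def)
qed

end

section \<open>Compactness of the map and quasi nuclearity of the transpose\<close>

definition seqs :: "bool \<Rightarrow> real \<Rightarrow> (nat \<Rightarrow> 'a::complex_normed_vector) set"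
  where "seqs s p = (if s then lp p else lpu p)"

definition seq_norm :: "bool \<Rightarrow> real \<Rightarrow> (nat \<Rightarrow> 'a::complex_normed_vector) \<Rightarrow> real"
  where "seq_norm s p = (if s then lp_norm p else lpw_norm p)"

lemma bounded_linear_cdual: "bounded_linear (cdual_apply \<phi>)"
  by transfer (rule blinfun.bounded_linear_right)

text \<open>In the strong case \<open>evaluation\<close> is a contraction; in the weak case a
  functional in the ball of the third dual, composed with \<open>evaluation\<close>, lies in the
  dual ball.\<close>

lemma gauge_evaluation:
  fixes \<tau> :: "'a::complex_normed_vector cdual cdual \<Rightarrow> real"
  assumes "\<tau> \<in> gauges s"
  shows "\<exists>\<tau>'\<in>gauges s. \<forall>x. \<tau> (evaluation x) \<le> \<tau>' (x :: 'a)"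
proof (cases s)
  case True
  then show ?thesis using assms by (simp add: gauges_def norm_evaluation_le)
next
  case False
  then obtain \<psi> where \<psi>: "\<psi> \<in> cball 0 1" "\<tau> = (\<lambda>\<Phi>. cmod (cdual_apply \<psi> \<Phi>))"
    using assms by (auto simp: gauges_def)
  have le: "cmod (cdual_apply \<psi> (evaluation x)) \<le> 1 * norm x" for x :: 'a
    using cdual_ball_le[OF \<psi>(1), of "evaluation x"] norm_evaluation_le[of x] by simp
  obtain \<phi> where \<phi>: "cdual_apply \<phi> = (\<lambda>x :: 'a. cdual_apply \<psi> (evaluation x))"
  proof (rule cdual_exists[OF _ le])
    have "evaluation (x + y) = evaluation x + evaluation y" "evaluation (a *\<^sub>C x) = a *\<^sub>C evaluation x"
      for x y :: 'a and a
      by (auto intro!: cdual_eqI simp: cdual_simps)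
    then show "clinear (\<lambda>x :: 'a. cdual_apply \<psi> (evaluation x))"
      by (simp add: clinear_iff cdual_simps scaleC_complex_def)
  qed
  have "norm \<phi> \<le> 1" using le by (intro cdual_norm_le) (auto simp: \<phi>)
  then have "(\<lambda>x. cmod (cdual_apply \<phi> x)) \<in> gauges s"
    using False by (simp add: gauges_def image_iff) (metis mem_cball_0)
  then show ?thesis by (rule rev_bexI) (simp add: \<psi>(2) \<phi>)
qed

section \<open>Gauges compared with the sequence spaces, and domination of functionals\<close>

context conjugate_exponents
begin

lemma pbound_strong_iff: "0 \<le> c \<Longrightarrow> pbound True p x c \<longleftrightarrow> x \<in> lp p \<and> lp_norm p x \<le> c"
  by (simp add: lp_iff pbound_def gauges_def)

lemma pnull_strong:
  fixes x :: "nat \<Rightarrow> 'a::complex_normed_vector"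
  assumes "x \<in> lp p"
  shows "pnull True p x"
  unfolding pnull_def
proof (intro allI impI)
  fix e :: real assume e: "0 < e"
  have s: "summable (\<lambda>n. norm (x n) powr p)" using assms by (simp add: lp_def)
  have "\<forall>\<^sub>F m in sequentially. (\<Sum>n. norm (x (n + m)) powr p) < e powr p"
    using suminf_exist_split2[OF s] by (rule order_tendstoD) (use e in simp)
  then obtain m where m: "(\<Sum>n. norm (x (n + m)) powr p) < e powr p"
    by (auto simp: eventually_sequentially)
  have s': "summable (\<lambda>n. norm (x (n + m)) powr p)"
    using summable_ignore_initial_segment[OF s, of m] .
  have "pbound True p (\<lambda>n. x (n + m)) e"
    unfolding pbound_def gauges_def
  proof (intro ballI allI)
    fix \<tau> :: "'a \<Rightarrow> real" and N assume "\<tau> \<in> (if True then {norm} else (\<lambda>\<phi> x. cmod (cdual_apply \<phi> x)) ` cball 0 1)"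
    then show "(\<Sum>n<N. \<tau> (x (n + m)) powr p) \<le> e powr p"
      using sum_le_suminf[OF s', of "{..<N}"] m by simp
  qed
  then show "\<exists>m. pbound True p (\<lambda>n. x (n + m)) e" by blast
qed

lemma pbound_weak_iff:
  fixes x :: "nat \<Rightarrow> 'a::complex_normed_vector"
  assumes c: "0 \<le> c"
  shows "pbound False p x c \<longleftrightarrow> x \<in> lpw p \<and> lpw_norm p x \<le> c"
proof
  assume "pbound False p x c"
  then have *: "(\<lambda>n. cdual_apply \<phi> (x n)) \<in> lp p \<and> lp_norm p (\<lambda>n. cdual_apply \<phi> (x n)) \<le> c"
    if "\<phi> \<in> cball 0 1" for \<phi>
    using that lp_iff[OF c, of "\<lambda>n. cdual_apply \<phi> (x n)"] by (auto simp: pbound_def gauges_def)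
  then have "x \<in> lpw p" unfolding lpw_def by (auto intro!: bdd_aboveI2[of _ _ c])
  moreover have "lpw_norm p x \<le> c"
    unfolding lpw_norm_def using * by (intro cSUP_least) auto
  ultimately show "x \<in> lpw p \<and> lpw_norm p x \<le> c" ..
next
  assume x: "x \<in> lpw p \<and> lpw_norm p x \<le> c"
  have "(\<Sum>n<N. cmod (cdual_apply \<phi> (x n)) powr p) \<le> c powr p" if \<phi>: "\<phi> \<in> cball 0 1" for \<phi> N
  proof -
    have "lp_norm p (\<lambda>n. cdual_apply \<phi> (x n)) \<le> lpw_norm p x"
      unfolding lpw_norm_def using x \<phi> by (intro cSUP_upper) (auto simp: lpw_def)
    then show ?thesis
      using x \<phi> lp_iff[OF c, of "\<lambda>n. cdual_apply \<phi> (x n)"] by (auto simp: lpw_def)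
  qed
  then show "pbound False p x c" by (auto simp: pbound_def gauges_def)
qed

lemma lpw_norm_nonneg:
  assumes "x \<in> lpw p"
  shows "0 \<le> lpw_norm p x"
proof -
  have "lp_norm p (\<lambda>n. cdual_apply 0 (x n)) \<le> lpw_norm p x"
    unfolding lpw_norm_def using assms by (intro cSUP_upper) (auto simp: lpw_def)
  then show ?thesis using lp_norm_nonneg order_trans by blast
qed

lemma lpu_iff: "x \<in> lpu p \<longleftrightarrow> x \<in> lpw p \<and> pnull False p x"
proof -
  have "(\<lambda>m. lpw_norm p (\<lambda>n. x (n + m))) \<longlonglongrightarrow> 0 \<longleftrightarrow> pnull False p x" if x: "x \<in> lpw p"
  proof -
    have xb: "pbound False p (\<lambda>n. x (n + 0)) (lpw_norm p x)"
      using x pbound_weak_iff[OF lpw_norm_nonneg[OF x], of x] by simp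
    have shift: "(\<lambda>n. x (n + m)) \<in> lpw p" for m
      using pbound_shift_mono[OF xb, of m] pbound_weak_iff[OF lpw_norm_nonneg[OF x]] by blast
    have "(\<lambda>m. lpw_norm p (\<lambda>n. x (n + m))) \<longlonglongrightarrow> 0" if null: "pnull False p x"
    proof (rule LIMSEQ_I)
      fix e :: real assume "0 < e"
      then obtain m where m: "pbound False p (\<lambda>n. x (n + m)) (e / 2)"
        using null unfolding pnull_def by (metis half_gt_zero)
      have "norm (lpw_norm p (\<lambda>n. x (n + M)) - 0) < e" if "m \<le> M" for M
        using pbound_shift_mono[OF m that] pbound_weak_iff[of "e / 2" "\<lambda>n. x (n + M)"] \<open>0 < e\<close>
          lpw_norm_nonneg[OF shift, of M] by auto
      then show "\<exists>m. \<forall>M\<ge>m. norm (lpw_norm p (\<lambda>n. x (n + M)) - 0) < e" by blast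
    qed
    moreover have "pnull False p x" if lim: "(\<lambda>m. lpw_norm p (\<lambda>n. x (n + m))) \<longlonglongrightarrow> 0"
      unfolding pnull_def
    proof (intro allI impI)
      fix e :: real assume e: "0 < e"
      have "\<forall>\<^sub>F m in sequentially. lpw_norm p (\<lambda>n. x (n + m)) < e"
        using lim e by (rule order_tendstoD)
      then obtain m where "lpw_norm p (\<lambda>n. x (n + m)) < e"
        by (auto simp: eventually_sequentially)
      then have "pbound False p (\<lambda>n. x (n + m)) e"
        using e shift[of m] by (simp add: pbound_weak_iff)
      then show "\<exists>m. pbound False p (\<lambda>n. x (n + m)) e" by blast
    qed
    ultimately show ?thesis by blast
  qed
  then show ?thesis by (auto simp: lpu_def)
qed

lemma seqs_intro: "pbound s p x c \<Longrightarrow> pnull s p x \<Longrightarrow> 0 \<le> c \<Longrightarrow> x \<in> seqs s p \<and> seq_norm s p x \<le> c"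
  by (cases s) (simp_all add: seqs_def seq_norm_def pbound_strong_iff pbound_weak_iff lpu_iff)

lemma seqs_dest:
  assumes "x \<in> seqs s p"
  shows "0 \<le> seq_norm s p x" "pbound s p x (seq_norm s p x)" "pnull s p x"
  using assms
  by (cases s; simp add: seqs_def seq_norm_def pbound_strong_iff pbound_weak_iff lpu_iff pnull_strong
      lp_norm_nonneg lpw_norm_nonneg)+

lemma pbound_imp_lp:
  assumes x: "pbound s p x c" and c: "0 \<le> c"
  shows "(\<lambda>n. cdual_apply \<phi> (x n)) \<in> lp p"
proof (cases "\<phi> = 0")
  case True
  then show ?thesis using p_gt_1 by (simp add: lp_def)
next
  case False
  define \<psi> where "\<psi> = complex_of_real (1 / norm \<phi>) *\<^sub>C \<phi>"
  have "\<psi> \<in> cball 0 1" using False by (simp add: \<psi>_def norm_scaleC norm_divide)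
  then have "(\<lambda>n. cdual_apply \<psi> (x n)) \<in> lp p"
    using lp_iff[OF c, of "\<lambda>n. cdual_apply \<psi> (x n)"] pbound_dual_sum[OF x] by auto
  from lp_scaleC(1)[OF this, of "complex_of_real (norm \<phi>)"] show ?thesis
    using False by (simp add: \<psi>_def scaleC_fun_def scaleC_complex_def cdual_simps)
qed

text \<open>The Hoelder half of the equivalence: the estimate of the partial sums passes to the
  limit.\<close>

lemma p_conv_dominated:
  fixes x :: "nat \<Rightarrow> 'a::cbanach"
  assumes x: "pbound s p x c" "0 \<le> c" and k: "k \<in> p_conv p x"
  shows "cmod (cdual_apply y k) \<le> lp_norm p (\<lambda>n. cdual_apply y (x n))"
proof -
  obtain a where a: "a \<in> lq_ball q" "(\<lambda>n. a n *\<^sub>C x n) sums k"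
    using k unfolding p_conv_def lq_ball_iff by blast
  have "(\<lambda>n. a n * cdual_apply y (x n)) sums cdual_apply y k"
    using bounded_linear.sums[OF bounded_linear_cdual a(2), of y] by (simp add: cdual_simps)
  then have lim: "(\<lambda>N. \<Sum>n<N. a n * cdual_apply y (x n)) \<longlonglongrightarrow> cdual_apply y k"
    by (simp add: sums_def)
  have "cmod (\<Sum>n<N. a n * cdual_apply y (x n)) \<le> lp_norm p (\<lambda>n. cdual_apply y (x n))" for N
    using lq_ball_sum[OF a(1)] lp_norm_bound[OF pbound_imp_lp[OF x]] lp_norm_nonneg
    by (intro Holder_norm_sum) auto
  then show ?thesis by (intro LIMSEQ_le_const2[OF tendsto_norm[OF lim]]) auto
qed

lemma evaluation_seqs:
  fixes x :: "nat \<Rightarrow> 'a::complex_normed_vector"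
  assumes "x \<in> seqs s p"
  shows "(\<lambda>n. evaluation (x n)) \<in> seqs s p \<and> seq_norm s p (\<lambda>n. evaluation (x n)) \<le> seq_norm s p x"
proof -
  have *: "pbound s p (\<lambda>n. evaluation (z n)) c" if "pbound s p z c" for z :: "nat \<Rightarrow> 'a" and c
    unfolding pbound_def
  proof (intro ballI allI)
    fix \<tau> :: "'a cdual cdual \<Rightarrow> real" and N assume \<tau>: "\<tau> \<in> gauges s"
    obtain \<tau>' where \<tau>': "\<tau>' \<in> gauges s" "\<And>x :: 'a. \<tau> (evaluation x) \<le> \<tau>' x"
      using gauge_evaluation[OF \<tau>] by blast
    have "(\<Sum>n<N. \<tau> (evaluation (z n)) powr p) \<le> (\<Sum>n<N. \<tau>' (z n) powr p)"
      using \<tau>'(2) gauge_nonneg[OF \<tau>] p_pos by (intro sum_mono powr_mono2) auto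
    also have "\<dots> \<le> c powr p" by (rule pbound_sum[OF that \<tau>'(1)]) simp
    finally show "(\<Sum>n<N. \<tau> (evaluation (z n)) powr p) \<le> c powr p" .
  qed
  then have "pnull s p (\<lambda>n. evaluation (x n))"
    using seqs_dest(3)[OF assms] unfolding pnull_def by blast
  then show ?thesis using * seqs_dest[OF assms] by (intro seqs_intro) auto
qed

text \<open>The Hahn-Banach half: represent the functional sending \<open>y\<close> to its value at
  \<open>k\<close> through the sequence of values of \<Phi> at \<open>y\<close>.\<close>

lemma dominated_imp_bidual_conv:
  fixes \<Phi> :: "nat \<Rightarrow> 'a::complex_normed_vector cdual cdual"
  assumes \<Phi>: "pbound s p \<Phi> c" "0 \<le> c"
    and le: "\<And>y. cmod (cdual_apply y k) \<le> lp_norm p (\<lambda>n. cdual_apply (\<Phi> n) y)"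
  shows "k \<in> bidual_conv q \<Phi>"
proof -
  obtain a where "\<And>N. (\<Sum>n<N. cmod (a n) powr q) \<le> 1"
      "\<And>y. (\<lambda>n. a n * cdual_apply (\<Phi> n) y) sums cdual_apply y k"
  proof (rule lp_dual_representation[of "\<lambda>y n. cdual_apply (\<Phi> n) y" "\<lambda>y. cdual_apply y k"])
    show "clinear (\<lambda>y n. cdual_apply (\<Phi> n) y)"
      by (simp add: clinear_iff fun_eq_iff cdual_simps scaleC_fun_def scaleC_complex_def)
    show "clinear (\<lambda>y. cdual_apply y k)"
      by (simp add: clinear_iff cdual_simps scaleC_complex_def)
    show "(\<lambda>n. cdual_apply (\<Phi> n) y) \<in> lp p" for y
      using pbound_imp_lp[OF \<Phi>, of "evaluation y"] by simp
  qed (use le in blast)+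
  then show ?thesis unfolding bidual_conv_def lq_ball_def by blast
qed

end

section \<open>The transpose of a weighted holomorphic map\<close>

lemma Hv_bound:
  assumes "f \<in> Hv U v"
  obtains B where "0 \<le> B" "\<And>x. x \<in> U \<Longrightarrow> v x * norm (f x) \<le> B"
proof -
  obtain B where "\<And>x. x \<in> U \<Longrightarrow> v x * norm (f x) \<le> B"
    using assms by (auto simp: Hv_def bdd_above_def)
  then show thesis using that[of "max B 0"] by (simp add: le_max_iff_disj)
qed

text \<open>The positive weight can be moved inside the functional and its modulus. Comparing with a
  bound \<open>C \<ge> 0\<close> instead of computing the supremum covers empty \<open>U\<close>,
  where the norm is 0.\<close>

lemma Hv_norm_transpose_le_iff:
  fixes f :: "'e::cbanach \<Rightarrow> 'f::cbanach"
  assumes v: "weight_on U v" and f: "f \<in> Hv U v" and C: "0 \<le> C"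
  shows "Hv_norm U v (transpose_map f y) \<le> C \<longleftrightarrow>
    (\<forall>k\<in>(\<lambda>x. v x *\<^sub>R f x) ` U. cmod (cdual_apply y k) \<le> C)"
proof -
  obtain B where B: "0 \<le> B" "\<And>x. x \<in> U \<Longrightarrow> v x * norm (f x) \<le> B"
    using Hv_bound[OF f] by blast
  have pos: "0 < v x" if "x \<in> U" for x using v that by (simp add: weight_on_def)
  have "v x * cmod (transpose_map f y x) \<le> norm y * B" if "x \<in> U" for x
  proof -
    have "v x * cmod (transpose_map f y x) \<le> v x * (norm y * norm (f x))"
      using pos[OF that] cdual_le[of y "f x"] by (simp add: transpose_map_def)
    also have "\<dots> \<le> norm y * B"
      using mult_left_mono[OF B(2)[OF that], of "norm y"] by (simp add: mult.left_commute)
    finally show ?thesis .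
  qed
  then have "bdd_above (insert 0 ((\<lambda>x. v x * cmod (transpose_map f y x)) ` U))"
    by (auto intro!: bdd_aboveI2)
  then have "Hv_norm U v (transpose_map f y) \<le> C \<longleftrightarrow>
      (\<forall>t\<in>insert 0 ((\<lambda>x. v x * cmod (transpose_map f y x)) ` U). t \<le> C)"
    unfolding Hv_norm_def by (intro cSup_le_iff) auto
  also have "\<dots> \<longleftrightarrow> (\<forall>k\<in>(\<lambda>x. v x *\<^sub>R f x) ` U. cmod (cdual_apply y k) \<le> C)"
    using C pos by (simp add: transpose_map_def scaleR_scaleC cdual_simps norm_mult less_imp_le)
  finally show ?thesis .
qed

text \<open>\<open>QNp\<close> and \<open>QNup\<close> both include this membership. Holomorphy is
  the chain rule for a bounded complex linear functional, and the weighted bound on \<open>f\<close>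
  bounds the operator.\<close>

lemma transpose_bounded_ops:
  fixes f :: "'e::cbanach \<Rightarrow> 'f::cbanach"
  assumes v: "weight_on U v" and f: "f \<in> Hv U v"
  shows "transpose_map f \<in> bounded_ops (Hv U v) (Hv_norm U v)"
proof -
  obtain B where B: "0 \<le> B" "\<And>x. x \<in> U \<Longrightarrow> v x * norm (f x) \<le> B"
    using Hv_bound[OF f] by blast
  have pos: "0 < v x" if "x \<in> U" for x using v that by (simp add: weight_on_def)
  have le: "v x * cmod (cdual_apply y (f x)) \<le> B * norm y" if "x \<in> U" for x y
  proof -
    have "v x * cmod (cdual_apply y (f x)) \<le> v x * (norm y * norm (f x))"
      using pos[OF that] cdual_le[of y "f x"] by simp
    also have "\<dots> \<le> B * norm y"
      using mult_left_mono[OF B(2)[OF that], of "norm y"] by (simp add: mult_ac)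
    finally show ?thesis .
  qed
  have "clinear (transpose_map f)"
    by (simp add: clinear_iff transpose_map_def fun_eq_iff cdual_simps scaleC_fun_def scaleC_complex_def)
  moreover have "transpose_map f y \<in> Hv U v" for y
    unfolding Hv_def mem_Collect_eq
  proof (intro conjI allI impI)
    show "holomorphic_map_on (transpose_map f y) U"
      unfolding holomorphic_map_on_def
    proof
      fix x assume "x \<in> U"
      then obtain D where D: "clinear D" "(f has_derivative D) (at x)"
        using f by (auto simp: Hv_def holomorphic_map_on_def)
      have "clinear (\<lambda>z. cdual_apply y (D z))"
        using D(1) by (simp add: clinear_iff cdual_simps scaleC_complex_def)
      moreover have "(transpose_map f y has_derivative (\<lambda>z. cdual_apply y (D z))) (at x)"
        using bounded_linear.has_derivative[OF bounded_linear_cdual D(2)]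
        by (simp add: transpose_map_def comp_def)
      ultimately show "\<exists>D. clinear D \<and> (transpose_map f y has_derivative D) (at x)" by blast
    qed
    show "transpose_map f y x = 0" if "x \<notin> U" for x
      using f that by (simp add: transpose_map_def Hv_def)
    show "bdd_above ((\<lambda>x. v x * norm (transpose_map f y x)) ` U)"
      using le by (auto simp: transpose_map_def intro!: bdd_aboveI2)
  qed
  moreover have "Hv_norm U v (transpose_map f y) \<le> B * norm y" for y
    using le[of _ y] B(1) pos
    by (subst Hv_norm_transpose_le_iff[OF v f]) (auto simp: scaleR_scaleC cdual_simps norm_mult less_imp_le)
  ultimately show ?thesis unfolding bounded_ops_def by blast
qed

context conjugate_exponents
begin

text \<open>Going from \<open>X\<close> to \<open>Y\<close> costs nothing, since
  \<open>evaluation\<close> does not increase norms. Going back costs an arbitrarily small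
  \<open>e\<close>, which disappears in the infimum.\<close>

lemma compact_iff_quasi_nuclear:
  fixes f :: "'e::cbanach \<Rightarrow> 'f::cbanach" and s :: bool
  assumes v: "weight_on U v" and f: "f \<in> Hv U v"
  defines "X \<equiv> {x \<in> seqs s p. (\<lambda>x. v x *\<^sub>R f x) ` U \<subseteq> p_conv p x}"
    and "Y \<equiv> {\<Phi> \<in> seqs s p. \<forall>y. Hv_norm U v (transpose_map f y) \<le> lp_norm p (\<lambda>n. cdual_apply (\<Phi> n) y)}"
  shows "(X \<noteq> {} \<longleftrightarrow> Y \<noteq> {}) \<and>
    (X \<noteq> {} \<longrightarrow> (INF x\<in>X. seq_norm s p x) = (INF \<Phi>\<in>Y. seq_norm s p \<Phi>))"
proof -
  have XY: "\<exists>\<Phi>\<in>Y. seq_norm s p \<Phi> \<le> seq_norm s p x" if "x \<in> X" for x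
  proof -
    have x: "x \<in> seqs s p" "(\<lambda>x. v x *\<^sub>R f x) ` U \<subseteq> p_conv p x"
      using that by (auto simp: X_def)
    have "Hv_norm U v (transpose_map f y) \<le> lp_norm p (\<lambda>n. cdual_apply (evaluation (x n)) y)" for y
      using x(2) p_conv_dominated[OF seqs_dest(2,1)[OF x(1)]]
      by (subst Hv_norm_transpose_le_iff[OF v f lp_norm_nonneg]) auto
    then show ?thesis
      using evaluation_seqs[OF x(1)] by (intro bexI[of _ "\<lambda>n. evaluation (x n)"]) (auto simp: Y_def)
  qed
  have YX: "\<exists>x\<in>X. seq_norm s p x \<le> seq_norm s p \<Phi> + e" if "\<Phi> \<in> Y" "0 < e" for \<Phi> e
  proof -
    have \<Phi>: "\<Phi> \<in> seqs s p"
        "\<And>y. Hv_norm U v (transpose_map f y) \<le> lp_norm p (\<lambda>n. cdual_apply (\<Phi> n) y)"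
      using that by (auto simp: Y_def)
    have "(\<lambda>x. v x *\<^sub>R f x) ` U \<subseteq> bidual_conv q \<Phi>"
    proof
      fix k assume k: "k \<in> (\<lambda>x. v x *\<^sub>R f x) ` U"
      show "k \<in> bidual_conv q \<Phi>"
        using \<Phi>(2) Hv_norm_transpose_le_iff[OF v f lp_norm_nonneg] k
        by (intro dominated_imp_bidual_conv[OF seqs_dest(2,1)[OF \<Phi>(1)]]) blast
    qed
    from p_conv_of_bidual_conv[OF seqs_dest(2,3,1)[OF \<Phi>(1)] this that(2)]
    obtain z where "pbound s p z (seq_norm s p \<Phi> + e)" "pnull s p z"
        "(\<lambda>x. v x *\<^sub>R f x) ` U \<subseteq> p_conv p z" by blast
    then show ?thesis
      using seqs_intro[of s z "seq_norm s p \<Phi> + e"] seqs_dest(1)[OF \<Phi>(1)] that(2)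
      by (intro bexI[of _ z]) (auto simp: X_def)
  qed
  have ne: "X \<noteq> {} \<longleftrightarrow> Y \<noteq> {}" using XY YX[OF _ zero_less_one] by blast
  moreover have "(INF x\<in>X. seq_norm s p x) = (INF \<Phi>\<in>Y. seq_norm s p \<Phi>)" if X: "X \<noteq> {}"
  proof (rule antisym)
    have bdd: "bdd_below (seq_norm s p ` X)" "bdd_below (seq_norm s p ` Y)"
      by (auto simp: X_def Y_def intro!: bdd_belowI2[of _ 0] seqs_dest(1))
    show "(INF x\<in>X. seq_norm s p x) \<le> (INF \<Phi>\<in>Y. seq_norm s p \<Phi>)"
    proof (intro cINF_greatest)
      show "Y \<noteq> {}" using ne X by simp
      fix \<Phi> assume \<Phi>: "\<Phi> \<in> Y"
      show "(INF x\<in>X. seq_norm s p x) \<le> seq_norm s p \<Phi>"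
      proof (rule field_le_epsilon)
        fix e :: real assume "0 < e"
        then obtain x where "x \<in> X" "seq_norm s p x \<le> seq_norm s p \<Phi> + e" using YX[OF \<Phi>] by blast
        then show "(INF x\<in>X. seq_norm s p x) \<le> seq_norm s p \<Phi> + e"
          using cINF_lower[OF bdd(1)] order_trans by blast
      qed
    qed
    show "(INF \<Phi>\<in>Y. seq_norm s p \<Phi>) \<le> (INF x\<in>X. seq_norm s p x)"
      using X XY cINF_lower[OF bdd(2)] by (intro cINF_greatest) (auto intro: order_trans)
  qed
  ultimately show ?thesis by blast
qed

end

theorem corollary2p15:
  fixes U :: "'e::cbanach set" and v :: "'e \<Rightarrow> real" and p :: real
    and f :: "'e \<Rightarrow> 'f::cbanach"
  assumes "open U" and "weight_on U v" and "1 < p" and "f \<in> Hv U v"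
  shows "(f \<in> Hv_Kp U v p \<longleftrightarrow> transpose_map f \<in> QNp p (Hv U v) (Hv_norm U v)) \<and>
    (f \<in> Hv_Kp U v p \<longrightarrow>
      Hv_Kp_norm U v p f = QNp_norm p (Hv_norm U v) (transpose_map f)) \<and>
    (f \<in> Hv_Kup U v p \<longleftrightarrow> transpose_map f \<in> QNup p (Hv U v) (Hv_norm U v)) \<and>
    (f \<in> Hv_Kup U v p \<longrightarrow>
      Hv_Kup_norm U v p f = QNup_norm p (Hv_norm U v) (transpose_map f))"
proof -
  interpret conjugate_exponents p "conj_index p"
    by unfold_locales (use assms(3) in \<open>auto simp: conj_index_def field_simps\<close>)
  note T = transpose_bounded_ops[OF assms(2,4)]
  note strong = compact_iff_quasi_nuclear[OF assms(2,4), where s=True]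
  note weak = compact_iff_quasi_nuclear[OF assms(2,4), where s=False]
  show ?thesis
    using strong weak assms(4) T
    by (auto simp: Hv_Kp_def Hv_Kup_def Hv_Kp_norm_def Hv_Kup_norm_def m_Kp_def m_Kup_def
        rel_p_compact_def rel_up_compact_def QNp_def QNup_def QNp_norm_def QNup_norm_def
        seqs_def seq_norm_def)
qed

end
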